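(* Let $n\ge 3$ and let $M^n$ be a non-Einstein weakly Einstein hypersurface of a space form $\overline{M}^{n+1}(c)$ of constant curvature $c$. Suppose that $M^n$ is semisymmetric, i.e. $R(X,Y)\cdot R=0$ for all tangent vector fields $X,Y$. Then $c\neq 0$, and the following hold: (i) If $c>0$, then $M^n$ is locally isometric to $\mathbb{S}^{p}(\sin^{-2}\theta)\times\mathbb{S}^{q}(\cos^{-2}\theta)$, where $\cos\theta,\sin\theta>0$ and $\tan^4\theta=\frac{p-1}{q-1}$. (ii) If $c<0$, then $M^n$ is locally isometric to $\mathbb{S}^{p}(\sinh^{-2}\theta)\times\mathbb{H}^{q}(-\cosh^{-2}\theta)$, where $\sinh\theta>0$ and $\tanh^4\theta=\frac{p-1}{q-1}$. In both cases, $n=p+q$ and $p\neq q$ (so $n$ can not be even).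
   Context: $R(X,Y)=[\nabla_X,\nabla_Y]-\nabla_{[X,Y]}$ is the curvature tensor of $M^n$ with the induced metric, and $R(X,Y,Z,W)=\langle R(X,Y)Z,W\rangle$. An $n$-dimensional Riemannian manifold $(M,g)$ is weakly Einstein if $\check R(X,Y)=\frac{\|R\|^2}{n}g(X,Y)$ for all vector fields $X,Y$, where $\check R(X,Y)=\sum_{i,j,k=1}^n R(X,e_i,e_j,e_k)R(Y,e_i,e_j,e_k)$ for a local orthonormal frame $\{e_i\}$. In the semisymmetric condition, the endomorphism $R(X,Y)$ acts on $R$ as a derivation: $(R(X,Y)\cdot R)(U,V)=[R(X,Y),R(U,V)]-R(R(X,Y)U,V)-R(U,R(X,Y)V)$. $\mathbb{S}^m(k)$ (for $k>0$) denotes the $m$-dimensional sphere of constant sectional curvature $k$, and $\mathbb{H}^m(k)$ (for $k<0$) denotes the $m$-dimensional hyperbolic space of constant sectional curvature $k$. Products are Riemannian products.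
   Formalization: The printed curvatures are right only for c = 1 and c = -1, so they are multiplied by |c|; the remark that n can not be even is false (p = 2, q = 4 gives n = 6) and is dropped; M is connected and the space form is the standard simply connected one. *)

theory Defs
  imports "HOL-Analysis.Analysis"
begin

section \<open>Smooth functions and smooth manifolds\<close>

definition ddir :: "('a::real_normed_vector \<Rightarrow> 'b::real_normed_vector) \<Rightarrow> 'a \<Rightarrow> 'a \<Rightarrow> 'b" where
  "ddir f y v = frechet_derivative f (at y) v"

text \<open>\<open>Ck_on k U f\<close>, for \<open>U\<close> open: all iterated directional derivatives of \<open>f\<close> up to
  order \<open>k\<close> exist and are continuous on \<open>U\<close>.\<close>

fun Ck_on :: "nat \<Rightarrow> 'a::euclidean_space set \<Rightarrow> ('a \<Rightarrow> 'b::real_normed_vector) \<Rightarrow> bool" where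
  "Ck_on 0 U f = continuous_on U f"
| "Ck_on (Suc k) U f =
     ((\<forall>y\<in>U. f differentiable (at y)) \<and> (\<forall>v. Ck_on k U (\<lambda>y. ddir f y v)))"

definition smooth_on :: "'a::euclidean_space set \<Rightarrow> ('a \<Rightarrow> 'b::real_normed_vector) \<Rightarrow> bool" where
  "smooth_on U f \<longleftrightarrow> (\<forall>k. Ck_on k U f)"

text \<open>A chart is a domain together with a coordinate map that is meaningful on the domain only.\<close>

type_synonym ('a, 'n) chart = "'a set \<times> ('a \<Rightarrow> real ^ 'n)"

definition chart_range :: "('a, 'n::finite) chart \<Rightarrow> (real ^ 'n) set" where
  "chart_range ch = snd ch ` fst ch"

definition chart_inv :: "('a, 'n::finite) chart \<Rightarrow> real ^ 'n \<Rightarrow> 'a" where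
  "chart_inv ch = inv_into (fst ch) (snd ch)"

text \<open>Manifolds of dimension \<open>CARD('n)\<close>.\<close>

definition smooth_manifold :: "'a topology \<Rightarrow> ('a, 'n::finite) chart set \<Rightarrow> bool" where
  "smooth_manifold X A \<longleftrightarrow>
     Hausdorff_space X \<and> second_countable X \<and>
     (\<Union>ch\<in>A. fst ch) = topspace X \<and>
     (\<forall>ch\<in>A. openin X (fst ch) \<and> open (chart_range ch) \<and>
        homeomorphic_map (subtopology X (fst ch)) (top_of_set (chart_range ch)) (snd ch)) \<and>
     (\<forall>ch\<in>A. \<forall>ch'\<in>A. smooth_on (snd ch ` (fst ch \<inter> fst ch')) (snd ch' \<circ> chart_inv ch))"

section \<open>The standard space forms and their products\<close>

text \<open>The model spaces are submanifolds of a coordinate space \<open>\<real>\<^sup>I\<close>, with the metric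
  induced by a constant symmetric bilinear form. Dimensions have to be natural numbers that can be
  quantified over, so \<open>\<real>\<^sup>m\<close> is the space of sequences vanishing from index \<open>m\<close> on. On
  such a set the product topology of \<open>nat \<Rightarrow> real\<close> is the Euclidean one.\<close>

record 'i model =
  pts :: "('i \<Rightarrow> real) set"
  bform :: "('i \<Rightarrow> real) \<Rightarrow> ('i \<Rightarrow> real) \<Rightarrow> real"

definition euclidean_model :: "nat \<Rightarrow> nat model" where
  "euclidean_model m =
     \<lparr>pts = {u. \<forall>i\<ge>m. u i = 0}, bform = (\<lambda>u v. \<Sum>i<m. u i * v i)\<rparr>"

text \<open>\<open>\<S>\<^sup>m(k)\<close>: the round sphere of radius \<open>1 / sqrt k\<close> in \<open>\<real>\<^sup>m\<^sup>+\<^sup>1\<close>, for \<open>k > 0\<close>.\<close>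

definition sphere_model :: "nat \<Rightarrow> real \<Rightarrow> nat model" where
  "sphere_model m k =
     (let B = (\<lambda>u v. \<Sum>i\<le>m. u i * v i)
      in \<lparr>pts = {u. (\<forall>i>m. u i = 0) \<and> B u u = 1 / k}, bform = B\<rparr>)"

text \<open>\<open>\<H>\<^sup>m(k)\<close>: one sheet of a hyperboloid in the Lorentz space \<open>\<real>\<^sup>m\<^sup>,\<^sup>1\<close>, for \<open>k < 0\<close>;
  the coordinate with index \<open>0\<close> is the timelike one.\<close>

definition hyperbolic_model :: "nat \<Rightarrow> real \<Rightarrow> nat model" where
  "hyperbolic_model m k =
     (let B = (\<lambda>u v. (\<Sum>i=1..m. u i * v i) - u 0 * v 0)
      in \<lparr>pts = {u. (\<forall>i>m. u i = 0) \<and> u 0 > 0 \<and> B u u = 1 / k}, bform = B\<rparr>)"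

definition space_form :: "nat \<Rightarrow> real \<Rightarrow> nat model" where
  "space_form m c =
     (if c > 0 then sphere_model m c
      else if c < 0 then hyperbolic_model m c
      else euclidean_model m)"

definition product_model :: "'i model \<Rightarrow> 'j model \<Rightarrow> ('i + 'j) model" where
  "product_model S T =
     \<lparr>pts = {w. w \<circ> Inl \<in> pts S \<and> w \<circ> Inr \<in> pts T},
      bform = (\<lambda>w z. bform S (w \<circ> Inl) (z \<circ> Inl) + bform T (w \<circ> Inr) (z \<circ> Inr))\<rparr>"

section \<open>Immersions and the induced metric\<close>

definition differential ::
  "('a \<Rightarrow> 'i \<Rightarrow> real) \<Rightarrow> ('a, 'n::finite) chart \<Rightarrow> real ^ 'n \<Rightarrow> real ^ 'n \<Rightarrow> 'i \<Rightarrow> real" where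
  "differential F ch y v = (\<lambda>i. ddir (\<lambda>z. F (chart_inv ch z) i) y v)"

definition smooth_map_on ::
  "('a, 'n::finite) chart set \<Rightarrow> 'a set \<Rightarrow> ('a \<Rightarrow> 'i \<Rightarrow> real) \<Rightarrow> bool" where
  "smooth_map_on A U F \<longleftrightarrow>
     (\<forall>ch\<in>A. \<forall>i. smooth_on (snd ch ` (fst ch \<inter> U)) (\<lambda>y. F (chart_inv ch y) i))"

definition immersion ::
  "'a topology \<Rightarrow> ('a, 'n::finite) chart set \<Rightarrow> 'i model \<Rightarrow> ('a \<Rightarrow> 'i \<Rightarrow> real) \<Rightarrow> bool" where
  "immersion X A S F \<longleftrightarrow>
     F ` topspace X \<subseteq> pts S \<and> smooth_map_on A (topspace X) F \<and>
     (\<forall>ch\<in>A. \<forall>y\<in>chart_range ch. inj (differential F ch y))"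

text \<open>A Riemannian metric is represented by its expression in every chart.\<close>

type_synonym 'n local_metric = "real ^ 'n \<Rightarrow> real ^ 'n \<Rightarrow> real ^ 'n \<Rightarrow> real"

definition induced_metric ::
  "'i model \<Rightarrow> ('a \<Rightarrow> 'i \<Rightarrow> real) \<Rightarrow> ('a, 'n::finite) chart \<Rightarrow> 'n local_metric" where
  "induced_metric S F ch y v w = bform S (differential F ch y v) (differential F ch y w)"

text \<open>The map \<open>\<Phi>\<close> below preserves the metric, hence is an immersion; being also a homeomorphism
  onto a relatively open subset of \<open>pts S\<close>, it is a diffeomorphism onto that subset.\<close>

definition locally_isometric ::
  "'a topology \<Rightarrow> ('a, 'n::finite) chart set \<Rightarrow> (('a, 'n) chart \<Rightarrow> 'n local_metric)
     \<Rightarrow> 'i model \<Rightarrow> bool" where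
  "locally_isometric X A g S \<longleftrightarrow>
     (\<forall>x\<in>topspace X. \<exists>U W \<Phi>.
        openin X U \<and> x \<in> U \<and> openin (top_of_set (pts S)) W \<and>
        homeomorphic_map (subtopology X U) (top_of_set W) \<Phi> \<and>
        smooth_map_on A U \<Phi> \<and>
        (\<forall>ch\<in>A. \<forall>y\<in>snd ch ` (fst ch \<inter> U). \<forall>v w.
           bform S (differential \<Phi> ch y v) (differential \<Phi> ch y w) = g ch y v w))"

section \<open>Curvature\<close>

definition gram :: "'n::finite local_metric \<Rightarrow> real ^ 'n \<Rightarrow> real ^ 'n ^ 'n" where
  "gram g y = (\<chi> i j. g y (axis i 1) (axis j 1))"

text \<open>The bilinear extension of the Christoffel symbols
  \<open>\<Gamma>\<^sup>k\<^sub>i\<^sub>j = \<Sum>\<^sub>l g\<^sup>k\<^sup>l (\<partial>\<^sub>i g\<^sub>j\<^sub>l + \<partial>\<^sub>j g\<^sub>i\<^sub>l - \<partial>\<^sub>l g\<^sub>i\<^sub>j) / 2\<close>.\<close>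

definition christoffel ::
  "'n::finite local_metric \<Rightarrow> real ^ 'n \<Rightarrow> real ^ 'n \<Rightarrow> real ^ 'n \<Rightarrow> real ^ 'n" where
  "christoffel g y v w =
     (1 / 2) *\<^sub>R (matrix_inv (gram g y) *v
        (\<chi> l. ddir (\<lambda>z. g z w (axis l 1)) y v + ddir (\<lambda>z. g z v (axis l 1)) y w
              - ddir (\<lambda>z. g z v w) y (axis l 1)))"

text \<open>Levi-Civita covariant derivative \<open>\<nabla>\<^sub>X Y\<close> of vector fields in coordinates.\<close>

definition nabla ::
  "'n::finite local_metric \<Rightarrow> (real ^ 'n \<Rightarrow> real ^ 'n) \<Rightarrow> (real ^ 'n \<Rightarrow> real ^ 'n)
     \<Rightarrow> real ^ 'n \<Rightarrow> real ^ 'n" where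
  "nabla g X Y = (\<lambda>y. ddir Y y (X y) + christoffel g y (X y) (Y y))"

definition lie_bracket ::
  "(real ^ 'n::finite \<Rightarrow> real ^ 'n) \<Rightarrow> (real ^ 'n \<Rightarrow> real ^ 'n) \<Rightarrow> real ^ 'n \<Rightarrow> real ^ 'n" where
  "lie_bracket X Y = (\<lambda>y. ddir Y y (X y) - ddir X y (Y y))"

definition curvature_field ::
  "'n::finite local_metric \<Rightarrow> (real ^ 'n \<Rightarrow> real ^ 'n) \<Rightarrow> (real ^ 'n \<Rightarrow> real ^ 'n)
     \<Rightarrow> (real ^ 'n \<Rightarrow> real ^ 'n) \<Rightarrow> real ^ 'n \<Rightarrow> real ^ 'n" where
  "curvature_field g X Y Z = (\<lambda>y.
     nabla g X (nabla g Y Z) y - nabla g Y (nabla g X Z) y - nabla g (lie_bracket X Y) Z y)"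

text \<open>The curvature is tensorial, so its value on tangent vectors at \<open>y\<close> may be computed with the
  extensions that are constant in the chart.\<close>

definition curv ::
  "'n::finite local_metric \<Rightarrow> real ^ 'n \<Rightarrow> real ^ 'n \<Rightarrow> real ^ 'n \<Rightarrow> real ^ 'n \<Rightarrow> real ^ 'n" where
  "curv g y v w u = curvature_field g (\<lambda>_. v) (\<lambda>_. w) (\<lambda>_. u) y"

definition curv4 ::
  "'n::finite local_metric \<Rightarrow> real ^ 'n \<Rightarrow> real ^ 'n \<Rightarrow> real ^ 'n \<Rightarrow> real ^ 'n \<Rightarrow> real ^ 'n \<Rightarrow> real" where
  "curv4 g y v w u t = g y (curv g y v w u) t"

definition orthonormal_frame ::
  "'n::finite local_metric \<Rightarrow> real ^ 'n \<Rightarrow> ('n \<Rightarrow> real ^ 'n) \<Rightarrow> bool" where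
  "orthonormal_frame g y e \<longleftrightarrow> (\<forall>i j. g y (e i) (e j) = (if i = j then 1 else 0))"

text \<open>The following contractions do not depend on the choice of the orthonormal frame \<open>e\<close>.\<close>

definition R_check ::
  "'n::finite local_metric \<Rightarrow> real ^ 'n \<Rightarrow> ('n \<Rightarrow> real ^ 'n) \<Rightarrow> real ^ 'n \<Rightarrow> real ^ 'n \<Rightarrow> real" where
  "R_check g y e v w =
     (\<Sum>i\<in>UNIV. \<Sum>j\<in>UNIV. \<Sum>k\<in>UNIV.
        curv4 g y v (e i) (e j) (e k) * curv4 g y w (e i) (e j) (e k))"

definition R_norm_sq :: "'n::finite local_metric \<Rightarrow> real ^ 'n \<Rightarrow> ('n \<Rightarrow> real ^ 'n) \<Rightarrow> real" where
  "R_norm_sq g y e =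
     (\<Sum>i\<in>UNIV. \<Sum>j\<in>UNIV. \<Sum>k\<in>UNIV. \<Sum>l\<in>UNIV. (curv4 g y (e i) (e j) (e k) (e l))\<^sup>2)"

definition ricci ::
  "'n::finite local_metric \<Rightarrow> real ^ 'n \<Rightarrow> ('n \<Rightarrow> real ^ 'n) \<Rightarrow> real ^ 'n \<Rightarrow> real ^ 'n \<Rightarrow> real" where
  "ricci g y e v w = (\<Sum>i\<in>UNIV. curv4 g y (e i) v w (e i))"

definition scalar_curv :: "'n::finite local_metric \<Rightarrow> real ^ 'n \<Rightarrow> ('n \<Rightarrow> real ^ 'n) \<Rightarrow> real" where
  "scalar_curv g y e = (\<Sum>i\<in>UNIV. ricci g y e (e i) (e i))"

definition einstein ::
  "('a, 'n::finite) chart set \<Rightarrow> (('a, 'n) chart \<Rightarrow> 'n local_metric) \<Rightarrow> bool" where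
  "einstein A g \<longleftrightarrow>
     (\<forall>ch\<in>A. \<forall>y\<in>chart_range ch. \<forall>e. orthonormal_frame (g ch) y e \<longrightarrow>
        (\<forall>v w. ricci (g ch) y e v w = scalar_curv (g ch) y e / real CARD('n) * g ch y v w))"

definition weakly_einstein ::
  "('a, 'n::finite) chart set \<Rightarrow> (('a, 'n) chart \<Rightarrow> 'n local_metric) \<Rightarrow> bool" where
  "weakly_einstein A g \<longleftrightarrow>
     (\<forall>ch\<in>A. \<forall>y\<in>chart_range ch. \<forall>e. orthonormal_frame (g ch) y e \<longrightarrow>
        (\<forall>v w. R_check (g ch) y e v w = R_norm_sq (g ch) y e / real CARD('n) * g ch y v w))"

text \<open>\<open>curv_action g y v w a b\<close> is the endomorphism \<open>(R(v,w) \<cdot> R)(a,b)\<close> of the tangent space.\<close>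

definition curv_action ::
  "'n::finite local_metric \<Rightarrow> real ^ 'n \<Rightarrow> real ^ 'n \<Rightarrow> real ^ 'n \<Rightarrow> real ^ 'n \<Rightarrow> real ^ 'n
     \<Rightarrow> real ^ 'n \<Rightarrow> real ^ 'n" where
  "curv_action g y v w a b = (\<lambda>u.
     (curv g y v w (curv g y a b u) - curv g y a b (curv g y v w u))
     - curv g y (curv g y v w a) b u
     - curv g y a (curv g y v w b) u)"

definition semisymmetric ::
  "('a, 'n::finite) chart set \<Rightarrow> (('a, 'n) chart \<Rightarrow> 'n local_metric) \<Rightarrow> bool" where
  "semisymmetric A g \<longleftrightarrow>
     (\<forall>ch\<in>A. \<forall>y\<in>chart_range ch. \<forall>v w a b. curv_action (g ch) y v w a b = (\<lambda>_. 0))"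

end

theory Submission
  imports Defs
begin

text \<open>By the Gauss equation the curvature operator at a point is diagonal in a principal frame, with
  sectional curvatures \<open>K\<^sub>i\<^sub>j = c + \<lambda>\<^sub>i \<lambda>\<^sub>j\<close>. Semisymmetry gives \<open>K\<^sub>i\<^sub>j (\<lambda>\<^sub>j - \<lambda>\<^sub>i) \<lambda>\<^sub>k = 0\<close> for distinct
  \<open>i, j, k\<close>, and the weak Einstein condition says that \<open>\<Sum>\<^sub>i K\<^sub>a\<^sub>i\<^sup>2\<close> does not depend on \<open>a\<close>. Hence a point is
  Einstein, or \<open>c \<noteq> 0\<close> and there are exactly two principal curvatures \<open>\<lambda>, \<mu>\<close>, of multiplicities \<open>p < q\<close>,
  with \<open>\<lambda> \<mu> = - c\<close> and \<open>(p - 1) \<lambda>\<^sup>2 = (q - 1) \<mu>\<^sup>2\<close>. These finitely many conditions are closed and mutually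
  exclusive, so by connectedness the same one holds everywhere.

  With \<open>N\<close> the unit normal, \<open>\<Phi> = (N + \<mu> f) / (\<mu> - \<lambda>)\<close> and \<open>\<Psi> = (N + \<lambda> f) / (\<lambda> - \<mu>)\<close> satisfy
  \<open>\<Phi> + \<Psi> = f\<close>, are constant along one principal distribution each, and have constant squared
  lengths. The form \<open>\<langle>X Y \<Phi>, Z \<Psi>\<rangle>\<close> is totally symmetric and therefore vanishes, so \<open>\<Phi>\<close> and \<open>\<Psi>\<close> stay in
  two fixed orthogonal subspaces of the ambient space: \<open>f\<close> itself, in suitable linear coordinates,
  is an open part of the product of the two quadrics.\<close>

section \<open>Calculus of smooth functions\<close>

text \<open>Principal distributions appear only through pointwise frames: neither their smoothness
  nor their integrability is established, and no splitting theorem for Riemannian manifolds is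
  invoked. This works because \<Phi> and \<Psi> are algebraic in \<open>N\<close> and
  \<open>f\<close>, hence smooth. On the \<lambda>-space \<open>dN = - \<lambda> df\<close>, so
  \<open>N + \<lambda> f\<close> has zero derivative there; likewise for \<mu>. The denominators
  normalise the sum to \<open>f\<close>. Orthogonality is the equation
  \<open>\<lambda> \<mu> = - c\<close> once more: \<open>N\<close> has length one and
  \<open>f\<close> has squared length \<open>1 / c\<close>, so the product of
  \<open>N + \<mu> f\<close> and \<open>N + \<lambda> f\<close> is
  \<open>1 + \<lambda> \<mu> / c\<close>. A second obstacle is the sign of the normal. No global
  unit normal is given, and the scalar second fundamental form is defined only up to sign. Global
  conditions are therefore phrased with inner products of normal vectors; a sign is fixed only
  locally, where the splitting is built. Existence of a frame with prescribed values of these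
  products is a closed condition, because orthonormal frames over a convergent sequence of points
  have a convergent subsequence.\<close>

lemma ddirI: "(f has_derivative f') (at y) \<Longrightarrow> ddir f y v = f' v"
  unfolding ddir_def by (metis frechet_derivative_at)

lemma ddir_const [simp]: "ddir (\<lambda>_. a) y v = 0"
  by (rule ddirI) simp

lemma ddir_cong:
  assumes "open U" "y \<in> U" "f differentiable (at y)" "\<And>z. z \<in> U \<Longrightarrow> f z = h z"
  shows "ddir f y v = ddir h y v"
  unfolding ddir_def using assms frechet_derivative_transform_within_open by metis

lemma Ck_on_subset: "Ck_on k U f \<Longrightarrow> V \<subseteq> U \<Longrightarrow> Ck_on k V f"
  by (induction k arbitrary: f) (auto intro: continuous_on_subset)

lemma Ck_on_cong:
  assumes "open U"
  shows "Ck_on k U f \<Longrightarrow> (\<And>y. y \<in> U \<Longrightarrow> f y = h y) \<Longrightarrow> Ck_on k U h"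
proof (induction k arbitrary: f h)
  case 0
  then show ?case by (metis Ck_on.simps(1) continuous_on_cong)
next
  case (Suc k)
  have d: "h differentiable (at y)" if "y \<in> U" for y
    using Suc.prems that assms
    by (metis Ck_on.simps(2) differentiable_def has_derivative_transform_within_open)
  moreover have "Ck_on k U (\<lambda>y. ddir h y v)" for v
    by (rule Suc.IH[of "\<lambda>y. ddir f y v"])
      (use Suc.prems assms in \<open>auto intro: ddir_cong\<close>)
  ultimately show ?case by simp
qed

lemma Ck_on_SucD: "Ck_on (Suc k) U f \<Longrightarrow> Ck_on k U f"
proof (induction k arbitrary: f)
  case 0
  then show ?case
    by (auto intro!: continuous_at_imp_continuous_on differentiable_imp_continuous_within)
next
  case (Suc k)
  then show ?case by (simp only: Ck_on.simps(2)) blast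
qed

declare Ck_on.simps(2) [simp del]

lemma Ck_on_differentiable: "Ck_on (Suc k) U f \<Longrightarrow> y \<in> U \<Longrightarrow> (f has_derivative ddir f y) (at y)"
  unfolding ddir_def by (metis Ck_on.simps(2) frechet_derivative_works)

text \<open>The closure proofs below work with an explicit derivative \<open>f'\<close>; openness of
  \<open>U\<close> allows \<open>ddir f\<close> to be replaced by it inside
  \<open>Ck_on\<close>.\<close>

lemma Ck_on_SucI:
  assumes "open U" "\<And>y. y \<in> U \<Longrightarrow> (f has_derivative f' y) (at y)"
    "\<And>v. Ck_on k U (\<lambda>y. f' y v)"
  shows "Ck_on (Suc k) U f"
proof -
  have "Ck_on k U (\<lambda>y. ddir f y v)" for v
    by (rule Ck_on_cong[OF assms(1) assms(3)[of v]]) (simp add: ddirI[OF assms(2)])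
  then show ?thesis
    unfolding Ck_on.simps(2) using assms(2) by (auto intro: differentiableI)
qed

lemma Ck_on_const: "Ck_on k U (\<lambda>_. a)"
  by (induction k arbitrary: a) (auto simp: Ck_on.simps(2))

lemma Ck_on_ddir: "Ck_on (Suc k) U f \<Longrightarrow> Ck_on k U (\<lambda>y. ddir f y v)"
  by (simp add: Ck_on.simps(2))

lemma Ck_on_linear:
  assumes L: "bounded_linear L" and U: "open U"
  shows "Ck_on k U f \<Longrightarrow> Ck_on k U (\<lambda>y. L (f y))"
proof (induction k arbitrary: f)
  case 0
  then show ?case using L by (simp add: bounded_linear.continuous_on)
next
  case (Suc k)
  then show ?case
    by (intro Ck_on_SucI[OF U, where f'="\<lambda>y v. L (ddir f y v)"])
      (auto intro: bounded_linear.has_derivative[OF L] Ck_on_differentiable Ck_on_ddir)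
qed

lemma Ck_on_add:
  assumes U: "open U"
  shows "Ck_on k U f \<Longrightarrow> Ck_on k U h \<Longrightarrow> Ck_on k U (\<lambda>y. f y + h y)"
proof (induction k arbitrary: f h)
  case 0
  then show ?case by (auto intro: continuous_intros)
next
  case (Suc k)
  then show ?case
    by (intro Ck_on_SucI[OF U, where f'="\<lambda>y v. ddir f y v + ddir h y v"])
      (auto intro: has_derivative_add Ck_on_differentiable Ck_on_ddir)
qed

lemma Ck_on_bilinear:
  assumes P: "bounded_bilinear P" and U: "open U"
  shows "Ck_on k U f \<Longrightarrow> Ck_on k U h \<Longrightarrow> Ck_on k U (\<lambda>y. P (f y) (h y))"
proof (induction k arbitrary: f h)
  case 0
  then show ?case using P by (simp add: bounded_bilinear.continuous_on)
next
  case (Suc k)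
  show ?case
  proof (rule Ck_on_SucI[OF U])
    show "((\<lambda>y. P (f y) (h y)) has_derivative (\<lambda>v. P (f y) (ddir h y v) + P (ddir f y v) (h y))) (at y)"
      if "y \<in> U" for y
      using Suc.prems that by (intro bounded_bilinear.FDERIV[OF P] Ck_on_differentiable)
    show "Ck_on k U (\<lambda>y. P (f y) (ddir h y v) + P (ddir f y v) (h y))" for v
      using Suc.prems by (intro Ck_on_add[OF U] Suc.IH) (auto intro: Ck_on_SucD Ck_on_ddir)
  qed
qed

lemma Ck_on_sum:
  assumes U: "open U" and "\<And>i. i \<in> I \<Longrightarrow> Ck_on k U (f i)"
  shows "Ck_on k U (\<lambda>y. \<Sum>i\<in>I. f i y)"
  using assms(2)
  by (induction I rule: infinite_finite_induct) (auto intro: Ck_on_const Ck_on_add[OF U])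

text \<open>The derivative of \<open>1 / f\<close> is a polynomial in \<open>1 / f\<close> and the
  derivative of \<open>f\<close>, so the induction can keep \<open>f\<close> fixed.\<close>

lemma Ck_on_inverse:
  fixes f :: "'a::euclidean_space \<Rightarrow> real"
  assumes U: "open U" and nz: "\<And>y. y \<in> U \<Longrightarrow> f y \<noteq> 0"
  shows "Ck_on k U f \<Longrightarrow> Ck_on k U (\<lambda>y. inverse (f y))"
proof (induction k)
  case 0
  then show ?case using nz by (auto intro: continuous_intros)
next
  case (Suc k)
  show ?case
  proof (rule Ck_on_SucI[OF U])
    show "((\<lambda>y. inverse (f y)) has_derivative
        (\<lambda>v. - (inverse (f y) * ddir f y v * inverse (f y)))) (at y)" if "y \<in> U" for y
      using Suc.prems that nz by (intro Deriv.has_derivative_inverse Ck_on_differentiable) auto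
    have "Ck_on k U (\<lambda>y. (- 1) * (inverse (f y) * ddir f y v * inverse (f y)))" for v
      using Suc Ck_on_SucD[OF Suc.prems]
      by (intro Ck_on_bilinear[OF bounded_bilinear_mult U] Ck_on_const Ck_on_ddir)
    then show "Ck_on k U (\<lambda>y. - (inverse (f y) * ddir f y v * inverse (f y)))" for v
      by simp
  qed
qed

lemma Ck_on_sqrt:
  fixes f :: "'a::euclidean_space \<Rightarrow> real"
  assumes U: "open U" and pos: "\<And>y. y \<in> U \<Longrightarrow> f y > 0"
  shows "Ck_on k U f \<Longrightarrow> Ck_on k U (\<lambda>y. sqrt (f y))"
proof (induction k)
  case 0
  then show ?case by (auto intro: continuous_intros)
next
  case (Suc k)
  show ?case
  proof (rule Ck_on_SucI[OF U])
    show "((\<lambda>y. sqrt (f y)) has_derivative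
        (\<lambda>v. inverse (sqrt (f y)) * ((1/2) * ddir f y v))) (at y)" if "y \<in> U" for y
    proof -
      have "((\<lambda>y. sqrt (f y)) has_derivative (\<lambda>v. ddir f y v * (inverse (sqrt (f y)) / 2))) (at y)"
        using that pos Suc.prems by (intro has_derivative_real_sqrt Ck_on_differentiable) auto
      then show ?thesis by (simp add: mult_ac)
    qed
    show "Ck_on k U (\<lambda>y. inverse (sqrt (f y)) * ((1/2) * ddir f y v))" for v
      using Suc Ck_on_SucD[OF Suc.prems] less_imp_neq[OF pos]
      by (intro Ck_on_bilinear[OF bounded_bilinear_mult U] Ck_on_inverse[OF U] Ck_on_const Ck_on_ddir) fastforce+
  qed
qed

lemma linear_eq_sum_Basis:
  assumes "linear L"
  shows "L x = (\<Sum>b\<in>Basis. (x \<bullet> b) *\<^sub>R L b)"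
proof -
  have "L x = L (\<Sum>b\<in>Basis. (x \<bullet> b) *\<^sub>R b)" by (simp add: euclidean_representation)
  then show ?thesis by (simp add: linear_sum[OF assms] linear_cmul[OF assms])
qed

section \<open>Closure properties of smooth functions\<close>

lemma smooth_on_subset: "smooth_on U f \<Longrightarrow> V \<subseteq> U \<Longrightarrow> smooth_on V f"
  unfolding smooth_on_def by (blast intro: Ck_on_subset)

lemma smooth_on_cong:
  "open U \<Longrightarrow> smooth_on U f \<Longrightarrow> (\<And>y. y \<in> U \<Longrightarrow> f y = h y) \<Longrightarrow> smooth_on U h"
  unfolding smooth_on_def by (blast intro: Ck_on_cong)

lemma smooth_on_has_derivative:
  "smooth_on U f \<Longrightarrow> y \<in> U \<Longrightarrow> (f has_derivative ddir f y) (at y)"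
  unfolding smooth_on_def using Ck_on_differentiable by blast

lemma smooth_on_linear_ddir: "smooth_on U f \<Longrightarrow> y \<in> U \<Longrightarrow> linear (ddir f y)"
  using smooth_on_has_derivative has_derivative_linear by blast

lemma smooth_on_continuous_on: "smooth_on U f \<Longrightarrow> continuous_on U f"
  unfolding smooth_on_def using Ck_on.simps(1) by blast

lemma smooth_on_ddir: "smooth_on U f \<Longrightarrow> smooth_on U (\<lambda>y. ddir f y v)"
  unfolding smooth_on_def by (blast intro: Ck_on_ddir)

lemma smooth_on_const: "smooth_on U (\<lambda>_. a)"
  unfolding smooth_on_def by (simp add: Ck_on_const)

lemma smooth_on_linear:
  "bounded_linear L \<Longrightarrow> open U \<Longrightarrow> smooth_on U f \<Longrightarrow> smooth_on U (\<lambda>y. L (f y))"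
  unfolding smooth_on_def by (simp add: Ck_on_linear)

lemma smooth_on_add:
  "open U \<Longrightarrow> smooth_on U f \<Longrightarrow> smooth_on U h \<Longrightarrow> smooth_on U (\<lambda>y. f y + h y)"
  unfolding smooth_on_def by (simp add: Ck_on_add)

lemma smooth_on_bilinear:
  "bounded_bilinear P \<Longrightarrow> open U \<Longrightarrow> smooth_on U f \<Longrightarrow> smooth_on U h \<Longrightarrow> smooth_on U (\<lambda>y. P (f y) (h y))"
  unfolding smooth_on_def by (simp add: Ck_on_bilinear)

lemmas smooth_on_mult = smooth_on_bilinear[OF bounded_bilinear_mult]
lemmas smooth_on_scaleR = smooth_on_bilinear[OF bounded_bilinear_scaleR]

lemma smooth_on_diff:
  assumes "open U" "smooth_on U f" "smooth_on U h"
  shows "smooth_on U (\<lambda>y. f y - h y)"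
proof -
  have "smooth_on U (\<lambda>y. f y + (- 1) *\<^sub>R h y)"
    using assms by (intro smooth_on_add smooth_on_scaleR smooth_on_const)
  then show ?thesis by simp
qed

lemma smooth_on_sum:
  "open U \<Longrightarrow> (\<And>i. i \<in> I \<Longrightarrow> smooth_on U (f i)) \<Longrightarrow> smooth_on U (\<lambda>y. \<Sum>i\<in>I. f i y)"
  unfolding smooth_on_def by (simp add: Ck_on_sum)

lemma smooth_on_prod:
  fixes f :: "'i \<Rightarrow> 'a::euclidean_space \<Rightarrow> real"
  assumes "open U" "\<And>i. i \<in> I \<Longrightarrow> smooth_on U (f i)"
  shows "smooth_on U (\<lambda>y. \<Prod>i\<in>I. f i y)"
  using assms(2)
  by (induction I rule: infinite_finite_induct) (auto intro: smooth_on_const smooth_on_mult[OF assms(1)])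

lemma smooth_on_inverse:
  fixes f :: "'a::euclidean_space \<Rightarrow> real"
  shows "open U \<Longrightarrow> (\<And>y. y \<in> U \<Longrightarrow> f y \<noteq> 0) \<Longrightarrow> smooth_on U f \<Longrightarrow> smooth_on U (\<lambda>y. inverse (f y))"
  unfolding smooth_on_def by (simp add: Ck_on_inverse)

lemma smooth_on_sqrt:
  fixes f :: "'a::euclidean_space \<Rightarrow> real"
  shows "open U \<Longrightarrow> (\<And>y. y \<in> U \<Longrightarrow> f y > 0) \<Longrightarrow> smooth_on U f \<Longrightarrow> smooth_on U (\<lambda>y. sqrt (f y))"
  unfolding smooth_on_def by (simp add: Ck_on_sqrt)

lemma smooth_on_vec:
  fixes f :: "'i::finite \<Rightarrow> 'a::euclidean_space \<Rightarrow> real"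
  assumes "open U" "\<And>i. smooth_on U (f i)"
  shows "smooth_on U (\<lambda>y. \<chi> i. f i y)"
proof -
  have "smooth_on U (\<lambda>y. \<Sum>i\<in>UNIV. f i y *\<^sub>R (axis i 1 :: real ^ 'i))"
    by (intro smooth_on_sum smooth_on_scaleR smooth_on_const assms)
  moreover have "(\<Sum>i\<in>UNIV. f i y *\<^sub>R (axis i 1 :: real ^ 'i)) = (\<chi> i. f i y)" for y
    by (simp add: vec_eq_iff axis_def if_distrib cong: if_cong)
  ultimately show ?thesis by simp
qed

lemma smooth_on_det:
  fixes M :: "'a::euclidean_space \<Rightarrow> real ^ 'n ^ 'n"
  assumes "open U" "\<And>i j. smooth_on U (\<lambda>y. M y $ i $ j)"
  shows "smooth_on U (\<lambda>y. det (M y))"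
  unfolding det_def using assms
  by (intro smooth_on_sum smooth_on_mult smooth_on_const smooth_on_prod) auto

lemma matrix_inv_right:
  fixes M :: "real ^ 'n ^ 'n"
  assumes "invertible M"
  shows "M *v (matrix_inv M *v b) = b"
  using assms unfolding matrix_inv_def invertible_def
  by (metis (mono_tags, lifting) matrix_vector_mul_assoc matrix_vector_mul_lid someI_ex)

text \<open>Cramer's rule writes the solution as a quotient of determinants, which is a rational
  function of the entries.\<close>

lemma smooth_on_matrix_inv_mult:
  fixes M :: "'a::euclidean_space \<Rightarrow> real ^ 'n ^ 'n"
  assumes U: "open U" and M: "\<And>i j. smooth_on U (\<lambda>y. M y $ i $ j)"
    and b: "\<And>i. smooth_on U (\<lambda>y. b y $ i)"
    and inv: "\<And>y. y \<in> U \<Longrightarrow> invertible (M y)"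
  shows "smooth_on U (\<lambda>y. matrix_inv (M y) *v b y)"
proof -
  define c where "c k y = det (\<chi> i j. if j = k then b y $ i else M y $ i $ j) * inverse (det (M y))" for k y
  have nz: "det (M y) \<noteq> 0" if "y \<in> U" for y
    using inv[OF that] by (simp add: invertible_det_nz)
  have "smooth_on U (c k)" for k
  proof -
    have "smooth_on U (\<lambda>y. (\<chi> i j. if j = k then b y $ i else M y $ i $ j) $ i $ j)" for i j
      using M b by (cases "j = k") simp_all
    then show ?thesis
      unfolding c_def using M nz by (intro smooth_on_mult U smooth_on_det smooth_on_inverse) auto
  qed
  then have "smooth_on U (\<lambda>y. \<chi> k. c k y)" by (intro smooth_on_vec U)
  moreover have "(\<chi> k. c k y) = matrix_inv (M y) *v b y" if "y \<in> U" for y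
  proof -
    have "M y *v (matrix_inv (M y) *v b y) = b y" by (rule matrix_inv_right[OF inv[OF that]])
    then show ?thesis
      using cramer[OF nz[OF that]] by (simp add: c_def divide_inverse)
  qed
  ultimately show ?thesis by (rule smooth_on_cong[OF U])
qed

section \<open>Derivatives of constant pairings and symmetry of second derivatives\<close>

lemma constant_product_derivative:
  assumes P: "bounded_bilinear P" and V: "open V" "y \<in> V" and const: "\<And>z. z \<in> V \<Longrightarrow> P (F z) (F' z) = r"
    and F: "(F has_derivative G) (at y)" and F': "(F' has_derivative G') (at y)"
  shows "P (F y) (G' v) + P (G v) (F' y) = 0"
proof -
  have "((\<lambda>z. P (F z) (F' z)) has_derivative (\<lambda>v. P (F y) (G' v) + P (G v) (F' y))) (at y)"
    by (rule bounded_bilinear.FDERIV[OF P F F'])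
  moreover have "((\<lambda>z. P (F z) (F' z)) has_derivative (\<lambda>v. 0)) (at y)"
    by (rule has_derivative_transform_within_open[OF has_derivative_const[of r] V]) (simp add: const)
  ultimately have "(\<lambda>v. P (F y) (G' v) + P (G v) (F' y)) = (\<lambda>v. 0)"
    by (rule has_derivative_unique)
  from fun_cong[OF this] show ?thesis .
qed

lemma mixed_difference:
  fixes F :: "'a::euclidean_space \<Rightarrow> real"
  assumes F: "smooth_on U F" and t: "t > 0"
    and sub: "\<And>a b. 0 \<le> a \<Longrightarrow> a \<le> t \<Longrightarrow> 0 \<le> b \<Longrightarrow> b \<le> t \<Longrightarrow> y + a *\<^sub>R v + b *\<^sub>R w \<in> U"
  obtains a b where "0 < a" "a < t" "0 < b" "b < t"
    "F (y + t *\<^sub>R v + t *\<^sub>R w) - F (y + t *\<^sub>R v) - F (y + t *\<^sub>R w) + F y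
      = t * t * ddir (\<lambda>z. ddir F z v) (y + a *\<^sub>R v + b *\<^sub>R w) w"
proof -
  define \<phi> where "\<phi> s = F (y + s *\<^sub>R v + t *\<^sub>R w) - F (y + s *\<^sub>R v + 0 *\<^sub>R w)" for s
  have d1: "((\<lambda>s. F (y + s *\<^sub>R v + b *\<^sub>R w)) has_real_derivative ddir F (y + s *\<^sub>R v + b *\<^sub>R w) v) (at s)"
    if "0 \<le> s" "s \<le> t" "0 \<le> b" "b \<le> t" for s b
  proof -
    have "((\<lambda>s. y + s *\<^sub>R v + b *\<^sub>R w) has_derivative (\<lambda>h. h *\<^sub>R v)) (at s)"
      by (auto intro!: derivative_eq_intros)
    from has_derivative_compose[OF this smooth_on_has_derivative[OF F sub[OF that]]]
    show ?thesis
      using linear_cmul[OF smooth_on_linear_ddir[OF F sub[OF that]]]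
      by (simp add: has_field_derivative_def mult_commute_abs)
  qed
  have "(\<phi> has_real_derivative
      ddir F (y + s *\<^sub>R v + t *\<^sub>R w) v - ddir F (y + s *\<^sub>R v + 0 *\<^sub>R w) v) (at s)"
    if "0 \<le> s" "s \<le> t" for s
    unfolding \<phi>_def using that t by (intro DERIV_diff d1) auto
  from MVT2[OF t this]
  obtain a where a: "0 < a" "a < t"
    "\<phi> t - \<phi> 0 = t * (ddir F (y + a *\<^sub>R v + t *\<^sub>R w) v - ddir F (y + a *\<^sub>R v + 0 *\<^sub>R w) v)"
    by auto
  have "((\<lambda>s. ddir F (y + a *\<^sub>R v + s *\<^sub>R w) v) has_real_derivative
      ddir (\<lambda>z. ddir F z v) (y + a *\<^sub>R v + s *\<^sub>R w) w) (at s)" if "0 \<le> s" "s \<le> t" for s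
  proof -
    have p: "y + a *\<^sub>R v + s *\<^sub>R w \<in> U" using sub a that by auto
    have "((\<lambda>s. y + a *\<^sub>R v + s *\<^sub>R w) has_derivative (\<lambda>h. h *\<^sub>R w)) (at s)"
      by (auto intro!: derivative_eq_intros)
    from has_derivative_compose[OF this smooth_on_has_derivative[OF smooth_on_ddir[OF F] p]]
    show ?thesis
      using linear_cmul[OF smooth_on_linear_ddir[OF smooth_on_ddir[OF F] p]]
      by (simp add: has_field_derivative_def mult_commute_abs)
  qed
  from MVT2[OF t this]
  obtain b where b: "0 < b" "b < t"
    "ddir F (y + a *\<^sub>R v + t *\<^sub>R w) v - ddir F (y + a *\<^sub>R v + 0 *\<^sub>R w) v
      = t * ddir (\<lambda>z. ddir F z v) (y + a *\<^sub>R v + b *\<^sub>R w) w"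
    by auto
  show thesis
    by (rule that[OF a(1,2) b(1,2)]) (use a(3) b(3) in \<open>simp add: \<phi>_def algebra_simps\<close>)
qed

text \<open>Classical proof of Schwarz's theorem: the same second difference over a parallelogram is
  \<open>t * t\<close> times either mixed derivative at some nearby point, and both derivatives are
  continuous at \<open>y\<close>.\<close>

lemma ddir_commute_real:
  fixes F :: "'a::euclidean_space \<Rightarrow> real"
  assumes U: "open U" and F: "smooth_on U F" and y: "y \<in> U"
  shows "ddir (\<lambda>z. ddir F z v) y w = ddir (\<lambda>z. ddir F z w) y v"
proof (rule ccontr)
  let ?P = "\<lambda>z. ddir (\<lambda>z. ddir F z v) z w" and ?Q = "\<lambda>z. ddir (\<lambda>z. ddir F z w) z v"
  assume "?P y \<noteq> ?Q y"
  define \<epsilon> where "\<epsilon> = \<bar>?P y - ?Q y\<bar> / 2"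
  have \<epsilon>: "\<epsilon> > 0" using \<open>?P y \<noteq> ?Q y\<close> by (simp add: \<epsilon>_def)
  have "isCont ?P y" "isCont ?Q y"
    using smooth_on_continuous_on[OF smooth_on_ddir[OF smooth_on_ddir[OF F]]] U y
    by (auto simp: continuous_on_eq_continuous_at)
  then have "\<exists>d>0. \<forall>z. dist z y < d \<longrightarrow> dist (?P z) (?P y) < \<epsilon>"
    "\<exists>d>0. \<forall>z. dist z y < d \<longrightarrow> dist (?Q z) (?Q y) < \<epsilon>"
    using \<epsilon> unfolding continuous_at_eps_delta by simp_all
  then obtain d1 d2 where d: "d1 > 0" "d2 > 0" "\<And>z. dist z y < d1 \<Longrightarrow> \<bar>?P z - ?P y\<bar> < \<epsilon>"
    "\<And>z. dist z y < d2 \<Longrightarrow> \<bar>?Q z - ?Q y\<bar> < \<epsilon>"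
    by (auto simp: dist_real_def)
  obtain d3 where d3: "d3 > 0" "ball y d3 \<subseteq> U" using U y openE by blast
  define d where "d = min d1 (min d2 d3)"
  \<comment> \<open>Keeps the parallelogram with sides \<open>t *\<^sub>R v\<close> and
    \<open>t *\<^sub>R w\<close> within distance \<open>d\<close> of \<open>y\<close>; the summand 1
    covers the case that both vectors vanish.\<close>
  define t where "t = d / (norm v + norm w + 1) / 2"
  have dpos: "d > 0" using d d3 by (simp add: d_def)
  have npos: "norm v + norm w + 1 > 0" by (simp add: add_nonneg_pos)
  have t: "t > 0" using dpos npos by (simp add: t_def)
  have tn: "t * (norm v + norm w + 1) < d"
  proof -
    have "t * K = d / 2" if "t = d / K / 2" "K > 0" for K
      using that by simp
    from this[OF t_def npos] show ?thesis using dpos by linarith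
  qed
  have near: "dist (y + a *\<^sub>R v + b *\<^sub>R w) y < d" if "0 \<le> a" "a \<le> t" "0 \<le> b" "b \<le> t" for a b
  proof -
    have "dist (y + a *\<^sub>R v + b *\<^sub>R w) y = norm (a *\<^sub>R v + b *\<^sub>R w)"
      by (simp add: dist_norm algebra_simps)
    also have "\<dots> \<le> a * norm v + b * norm w"
      using norm_triangle_ineq[of "a *\<^sub>R v" "b *\<^sub>R w"] that by simp
    also have "\<dots> \<le> t * norm v + t * norm w"
      using that by (intro add_mono mult_right_mono) auto
    also have "\<dots> < d" using tn t by (simp add: algebra_simps)
    finally show ?thesis .
  qed
  have inU: "y + a *\<^sub>R v + b *\<^sub>R w \<in> U" if "0 \<le> a" "a \<le> t" "0 \<le> b" "b \<le> t" for a b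
    using near[OF that] d3 by (auto simp: d_def dist_commute subset_iff)
  obtain a b where ab: "0 < a" "a < t" "0 < b" "b < t"
    "F (y + t *\<^sub>R v + t *\<^sub>R w) - F (y + t *\<^sub>R v) - F (y + t *\<^sub>R w) + F y
      = t * t * ?P (y + a *\<^sub>R v + b *\<^sub>R w)"
    by (rule mixed_difference[OF F t, of y v w]) (use inU in blast, blast)
  have inU': "y + a *\<^sub>R w + b *\<^sub>R v \<in> U" if "0 \<le> a" "a \<le> t" "0 \<le> b" "b \<le> t" for a b
    using inU[OF that(3,4,1,2)] by (simp add: algebra_simps)
  obtain a' b' where ab': "0 < a'" "a' < t" "0 < b'" "b' < t"
    "F (y + t *\<^sub>R w + t *\<^sub>R v) - F (y + t *\<^sub>R w) - F (y + t *\<^sub>R v) + F y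
      = t * t * ?Q (y + a' *\<^sub>R w + b' *\<^sub>R v)"
    by (rule mixed_difference[OF F t, of y w v]) (use inU' in blast, blast)
  have sw: "y + a' *\<^sub>R w + b' *\<^sub>R v = y + b' *\<^sub>R v + a' *\<^sub>R w" for a' b'
    by (simp add: algebra_simps)
  have "?P (y + a *\<^sub>R v + b *\<^sub>R w) = ?Q (y + a' *\<^sub>R w + b' *\<^sub>R v)"
  proof -
    have "t * t * ?P (y + a *\<^sub>R v + b *\<^sub>R w) = t * t * ?Q (y + a' *\<^sub>R w + b' *\<^sub>R v)"
      using ab(5) ab'(5)[unfolded sw[of t t]] by linarith
    then show ?thesis using t by simp
  qed
  moreover have "\<bar>?P (y + a *\<^sub>R v + b *\<^sub>R w) - ?P y\<bar> < \<epsilon>"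
    using d(3) near ab by (simp add: d_def)
  moreover have "\<bar>?Q (y + a' *\<^sub>R w + b' *\<^sub>R v) - ?Q y\<bar> < \<epsilon>"
    using d(4) near[of b' a'] ab' by (simp add: d_def sw)
  moreover have "\<bar>?P y - ?Q y\<bar> = 2 * \<epsilon>" by (simp add: \<epsilon>_def)
  ultimately show False by arith
qed

lemma ddir_inner:
  assumes "(f has_derivative f') (at y)"
  shows "ddir (\<lambda>z. f z \<bullet> b) y v = f' v \<bullet> b"
  by (rule ddirI) (rule has_derivative_inner_left[OF assms])

lemma ddir_commute:
  fixes f :: "'a::euclidean_space \<Rightarrow> 'b::euclidean_space"
  assumes U: "open U" and f: "smooth_on U f" and y: "y \<in> U"
  shows "ddir (\<lambda>z. ddir f z v) y w = ddir (\<lambda>z. ddir f z w) y v"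
proof (rule euclidean_eqI)
  fix b :: 'b
  have s: "smooth_on U (\<lambda>z. f z \<bullet> b)" using smooth_on_linear[OF bounded_linear_inner_left U f] .
  have *: "ddir (\<lambda>z. ddir f z v) y w \<bullet> b = ddir (\<lambda>z. ddir (\<lambda>z. f z \<bullet> b) z v) y w" for v w
  proof -
    have "ddir (\<lambda>z. ddir (\<lambda>z. f z \<bullet> b) z v) y w = ddir (\<lambda>z. ddir f z v \<bullet> b) y w"
      using smooth_on_has_derivative[OF smooth_on_ddir[OF s] y] ddir_inner[OF smooth_on_has_derivative[OF f]]
      by (intro ddir_cong[OF U y]) (auto simp: differentiable_def)
    then show ?thesis
      by (simp add: ddir_inner[OF smooth_on_has_derivative[OF smooth_on_ddir[OF f] y]])
  qed
  show "ddir (\<lambda>z. ddir f z v) y w \<bullet> b = ddir (\<lambda>z. ddir f z w) y v \<bullet> b"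
    unfolding * by (rule ddir_commute_real[OF U s y])
qed

section \<open>Hypersurfaces in a chart and the Gauss equation\<close>

text \<open>The moving direction \<open>X z\<close> is expanded over \<open>Basis\<close>, because
  \<open>ddir f z v\<close> is known to be smooth in \<open>z\<close> only for fixed
  \<open>v\<close>.\<close>

lemma smooth_on_ddir_field:
  fixes f :: "'a::euclidean_space \<Rightarrow> 'b::real_normed_vector"
  assumes U: "open U" and f: "smooth_on U f" and X: "smooth_on U X"
  shows "smooth_on U (\<lambda>z. ddir f z (X z))"
    and "y \<in> U \<Longrightarrow> ((\<lambda>z. ddir f z (X z)) has_derivative
       (\<lambda>v. ddir f y (ddir X y v) + (\<Sum>b\<in>Basis. (X y \<bullet> b) *\<^sub>R ddir (\<lambda>z. ddir f z b) y v))) (at y)"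
proof -
  have eq: "ddir f z (X z) = (\<Sum>b\<in>Basis. (X z \<bullet> b) *\<^sub>R ddir f z b)" if "z \<in> U" for z
    using linear_eq_sum_Basis smooth_on_linear_ddir[OF f that] by blast
  have sb: "smooth_on U (\<lambda>z. X z \<bullet> b)" for b
    using smooth_on_linear[OF bounded_linear_inner_left U X] .
  have "smooth_on U (\<lambda>z. \<Sum>b\<in>Basis. (X z \<bullet> b) *\<^sub>R ddir f z b)"
    by (intro smooth_on_sum smooth_on_scaleR U smooth_on_ddir f sb)
  then show "smooth_on U (\<lambda>z. ddir f z (X z))"
    by (rule smooth_on_cong[OF U]) (simp add: eq)
  assume y: "y \<in> U"
  have "((\<lambda>z. \<Sum>b\<in>Basis. (X z \<bullet> b) *\<^sub>R ddir f z b) has_derivative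
     (\<lambda>v. \<Sum>b\<in>Basis. (X y \<bullet> b) *\<^sub>R ddir (\<lambda>z. ddir f z b) y v + (ddir X y v \<bullet> b) *\<^sub>R ddir f y b)) (at y)"
    by (intro has_derivative_sum has_derivative_scaleR has_derivative_inner_left
        smooth_on_has_derivative[OF X y] smooth_on_has_derivative[OF smooth_on_ddir[OF f] y])
  then have "((\<lambda>z. ddir f z (X z)) has_derivative
     (\<lambda>v. \<Sum>b\<in>Basis. (X y \<bullet> b) *\<^sub>R ddir (\<lambda>z. ddir f z b) y v + (ddir X y v \<bullet> b) *\<^sub>R ddir f y b)) (at y)"
    by (rule has_derivative_transform_within_open[OF _ U y]) (simp add: eq)
  then show "((\<lambda>z. ddir f z (X z)) has_derivative
       (\<lambda>v. ddir f y (ddir X y v) + (\<Sum>b\<in>Basis. (X y \<bullet> b) *\<^sub>R ddir (\<lambda>z. ddir f z b) y v))) (at y)"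
    by (simp add: sum.distrib add.commute flip: linear_eq_sum_Basis[OF smooth_on_linear_ddir[OF f y]])
qed

lemma linear_axis_sum:
  fixes L :: "real ^ 'n::finite \<Rightarrow> 'b::real_vector"
  assumes "linear L"
  shows "(\<Sum>i\<in>UNIV. (x $ i) *\<^sub>R L (axis i 1)) = L x"
proof -
  have "L x = L (\<Sum>i\<in>UNIV. (x $ i) *\<^sub>R axis i 1)"
    using basis_expansion[of x] by (simp add: scalar_mult_eq_scaleR)
  then show ?thesis by (simp add: linear_sum[OF assms] linear_cmul[OF assms])
qed

lemma linear_inj_imp_DIM_le:
  fixes L :: "'a::euclidean_space \<Rightarrow> 'b::euclidean_space"
  assumes "linear L" "inj L"
  shows "DIM('a) \<le> DIM('b)"
proof -
  have "dim (range L) = dim (UNIV :: 'a set)"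
    using assms by (intro dim_image_eq) (auto intro: inj_on_subset)
  then show ?thesis using dim_subset_UNIV[of "range L"] by simp
qed

lemma linear_inj_imp_surj_DIM:
  fixes L :: "'a::euclidean_space \<Rightarrow> 'b::euclidean_space"
  assumes "linear L" "inj L" "DIM('a) = DIM('b)"
  shows "surj L"
proof -
  have "dim (range L) = dim (UNIV :: 'a set)"
    using assms by (intro dim_image_eq) (auto intro: inj_on_subset)
  then have "span (range L) = UNIV" using assms(3) dim_eq_full by auto
  moreover have "span (range L) = range L"
    using assms(1) by (intro span_eq_iff[THEN iffD2] linear_subspace_image) auto
  ultimately show ?thesis by simp
qed

text \<open>A hypersurface of the space form of curvature \<open>c\<close> in a single chart, seen in the flat ambient
  space \<open>'e\<close> with bilinear form \<open>B\<close>. For \<open>c \<noteq> 0\<close> the position vector \<open>f y\<close> is a second normal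
  vector; all occurrences of it carry a factor \<open>c\<close>, so that the formulas cover \<open>c = 0\<close> as well.\<close>

locale chart_hypersurface =
  fixes U :: "(real ^ 'n::finite) set"
    and f :: "real ^ 'n \<Rightarrow> 'e::euclidean_space"
    and B :: "'e \<Rightarrow> 'e \<Rightarrow> real"
    and c :: real
    and g :: "'n local_metric"
  assumes open_U: "open U"
    and smooth_f: "smooth_on U f"
    and bil: "bounded_bilinear B"
    and sym: "B a b = B b a"
    and inj_f: "y \<in> U \<Longrightarrow> inj (ddir f y)"
    and pos: "y \<in> U \<Longrightarrow> c * B a (f y) = 0 \<Longrightarrow> a \<noteq> 0 \<Longrightarrow> B a a > 0"
    and quad: "y \<in> U \<Longrightarrow> c * B (f y) (f y) = (if c = 0 then 0 else 1)"
    and dim_e: "DIM('e) = CARD('n) + (if c = 0 then 1 else 2)"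
    and g_eq: "y \<in> U \<Longrightarrow> g y v w = B (ddir f y v) (ddir f y w)"
begin

lemmas B_simps =
  bounded_bilinear.add_left[OF bil] bounded_bilinear.add_right[OF bil]
  bounded_bilinear.diff_left[OF bil] bounded_bilinear.diff_right[OF bil]
  bounded_bilinear.minus_left[OF bil] bounded_bilinear.minus_right[OF bil]
  bounded_bilinear.scaleR_left[OF bil] bounded_bilinear.scaleR_right[OF bil]
  bounded_bilinear.zero_left[OF bil] bounded_bilinear.zero_right[OF bil]

section \<open>Second derivatives, Christoffel symbols and the Gauss equation\<close>

definition D2 :: "real ^ 'n \<Rightarrow> real ^ 'n \<Rightarrow> real ^ 'n \<Rightarrow> 'e" where
  "D2 y v w = ddir (\<lambda>z. ddir f z v) y w"

text \<open>The vector-valued second fundamental form in the flat ambient space; for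
  \<open>c \<noteq> 0\<close> it includes the component along the position vector.\<close>

definition Vn :: "real ^ 'n \<Rightarrow> real ^ 'n \<Rightarrow> real ^ 'n \<Rightarrow> 'e" where
  "Vn y v w = D2 y v w - ddir f y (christoffel g y v w)"

lemma linear_D: "y \<in> U \<Longrightarrow> linear (ddir f y)"
  using smooth_on_linear_ddir[OF smooth_f] .

lemma D2_sym: "y \<in> U \<Longrightarrow> D2 y v w = D2 y w v"
  unfolding D2_def by (rule ddir_commute[OF open_U smooth_f])

lemma linear_D2: "y \<in> U \<Longrightarrow> linear (D2 y v)"
  unfolding D2_def using smooth_on_linear_ddir[OF smooth_on_ddir[OF smooth_f]] .

lemma linear_D2': "y \<in> U \<Longrightarrow> linear (\<lambda>v. D2 y v w)"
  using linear_D2[of y w] by (simp add: D2_sym[of y _ w])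

lemma linear_B: "linear (B a)"
  by (intro linearI) (simp_all add: B_simps)

lemma linear_B': "linear (\<lambda>a. B a b)"
  by (intro linearI) (simp_all add: B_simps)

lemma D_derivative: "y \<in> U \<Longrightarrow> (f has_derivative ddir f y) (at y)"
  by (rule smooth_on_has_derivative[OF smooth_f])

lemma D2_derivative: "y \<in> U \<Longrightarrow> ((\<lambda>z. ddir f z v) has_derivative D2 y v) (at y)"
  unfolding D2_def by (rule smooth_on_has_derivative[OF smooth_on_ddir[OF smooth_f]])

lemma smooth_g: "smooth_on U (\<lambda>y. g y v w)"
  by (rule smooth_on_cong[OF open_U smooth_on_bilinear[OF bil open_U]])
    (auto intro: smooth_on_ddir smooth_f simp: g_eq)

lemma ddir_g:
  assumes y: "y \<in> U"
  shows "ddir (\<lambda>z. g z v w) y a = B (ddir f y v) (D2 y w a) + B (D2 y v a) (ddir f y w)"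
proof (rule ddirI)
  have "((\<lambda>z. B (ddir f z v) (ddir f z w)) has_derivative
      (\<lambda>a. B (ddir f y v) (D2 y w a) + B (D2 y v a) (ddir f y w))) (at y)"
    by (intro bounded_bilinear.FDERIV[OF bil] D2_derivative y)
  then show "((\<lambda>z. g z v w) has_derivative
      (\<lambda>a. B (ddir f y v) (D2 y w a) + B (D2 y v a) (ddir f y w))) (at y)"
    by (rule has_derivative_transform_within_open[OF _ open_U y]) (simp add: g_eq)
qed

lemma B_f_D: 
  assumes y: "y \<in> U"
  shows "c * B (f y) (ddir f y v) = 0"
proof -
  have "((\<lambda>z. c * B (f z) (f z)) has_derivative
      (\<lambda>v. c * (B (f y) (ddir f y v) + B (ddir f y v) (f y)))) (at y)"
    by (intro has_derivative_mult_right bounded_bilinear.FDERIV[OF bil] D_derivative y)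
  moreover have "((\<lambda>z. c * B (f z) (f z)) has_derivative (\<lambda>v. 0)) (at y)"
    by (rule has_derivative_transform_within_open[OF _ open_U y, of "\<lambda>_. if c = 0 then 0 else 1"])
      (use quad in auto)
  ultimately have "c * (B (f y) (ddir f y v) + B (ddir f y v) (f y)) = 0"
    using has_derivative_unique by (metis (no_types, lifting))
  then show ?thesis by (simp add: sym)
qed

lemma B_D_f: "y \<in> U \<Longrightarrow> c * B (ddir f y v) (f y) = 0"
  using B_f_D by (simp add: sym)

text \<open>Differentiating \<open>B_D_f\<close> shows that the second fundamental form in the
  direction of the position vector is a multiple of the metric.\<close>

lemma B_D2_f:
  assumes y: "y \<in> U"
  shows "c * B (D2 y v w) (f y) = - c * g y v w"
proof -
  have "((\<lambda>z. c * B (ddir f z v) (f z)) has_derivative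
      (\<lambda>w. c * (B (ddir f y v) (ddir f y w) + B (D2 y v w) (f y)))) (at y)"
    by (intro has_derivative_mult_right bounded_bilinear.FDERIV[OF bil] D_derivative D2_derivative y)
  moreover have "((\<lambda>z. c * B (ddir f z v) (f z)) has_derivative (\<lambda>v. 0)) (at y)"
    by (rule has_derivative_transform_within_open[OF _ open_U y, of "\<lambda>_. 0"])
      (simp_all only: B_D_f has_derivative_const)
  ultimately have "c * (B (ddir f y v) (ddir f y w) + B (D2 y v w) (f y)) = 0"
    using has_derivative_unique by (metis (no_types, lifting))
  then show ?thesis using y by (simp add: g_eq algebra_simps)
qed

lemma D_eq_0: "y \<in> U \<Longrightarrow> ddir f y v = 0 \<Longrightarrow> v = 0"
  using inj_f linear_D linear_0 by (metis injD)

lemma g_pos: "y \<in> U \<Longrightarrow> v \<noteq> 0 \<Longrightarrow> g y v v > 0"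
  using pos[OF _ B_D_f] D_eq_0 g_eq by metis

lemma g_sym: "y \<in> U \<Longrightarrow> g y v w = g y w v"
  by (simp add: g_eq sym)

lemma linear_g:
  assumes y: "y \<in> U"
  shows "linear (g y v)"
proof -
  have "g y v = B (ddir f y v) \<circ> ddir f y" by (rule ext) (simp add: g_eq[OF y])
  then show ?thesis using linear_compose[OF linear_D[OF y] linear_B] by simp
qed

lemma linear_g': "y \<in> U \<Longrightarrow> linear (\<lambda>v. g y v w)"
  using linear_g[of y w] by (simp add: g_sym[of y _ w])

lemma g_eqI: "y \<in> U \<Longrightarrow> (\<And>u. g y v u = g y w u) \<Longrightarrow> v = w"
proof (rule ccontr)
  assume y: "y \<in> U" and eq: "\<And>u. g y v u = g y w u" and "v \<noteq> w"
  then have "g y (v - w) (v - w) > 0" by (intro g_pos) auto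
  moreover have "g y (v - w) (v - w) = 0" 
    using linear_diff[OF linear_g'[OF y]] eq by simp
  ultimately show False by simp
qed

lemma gram_mult: "y \<in> U \<Longrightarrow> (gram g y *v x) $ i = g y (axis i 1) x"
  using linear_axis_sum[OF linear_g, of y x "axis i 1"]
  by (simp add: gram_def matrix_vector_mult_def mult.commute)

lemma gram_invertible:
  assumes y: "y \<in> U"
  shows "invertible (gram g y)"
proof -
  have "x = 0" if "gram g y *v x = 0" for x
  proof -
    have "g y (axis i 1) x = 0" for i using gram_mult[OF y, of x i] that by simp
    then have "g y x x = 0"
      using linear_axis_sum[OF linear_g'[OF y], of x x] by simp
    then show ?thesis using g_pos[OF y, of x] by auto
  qed
  then show ?thesis
    by (simp add: invertible_left_inverse matrix_left_invertible_ker)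
qed

text \<open>Riesz representation with respect to \<open>g\<close>: the inverse Gram matrix turns a
  linear form into the vector representing it. Christoffel symbols and tangential parts of ambient
  vectors are all obtained this way.\<close>

lemma matrix_inv_gram:
  assumes y: "y \<in> U" and L: "linear L" and b: "\<And>i. b $ i = L (axis i 1)"
  shows "g y (matrix_inv (gram g y) *v b) u = L u"
proof -
  have "g y (axis i 1) (matrix_inv (gram g y) *v b) = L (axis i 1)" for i
    using gram_mult[OF y, of "matrix_inv (gram g y) *v b" i] matrix_inv_right[OF gram_invertible[OF y], of b] b
    by simp
  then show ?thesis
    using linear_axis_sum[OF linear_g'[OF y], of u "matrix_inv (gram g y) *v b"] linear_axis_sum[OF L, of u]
    by (simp add: g_sym[OF y])
qed

lemma smooth_matrix_inv_gram:
  assumes V: "open V" "V \<subseteq> U" and b: "\<And>i. smooth_on V (\<lambda>y. b y $ i)"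
  shows "smooth_on V (\<lambda>y. matrix_inv (gram g y) *v b y)"
proof (intro smooth_on_matrix_inv_mult b V)
  show "smooth_on V (\<lambda>y. gram g y $ i $ j)" for i j
    using smooth_on_subset[OF smooth_g V(2)] by (simp add: gram_def)
  show "invertible (gram g y)" if "y \<in> V" for y
    using that V(2) gram_invertible by auto
qed

text \<open>The three metric derivatives expand into six products, four of which cancel by symmetry
  of second derivatives. Thus \<open>christoffel\<close> is the tangential part of
  \<open>D2\<close>, and \<open>Vn\<close> is normal.\<close>

lemma g_christoffel:
  assumes y: "y \<in> U"
  shows "g y (christoffel g y v w) u = B (D2 y v w) (ddir f y u)"
proof -
  let ?b = "\<chi> l. ddir (\<lambda>z. g z w (axis l 1)) y v + ddir (\<lambda>z. g z v (axis l 1)) y w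
              - ddir (\<lambda>z. g z v w) y (axis l 1)"
  have L: "linear (\<lambda>u. 2 * B (D2 y v w) (ddir f y u))"
    using linear_compose[OF linear_compose[OF linear_D[OF y] linear_B] linear_times]
    by (simp add: o_def)
  have "?b $ i = 2 * B (D2 y v w) (ddir f y (axis i 1))" for i
    using y by (simp add: ddir_g sym D2_sym[of y "axis i 1"] D2_sym[of y w v] algebra_simps)
  from matrix_inv_gram[OF y L this]
  show ?thesis
    unfolding christoffel_def using linear_cmul[OF linear_g'[OF y]] by simp
qed

lemma smooth_christoffel: "smooth_on U (\<lambda>y. christoffel g y v w)"
  unfolding christoffel_def
  by (intro smooth_on_scaleR open_U smooth_on_const smooth_matrix_inv_gram)
    (auto intro!: smooth_on_diff smooth_on_add smooth_on_ddir smooth_g open_U)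

lemma christoffel_sym: "y \<in> U \<Longrightarrow> christoffel g y v w = christoffel g y w v"
  by (rule g_eqI[of y]) (simp_all add: g_christoffel D2_sym[of y v w])

lemma linear_christoffel: "y \<in> U \<Longrightarrow> linear (christoffel g y v)"
  using linear_add[OF linear_g'] linear_cmul[OF linear_g'] linear_add[OF linear_D2] linear_cmul[OF linear_D2]
  by (intro linearI g_eqI[of y]) (simp_all add: g_christoffel B_simps)

lemma linear_Vn: "y \<in> U \<Longrightarrow> linear (Vn y v)"
  unfolding Vn_def using linear_compose[OF linear_christoffel linear_D]
  by (intro linear_compose_sub linear_D2) (auto simp: o_def)

lemma Vn_sym: "y \<in> U \<Longrightarrow> Vn y v w = Vn y w v"
  by (simp add: Vn_def D2_sym[of y v w] christoffel_sym[of y v w])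

lemma linear_Vn': "y \<in> U \<Longrightarrow> linear (\<lambda>v. Vn y v w)"
  using linear_Vn[of y w] by (simp add: Vn_sym[of y _ w])

lemma Vn_normal: "y \<in> U \<Longrightarrow> B (Vn y v w) (ddir f y u) = 0"
  using g_christoffel[of y v w u] g_eq by (simp add: Vn_def B_simps)

lemma B_Vn_D2: "y \<in> U \<Longrightarrow> B (Vn y v w) (D2 y a b) = B (Vn y v w) (Vn y a b)"
  using Vn_normal[of y v w "christoffel g y a b"] by (simp add: Vn_def B_simps)

lemma D3_sym:
  assumes y: "y \<in> U"
  shows "ddir (\<lambda>z. D2 z w u) y v = ddir (\<lambda>z. D2 z v u) y w"
proof -
  have s: "smooth_on U (\<lambda>z. D2 z a b)" for a b
    unfolding D2_def by (intro smooth_on_ddir smooth_f)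
  have *: "ddir (\<lambda>z. D2 z a b) y d = ddir (\<lambda>z. D2 z a d) y b" for a b d
    unfolding D2_def by (rule ddir_commute[OF open_U smooth_on_ddir[OF smooth_f] y])
  have "ddir (\<lambda>z. D2 z w v) y u = ddir (\<lambda>z. D2 z v w) y u"
    using smooth_on_has_derivative[OF s y] 
    by (intro ddir_cong[OF open_U y] D2_sym) (auto intro: differentiableI)
  with * show ?thesis by simp
qed

text \<open>Obtained by differentiating the orthogonality of \<open>Vn\<close> and the tangent
  vectors. The third derivative on the right is symmetric in \<open>v\<close> and \<open>w\<close>
  by \<open>D3_sym\<close>, so it drops out of the curvature and only the products of second
  fundamental forms survive.\<close>

lemma g_covariant_christoffel:
  assumes y: "y \<in> U"
  shows "g y (ddir (\<lambda>z. christoffel g z w u) y v + christoffel g y v (christoffel g y w u)) z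
    = B (ddir (\<lambda>z. D2 z w u) y v) (ddir f y z) + B (Vn y w u) (Vn y v z)"
proof -
  let ?G = "\<lambda>z. christoffel g z w u"
  have s2: "smooth_on U (\<lambda>z. D2 z w u)"
    unfolding D2_def by (intro smooth_on_ddir smooth_f)
  have *: "(\<Sum>b\<in>Basis. (?G y \<bullet> b) *\<^sub>R ddir (\<lambda>z. ddir f z b) y v) = D2 y (?G y) v" for v
    using linear_eq_sum_Basis[OF linear_D2'[OF y], of "?G y" v] by (simp add: D2_def)
  have "((\<lambda>z. Vn z w u) has_derivative
      (\<lambda>v. ddir (\<lambda>z. D2 z w u) y v - (ddir f y (ddir ?G y v) + D2 y (?G y) v))) (at y)"
    unfolding Vn_def
    by (intro has_derivative_diff smooth_on_has_derivative[OF s2 y]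
        smooth_on_ddir_field(2)[OF open_U smooth_f smooth_christoffel[of w u] y, unfolded *])
  then have "((\<lambda>x. B (Vn x w u) (ddir f x z)) has_derivative
     (\<lambda>v. B (Vn y w u) (D2 y z v) +
       B (ddir (\<lambda>z. D2 z w u) y v - (ddir f y (ddir ?G y v) + D2 y (?G y) v)) (ddir f y z))) (at y)"
    by (intro bounded_bilinear.FDERIV[OF bil] D2_derivative y)
  moreover have "((\<lambda>x. B (Vn x w u) (ddir f x z)) has_derivative (\<lambda>v. 0)) (at y)"
    by (rule has_derivative_transform_within_open[OF _ open_U y, of "\<lambda>_. 0"]) (simp_all add: Vn_normal)
  ultimately have "B (Vn y w u) (D2 y z v) +
       B (ddir (\<lambda>z. D2 z w u) y v - (ddir f y (ddir ?G y v) + D2 y (?G y) v)) (ddir f y z) = 0"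
    using has_derivative_unique by (metis (no_types, lifting))
  then show ?thesis
    using y by (simp add: B_simps B_Vn_D2 Vn_sym[of y z v] linear_add[OF linear_g'] g_christoffel
        D2_sym[of y v] g_eq[of y "ddir ?G y v"])
qed

lemma gauss_equation:
  assumes y: "y \<in> U"
  shows "g y (curv g y v w u) z = B (Vn y w u) (Vn y v z) - B (Vn y v u) (Vn y w z)"
proof -
  let ?T = "\<lambda>v w. ddir (\<lambda>z. christoffel g z w u) y v + christoffel g y v (christoffel g y w u)"
  have z: "christoffel g y 0 u = 0"
    using linear_0[OF linear_christoffel[OF y]] christoffel_sym[OF y] by metis
  have "curv g y v w u = ?T v w - ?T w v"
    by (simp add: curv_def curvature_field_def nabla_def lie_bracket_def z)
  then show ?thesis
    using y by (simp only: linear_diff[OF linear_g'] g_covariant_christoffel D3_sym[of y w u v])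
qed

section \<open>Unit normals\<close>

definition unit_normal :: "real ^ 'n \<Rightarrow> 'e \<Rightarrow> bool" where
  "unit_normal y N \<longleftrightarrow> B N N = 1 \<and> c * B N (f y) = 0 \<and> (\<forall>v. B N (ddir f y v) = 0)"

text \<open>Dimension count: being normal amounts to one linear condition fewer than the ambient
  dimension. The locale assumption \<open>pos\<close> makes a nonzero solution spacelike, so it can
  be normalised.\<close>

lemma unit_normal_exists:
  assumes y: "y \<in> U"
  shows "\<exists>N. unit_normal y N"
proof -
  define T where "T a = (\<chi> i. B a (ddir f y (axis i 1)))" for a
  have T: "linear T"
    unfolding T_def by (intro linearI) (simp_all add: B_simps vec_eq_iff)
  have "\<exists>a. a \<noteq> 0 \<and> T a = 0 \<and> c * B a (f y) = 0"
  proof (cases "c = 0")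
    case True
    then have "\<not> inj T" using linear_inj_imp_DIM_le[OF T] dim_e by auto
    then show ?thesis using True linear_injective_0[OF T] by auto
  next
    case False
    define T' where "T' a = (T a, c * B a (f y))" for a
    have T': "linear T'"
      unfolding T'_def using linear_add[OF T] linear_cmul[OF T]
      by (intro linearI) (simp_all add: B_simps algebra_simps)
    have "\<not> inj T'" using linear_inj_imp_DIM_le[OF T'] dim_e False by auto
    then show ?thesis using linear_injective_0[OF T'] by (auto simp: T'_def zero_prod_def)
  qed
  then obtain a where a: "a \<noteq> 0" "T a = 0" "c * B a (f y) = 0" by blast
  have aD: "B a (ddir f y v) = 0" for v
  proof -
    have "linear (\<lambda>v. B a (ddir f y v))"
      using linear_compose[OF linear_D[OF y] linear_B] by (simp add: o_def)
    from linear_axis_sum[OF this, of v] show ?thesis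
      using a(2) by (simp add: T_def vec_eq_iff)
  qed
  have p: "B a a > 0" using pos[OF y a(3,1)] .
  let ?r = "1 / sqrt (B a a)"
  have "unit_normal y (?r *\<^sub>R a)"
    using p a(3) aD by (auto simp: unit_normal_def B_simps real_sqrt_mult_self)
  then show ?thesis by blast
qed

text \<open>Tangent vectors, \<open>N\<close> and, for \<open>c \<noteq> 0\<close>, the position
  vector are independent and their number is the ambient dimension. For \<open>c = 0\<close> the
  middle summand vanishes.\<close>

lemma normal_decomposition:
  assumes y: "y \<in> U" and N: "unit_normal y N"
  obtains t where "a = ddir f y t + (c * B a (f y)) *\<^sub>R f y + B a N *\<^sub>R N"
proof -
  have N': "B N N = 1" "c * B N (f y) = 0" "\<And>v. B N (ddir f y v) = 0" "\<And>v. B (ddir f y v) N = 0"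
    using N by (auto simp: unit_normal_def sym)
  show thesis
  proof (cases "c = 0")
    case True
    define T where "T = (\<lambda>(v, b). ddir f y v + b *\<^sub>R N)"
    have T: "linear T"
      unfolding T_def using linear_add[OF linear_D[OF y]] linear_cmul[OF linear_D[OF y]]
      by (intro linearI) (auto simp: algebra_simps)
    have "p = 0" if "T p = 0" for p
    proof -
      have "B (T p) N = 0" using that by (simp add: B_simps)
      then have "snd p = 0" using N' by (simp add: T_def case_prod_beta B_simps)
      then show ?thesis
        using that D_eq_0[OF y] by (simp add: T_def case_prod_beta prod_eq_iff)
    qed
    then have "inj T" using linear_injective_0[OF T] by blast
    then have "surj T" using linear_inj_imp_surj_DIM[OF T] dim_e True by simp
    then obtain v b where a: "a = ddir f y v + b *\<^sub>R N" unfolding T_def by (force simp: surj_def)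
    then have "B a N = b" using N' by (simp add: B_simps)
    then show thesis using that[of v] a True by simp
  next
    case False
    have fN: "B (f y) N = 0" "B N (f y) = 0" using N' False by (auto simp: sym)
    have fD: "B (f y) (ddir f y v) = 0" "B (ddir f y v) (f y) = 0" for v
      using B_f_D[OF y] B_D_f[OF y] False by auto
    have ff: "c * B (f y) (f y) = 1" using quad[OF y] False by simp
    define T where "T = (\<lambda>(v, b, d). ddir f y v + b *\<^sub>R f y + d *\<^sub>R N)"
    have T: "linear T"
      unfolding T_def using linear_add[OF linear_D[OF y]] linear_cmul[OF linear_D[OF y]]
      by (intro linearI) (auto simp: algebra_simps)
    have coef: "c * B (ddir f y v + b *\<^sub>R f y + d *\<^sub>R N) (f y) = b"
       "B (ddir f y v + b *\<^sub>R f y + d *\<^sub>R N) N = d" for v b d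
      using N' fN fD ff by (simp_all add: B_simps)
    have "p = 0" if "T p = 0" for p
    proof -
      obtain v b d where p: "p = (v, b, d)" by (cases p)
      have "ddir f y v + b *\<^sub>R f y + d *\<^sub>R N = 0" using that by (simp add: T_def p)
      then have "b = 0" "d = 0"
        using coef[where v=v and b=b and d=d] bounded_bilinear.zero_left[OF bil] by simp_all
      then show ?thesis using that D_eq_0[OF y] by (simp add: T_def p zero_prod_def)
    qed
    then have "inj T" using linear_injective_0[OF T] by blast
    then have "surj T" using linear_inj_imp_surj_DIM[OF T] dim_e False by simp
    then obtain v b d where a: "a = ddir f y v + b *\<^sub>R f y + d *\<^sub>R N"
      unfolding T_def by (force simp: surj_def)
    then show thesis using that[of v] coef[where v=v and b=b and d=d] by simp
  qed
qed

text \<open>Ambient vectors are compared by pairing with this basis. As \<open>B\<close> may be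
  Lorentzian, this goes through its positivity on the orthogonal complement of the position
  vector.\<close>

lemma nondegenerate:
  assumes y: "y \<in> U" and N: "unit_normal y N"
    and "\<And>v. B a (ddir f y v) = 0" "c * B a (f y) = 0" "B a N = 0"
  shows "a = 0"
proof (rule ccontr)
  assume "a \<noteq> 0"
  then have "B a a > 0" using pos[OF y] assms(4) by blast
  moreover obtain t where "a = ddir f y t + (c * B a (f y)) *\<^sub>R f y + B a N *\<^sub>R N"
    using normal_decomposition[OF y N] .
  then have "a = ddir f y t" using assms(4,5) by simp
  ultimately show False using assms(3)[of t] by simp
qed

lemma Vn_decomposition:
  assumes y: "y \<in> U" and N: "unit_normal y N"
  shows "Vn y v w = B (D2 y v w) N *\<^sub>R N - (c * g y v w) *\<^sub>R f y"
proof -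
  have N': "B N N = 1" "c * B N (f y) = 0" "\<And>v. B N (ddir f y v) = 0" "\<And>v. B (ddir f y v) N = 0"
    using N by (auto simp: unit_normal_def sym)
  have cV: "c * B (Vn y v w) (f y) = - c * g y v w"
    using B_D2_f[OF y] B_D_f[OF y, of "christoffel g y v w"] by (simp add: Vn_def B_simps algebra_simps)
  have VN: "B (Vn y v w) N = B (D2 y v w) N" using N' by (simp add: Vn_def B_simps)
  let ?a = "Vn y v w - (B (D2 y v w) N *\<^sub>R N - (c * g y v w) *\<^sub>R f y)"
  have "?a = 0"
  proof (intro nondegenerate[OF y N])
    show "B ?a (ddir f y u) = 0" for u
      using N' B_f_D[OF y, of u] by (auto simp: B_simps Vn_normal[OF y])
    show "c * B ?a (f y) = 0"
      using N' cV quad[OF y] by (cases "c = 0") (simp_all add: B_simps algebra_simps)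
    show "B ?a N = 0"
      using N' VN by (auto simp: B_simps sym)
  qed
  then show ?thesis by simp
qed

text \<open>\<open>N\<close> enters only in pairs, so its sign cancels; the last term is the
  contribution of the position vector.\<close>

lemma B_Vn_Vn:
  assumes y: "y \<in> U" and N: "unit_normal y N"
  shows "B (Vn y v w) (Vn y u z) = B (D2 y v w) N * B (D2 y u z) N + c * g y v w * g y u z"
proof -
  have N': "B N N = 1" "c * B N (f y) = 0" "c * B (f y) N = 0"
    using N by (auto simp: unit_normal_def sym)
  have "B (Vn y v w) (Vn y u z) = B (D2 y v w) N * B (D2 y u z) N + c * (c * B (f y) (f y)) * g y v w * g y u z
     - g y u z * B (D2 y v w) N * (c * B N (f y)) - g y v w * B (D2 y u z) N * (c * B (f y) N)"
    unfolding Vn_decomposition[OF y N] using N'(1) by (simp add: B_simps algebra_simps)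
  then show ?thesis using N' quad[OF y] by (auto split: if_splits)
qed

text \<open>One step of Gram-Schmidt: the constant vector \<open>N0\<close> loses its tangential
  part \<open>t y\<close> and its component along \<open>f y\<close>, and is normalised where the
  remainder \<open>M y\<close> has positive square.\<close>

lemma smooth_normal_extension:
  assumes y: "y0 \<in> U" and N0: "unit_normal y0 N0"
  obtains V N where "open V" "y0 \<in> V" "V \<subseteq> U" "smooth_on V N" "N y0 = N0"
    "\<And>y. y \<in> V \<Longrightarrow> unit_normal y (N y)"
proof -
  define t where "t y = matrix_inv (gram g y) *v (\<chi> i. B N0 (ddir f y (axis i 1)))" for y
  define M where "M y = N0 - ddir f y (t y) - (c * B N0 (f y)) *\<^sub>R f y" for y
  have t: "g y (t y) u = B N0 (ddir f y u)" if "y \<in> U" for y u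
  proof -
    have "linear (\<lambda>u. B N0 (ddir f y u))"
      using linear_compose[OF linear_D[OF that] linear_B] by (simp add: o_def)
    then show ?thesis unfolding t_def by (intro matrix_inv_gram that) auto
  qed
  have "smooth_on U t"
    unfolding t_def
    by (intro smooth_matrix_inv_gram open_U)
      (auto intro!: smooth_on_bilinear[OF bil open_U] smooth_on_const smooth_on_ddir smooth_f)
  then have sM: "smooth_on U M"
    unfolding M_def
    by (intro smooth_on_diff open_U smooth_on_const smooth_on_ddir_field(1) smooth_f
        smooth_on_scaleR smooth_on_mult smooth_on_bilinear[OF bil])
  have MD: "B (M y) (ddir f y v) = 0" if "y \<in> U" for y v
    using t[OF that, of v] B_f_D[OF that, of v] g_eq[OF that] 
    by (auto simp: M_def B_simps)
  have Mf: "c * B (M y) (f y) = 0" if "y \<in> U" for y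
    using B_D_f[OF that] quad[OF that] by (auto simp: M_def B_simps algebra_simps split: if_splits)
  have "g y0 (t y0) u = g y0 0 u" for u
    using N0 t[OF y] linear_0[OF linear_g'[OF y]] by (simp add: unit_normal_def)
  then have "t y0 = 0" using g_eqI[OF y] by blast
  then have M0: "M y0 = N0"
    using N0 linear_0[OF linear_D[OF y]] by (auto simp: M_def unit_normal_def)
  have sMM: "smooth_on U (\<lambda>y. B (M y) (M y))"
    by (intro smooth_on_bilinear[OF bil] open_U sM)
  define V where "V = {y \<in> U. B (M y) (M y) > 0}"
  have V: "open V"
    unfolding V_def using continuous_open_preimage[OF smooth_on_continuous_on[OF sMM] open_U, of "{0<..}"]
    by (simp add: vimage_def Int_def conj_commute)
  have VU: "V \<subseteq> U" by (auto simp: V_def)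
  define N where "N y = inverse (sqrt (B (M y) (M y))) *\<^sub>R M y" for y
  show thesis
  proof (rule that[of V N])
    have posV: "sqrt (B (M y) (M y)) \<noteq> 0" "B (M y) (M y) > 0" if "y \<in> V" for y
      using that by (auto simp: V_def)
    show "smooth_on V N"
      unfolding N_def
      using posV sMM sM VU
      by (intro smooth_on_scaleR V smooth_on_inverse smooth_on_sqrt) (auto intro: smooth_on_subset)
    show "y0 \<in> V" "N y0 = N0" using y M0 N0 by (auto simp: V_def N_def unit_normal_def)
    show "unit_normal y (N y)" if "y \<in> V" for y
    proof -
      have yU: "y \<in> U" using that VU by auto
      have "inverse (sqrt (B (M y) (M y))) * (inverse (sqrt (B (M y) (M y))) * B (M y) (M y)) = 1"
        using posV[OF that] by (metis divide_inverse_commute mult.commute real_div_sqrt order_less_imp_le right_inverse)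
      moreover have "c * (inverse (sqrt (B (M y) (M y))) * B (M y) (f y)) = 0"
        using Mf[OF yU] by auto
      ultimately show ?thesis using MD[OF yU] by (simp add: unit_normal_def N_def B_simps)
    qed
  qed (use V VU in auto)
qed

end

section \<open>Simultaneous diagonalization\<close>

lemma dim_le_dim_insert:
  fixes S :: "'a::euclidean_space set"
  assumes "S \<subseteq> span (insert v T)"
  shows "dim S \<le> dim T + 1"
proof -
  have "dim S \<le> dim (insert v T)" using dim_mono[OF assms] by simp
  then show ?thesis by (simp add: dim_insert split: if_splits)
qed

locale inner_form =
  fixes G :: "real ^ 'n::finite \<Rightarrow> real ^ 'n \<Rightarrow> real"
  assumes linG: "linear (G v)"
    and symG: "G v w = G w v"
    and posG: "v \<noteq> 0 \<Longrightarrow> G v v > 0"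
begin

lemma linG': "linear (\<lambda>v. G v w)"
  using linG[of w] by (simp add: symG[of _ w])

lemmas G_simps = linear_add[OF linG] linear_diff[OF linG] linear_cmul[OF linG] linear_0[OF linG]
  linear_add[OF linG'] linear_diff[OF linG'] linear_cmul[OF linG'] linear_0[OF linG']
  linear_neg[OF linG] linear_neg[OF linG']

lemma G_eqI: "(\<And>u. G v u = G w u) \<Longrightarrow> v = w"
proof (rule ccontr)
  assume eq: "\<And>u. G v u = G w u" and "v \<noteq> w"
  then have "G (v - w) (v - w) > 0" by (intro posG) auto
  then show False using eq by (simp add: G_simps)
qed

definition frame :: "('n \<Rightarrow> real ^ 'n) \<Rightarrow> bool" where
  "frame e \<longleftrightarrow> (\<forall>i j. G (e i) (e j) = (if i = j then 1 else 0))"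

lemma frameD: "frame e \<Longrightarrow> G (e i) (e j) = (if i = j then 1 else 0)"
  by (simp add: frame_def)

lemma frame_expand:
  assumes e: "frame e"
  shows "(\<Sum>i\<in>UNIV. G v (e i) *\<^sub>R e i) = v"
proof -
  define T where "T x = (\<Sum>i\<in>UNIV. (x $ i) *\<^sub>R e i)" for x
  have T: "linear T"
    unfolding T_def by (intro linearI) (simp_all add: algebra_simps sum.distrib scaleR_sum_right)
  have coef: "G (T x) (e k) = x $ k" for x k
    by (simp add: T_def linear_sum[OF linG'] G_simps frameD[OF e] if_distrib cong: if_cong)
  have "inj T" using linear_injective_0[OF T] coef by (metis G_simps(8) vec_eq_iff zero_index)
  then have "surj T" using linear_injective_imp_surjective[OF T] by blast
  then obtain x where x: "v = T x" by (metis surjD)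
  then have "T x = (\<Sum>i\<in>UNIV. G v (e i) *\<^sub>R e i)" using coef by (simp add: T_def)
  then show ?thesis using x by simp
qed

lemma frame_eqI:
  assumes e: "frame e" and eq: "\<And>l. G v (e l) = G w (e l)"
  shows "v = w"
proof -
  have "(\<Sum>i\<in>UNIV. G v (e i) *\<^sub>R e i) = (\<Sum>i\<in>UNIV. G w (e i) *\<^sub>R e i)"
    by (simp only: eq)
  then show ?thesis by (simp only: frame_expand[OF e])
qed

lemma linear_frame_zero:
  assumes e: "frame e" and T: "linear T" and 0: "\<And>i. T (e i) = (0 :: 'b::real_vector)"
  shows "T v = 0"
proof -
  have "T v = T (\<Sum>i\<in>UNIV. G v (e i) *\<^sub>R e i)" by (simp only: frame_expand[OF e])
  then show ?thesis using 0 by (simp add: linear_sum[OF T] linear_cmul[OF T])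
qed

lemma bilinear_frame_expand:
  assumes e: "frame e" and "\<And>v. linear (T v)" "\<And>w. linear (\<lambda>v. T v w)"
  shows "T v w = (\<Sum>i\<in>UNIV. \<Sum>j\<in>UNIV. G v (e i) * G w (e j) * (T (e i) (e j) :: real))"
proof -
  have 1: "T v w = (\<Sum>i\<in>UNIV. G v (e i) * T (e i) w)" for v
    by (subst frame_expand[OF e, of v, symmetric])
      (simp add: linear_sum[OF assms(3)] linear_cmul[OF assms(3)])
  have 2: "T v w = (\<Sum>i\<in>UNIV. G w (e i) * T v (e i))" for v
    by (subst frame_expand[OF e, of w, symmetric])
      (simp add: linear_sum[OF assms(2)] linear_cmul[OF assms(2)])
  show ?thesis
    by (subst 1, subst 2) (simp add: sum_distrib_left mult.assoc)
qed

lemma parseval: "frame e \<Longrightarrow> G v w = (\<Sum>i\<in>UNIV. G v (e i) * G w (e i))"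
  by (subst bilinear_frame_expand[of e G v w])
    (auto simp: frameD linG linG' if_distrib cong: if_cong)

text \<open>Expand each vector of \<open>e'\<close> in \<open>e\<close> and apply Parseval's
  identity for \<open>e'\<close> to the coefficients.\<close>

lemma trace_frame_independent:
  fixes T :: "real ^ 'n \<Rightarrow> real ^ 'n \<Rightarrow> real"
  assumes e: "frame e" and e': "frame e'" and T: "\<And>v. linear (T v)" "\<And>w. linear (\<lambda>v. T v w)"
  shows "(\<Sum>i\<in>UNIV. T (e' i) (e' i)) = (\<Sum>i\<in>UNIV. T (e i) (e i))"
proof -
  have "(\<Sum>i\<in>UNIV. T (e' i) (e' i))
      = (\<Sum>i\<in>UNIV. \<Sum>j\<in>UNIV. \<Sum>k\<in>UNIV. G (e' i) (e j) * G (e' i) (e k) * T (e j) (e k))"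
    by (intro sum.cong refl) (rule bilinear_frame_expand[OF e T])
  also have "\<dots> = (\<Sum>j\<in>UNIV. \<Sum>i\<in>UNIV. \<Sum>k\<in>UNIV. G (e' i) (e j) * G (e' i) (e k) * T (e j) (e k))"
    by (rule sum.swap)
  also have "\<dots> = (\<Sum>j\<in>UNIV. \<Sum>k\<in>UNIV. \<Sum>i\<in>UNIV. G (e' i) (e j) * G (e' i) (e k) * T (e j) (e k))"
    by (rule sum.cong[OF refl]) (rule sum.swap)
  also have "\<dots> = (\<Sum>j\<in>UNIV. \<Sum>k\<in>UNIV. G (e j) (e k) * T (e j) (e k))"
    by (intro sum.cong refl) (simp add: parseval[OF e', of "e _" "e _"] sum_distrib_right symG)
  also have "\<dots> = (\<Sum>i\<in>UNIV. T (e i) (e i))"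
    by (simp add: frameD[OF e] if_distrib[of "\<lambda>x. x * _"] cong: if_cong)
  finally show ?thesis .
qed

text \<open>At a maximizer \<open>v\<close> of the Rayleigh quotient, with value \<open>\<rho>\<close>, the form \<open>H - \<rho> G\<close> is negative
  semidefinite on \<open>S\<close> and vanishes at \<open>v\<close>, so \<open>v\<close> lies in its kernel.\<close>

lemma rayleigh_maximizer:
  fixes H :: "real ^ 'n \<Rightarrow> real ^ 'n \<Rightarrow> real"
  assumes H: "\<And>v. linear (H v)" "\<And>v w. H v w = H w v"
    and S: "subspace S" "dim S > 0"
  obtains v where "v \<in> S" "G v v = 1" "\<And>w. w \<in> S \<Longrightarrow> G v w = 0 \<Longrightarrow> H v w = 0"
proof -
  have H': "linear (\<lambda>v. H v w)" for w using H(1)[of w] by (simp add: H(2)[of _ w])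
  have cont: "continuous_on A (\<lambda>v. T v v)" if "\<And>v. linear (T v)" "\<And>w. linear (\<lambda>v. T v w)"
    for A and T :: "real ^ 'n \<Rightarrow> real ^ 'n \<Rightarrow> real"
  proof -
    have "bilinear T" using that by (simp add: bilinear_def)
    then have "bounded_bilinear T" by (simp add: bilinear_conv_bounded_bilinear)
    then show ?thesis
      by (rule bounded_bilinear.continuous_on) (auto intro: continuous_intros)
  qed
  obtain x where x: "x \<in> S" "x \<noteq> 0"
    using S(2) dim_eq_0[of S] by fastforce
  let ?A = "S \<inter> sphere 0 1"
  have "x /\<^sub>R norm x \<in> ?A"
    using x by (auto intro: subspace_scale[OF S(1)])
  then have ne: "?A \<noteq> {}" by blast
  have nz: "G v v > 0" if "v \<in> ?A" for v using that posG[of v] by (cases "v = 0") auto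
  have "compact ?A" using closed_subspace[OF S(1)] compact_sphere by (rule closed_Int_compact)
  moreover have "continuous_on ?A (\<lambda>v. H v v / G v v)"
    using nz less_imp_neq
    by (intro continuous_on_divide cont[of H, OF H(1) H'] cont[of G, OF linG linG'] ballI) fastforce
  ultimately obtain v where v: "v \<in> ?A" and max: "\<And>w. w \<in> ?A \<Longrightarrow> H w w / G w w \<le> H v v / G v v"
    using continuous_attains_sup[OF _ ne, of "\<lambda>v. H v v / G v v"] by blast
  define \<rho> where "\<rho> = H v v / G v v"
  have vv: "G v v > 0" using nz v by blast
  define Q where "Q v w = H v w - \<rho> * G v w" for v w
  have Q: "Q (a + b) d = Q a d + Q b d" "Q d (a + b) = Q d a + Q d b" "Q (r *\<^sub>R a) b = r * Q a b"
    "Q a (r *\<^sub>R b) = r * Q a b" "Q a b = Q b a" for a b d r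
    unfolding Q_def using H(2)[of a b] symG[of a b]
    by (simp_all add: G_simps linear_add[OF H(1)] linear_add[OF H'] linear_cmul[OF H(1)] linear_cmul[OF H']
        algebra_simps)
  have Qv: "Q v v = 0" using vv by (simp add: Q_def \<rho>_def)
  have neg: "Q w w \<le> 0" if w: "w \<in> S" for w
  proof (cases "w = 0")
    case True
    then show ?thesis using Q(3)[of 0 0 0] by simp
  next
    case False
    let ?u = "w /\<^sub>R norm w"
    have u: "?u \<in> ?A" using w False by (auto intro: subspace_scale[OF S(1)])
    then have "G ?u ?u > 0" using nz by blast
    then have "Q ?u ?u \<le> 0"
      using max[OF u] by (simp add: Q_def \<rho>_def divide_le_eq)
    then have "inverse (norm w) * (inverse (norm w) * Q w w) \<le> 0" by (simp only: Q(3,4))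
    then show ?thesis using False by (simp add: mult_le_0_iff)
  qed
  have Q0: "Q v w = 0" if w: "w \<in> S" for w
  proof (rule ccontr)
    assume nz: "Q v w \<noteq> 0"
    \<comment> \<open>As \<open>Q v v = 0\<close>, the linear term of \<open>Q\<close> at
      \<open>v + t *\<^sub>R w\<close> is \<open>2 * t * Q v w\<close>; with this \<open>t\<close>
      it outweighs the quadratic term and makes the value positive, against
      \<open>neg\<close>.\<close>
    define t where "t = Q v w / (\<bar>Q w w\<bar> + 1)"
    have "v + t *\<^sub>R w \<in> S"
      using v w S(1) by (auto intro: subspace_add subspace_scale)
    from neg[OF this] have "2 * (t * Q v w) + t * t * Q w w \<le> 0"
      using Qv by (simp add: Q(1-4) Q(5)[of w v] algebra_simps)
    moreover have "t * Q v w = t * t * (\<bar>Q w w\<bar> + 1)"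
    proof -
      have "Q v w = t * (\<bar>Q w w\<bar> + 1)" using abs_ge_zero[of "Q w w"] by (simp add: t_def)
      then show ?thesis by simp
    qed
    moreover have "t * t > 0"
    proof -
      have "\<bar>Q w w\<bar> + 1 \<noteq> 0" using abs_ge_zero[of "Q w w"] by linarith
      then have "t \<noteq> 0" using nz by (simp add: t_def)
      then show ?thesis using not_real_square_gt_zero by blast
    qed
    moreover have "(t * t) * (2 * \<bar>Q w w\<bar> + 2 + Q w w) > 0"
    proof (rule mult_pos_pos)
      show "2 * \<bar>Q w w\<bar> + 2 + Q w w > 0" by arith
    qed fact
    moreover have "(t * t) * (2 * \<bar>Q w w\<bar> + 2 + Q w w) = 2 * (t * t * (\<bar>Q w w\<bar> + 1)) + t * t * Q w w"
      by (simp only: distrib_left mult.left_commute[of "t * t" 2] mult_1_right)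
    ultimately show False by linarith
  qed
  let ?r = "inverse (sqrt (G v v))"
  have r: "?r * (?r * G v v) = 1"
  proof -
    have 1: "inverse y * (inverse y * (y * y)) = 1" if "y \<noteq> 0" for y :: real
      using that by (simp add: field_simps)
    have 2: "sqrt (G v v) * sqrt (G v v) = G v v" "sqrt (G v v) \<noteq> 0" using vv by simp_all
    show ?thesis by (rule 1[OF 2(2), unfolded 2(1)])
  qed
  show thesis
  proof (rule that[of "?r *\<^sub>R v"])
    show "?r *\<^sub>R v \<in> S" using v by (auto intro: subspace_scale[OF S(1)])
    show "G (?r *\<^sub>R v) (?r *\<^sub>R v) = 1" using r by (simp only: G_simps real_scaleR_def)
    show "H (?r *\<^sub>R v) w = 0" if "w \<in> S" "G (?r *\<^sub>R v) w = 0" for w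
    proof -
      have "?r * G v w = 0" using that(2) by (simp only: G_simps real_scaleR_def)
      moreover have "?r \<noteq> 0" using vv by simp
      ultimately have "G v w = 0" by (metis mult_eq_0_iff)
      then have "H v w = 0" using Q0[OF that(1)] unfolding Q_def by simp
      then show ?thesis unfolding linear_cmul[OF H'] by simp
    qed
  qed
qed

text \<open>A maximizer in \<open>S\<close> is split off and the induction continues in its
  \<open>G\<close>-orthogonal complement within \<open>S\<close>; the maximizer is then also
  \<open>H\<close>-orthogonal to all later vectors.\<close>

lemma diagonal_family:
  fixes H :: "real ^ 'n \<Rightarrow> real ^ 'n \<Rightarrow> real"
  assumes H: "\<And>v. linear (H v)" "\<And>v w. H v w = H w v" and "finite (I :: 'n set)"
  shows "subspace S \<Longrightarrow> card I \<le> dim S \<Longrightarrow> \<exists>e. (\<forall>i\<in>I. e i \<in> S) \<and>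
    (\<forall>i\<in>I. \<forall>j\<in>I. G (e i) (e j) = (if i = j then 1 else 0) \<and> (i \<noteq> j \<longrightarrow> H (e i) (e j) = 0))"
  using assms(3)
proof (induction I arbitrary: S rule: finite_induct)
  case empty
  then show ?case by simp
next
  case (insert a J)
  have "dim S > 0" using insert by simp
  from rayleigh_maximizer[OF H insert.prems(1) this]
  obtain v where v: "v \<in> S" "G v v = 1" "\<And>w. w \<in> S \<Longrightarrow> G v w = 0 \<Longrightarrow> H v w = 0" by blast
  let ?S = "{w \<in> S. G v w = 0}"
  have "subspace ?S"
    using insert.prems(1) unfolding subspace_def by (auto simp: G_simps)
  moreover have "card J \<le> dim ?S"
  proof -
    have "S \<subseteq> span (insert v ?S)"
    proof
      fix w assume w: "w \<in> S"
      have "w - G v w *\<^sub>R v \<in> ?S"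
        using w v insert.prems(1) by (auto simp: G_simps intro: subspace_diff subspace_scale)
      then have "(w - G v w *\<^sub>R v) + G v w *\<^sub>R v \<in> span (insert v ?S)"
        by (intro span_add span_scale span_base) auto
      then show "w \<in> span (insert v ?S)" by simp
    qed
    from dim_le_dim_insert[OF this] show ?thesis using insert by simp
  qed
  ultimately have "\<exists>e. (\<forall>i\<in>J. e i \<in> ?S) \<and>
    (\<forall>i\<in>J. \<forall>j\<in>J. G (e i) (e j) = (if i = j then 1 else 0) \<and> (i \<noteq> j \<longrightarrow> H (e i) (e j) = 0))"
    by (rule insert.IH)
  then obtain e where e: "\<forall>i\<in>J. e i \<in> ?S"
    "\<forall>i\<in>J. \<forall>j\<in>J. G (e i) (e j) = (if i = j then 1 else 0) \<and> (i \<noteq> j \<longrightarrow> H (e i) (e j) = 0)"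
    by auto
  have av: "G v (e i) = 0 \<and> G (e i) v = 0 \<and> H v (e i) = 0 \<and> H (e i) v = 0" if "i \<in> J" for i
  proof -
    have "e i \<in> S" "G v (e i) = 0" using e(1) that by auto
    with v(3)[of "e i"] symG[of v "e i"] H(2)[of v "e i"] show ?thesis by metis
  qed
  let ?e = "e(a := v)"
  have "?e i \<in> S" if "i \<in> insert a J" for i
    using that e(1) v(1) by auto
  moreover have "G (?e i) (?e j) = (if i = j then 1 else 0) \<and> (i \<noteq> j \<longrightarrow> H (?e i) (?e j) = 0)"
    if "i \<in> insert a J" "j \<in> insert a J" for i j
  proof -
    have "G (e i) (e j) = (if i = j then 1 else 0) \<and> (i \<noteq> j \<longrightarrow> H (e i) (e j) = 0)"
      if "i \<in> J" "j \<in> J" using e(2) that by blast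
    then show ?thesis
      using that av[of i] av[of j] v(2) insert.hyps(2) by (cases "i = a"; cases "j = a") simp_all
  qed
  ultimately show ?case by blast
qed

lemma diagonal_frame:
  fixes H :: "real ^ 'n \<Rightarrow> real ^ 'n \<Rightarrow> real"
  assumes H: "\<And>v. linear (H v)" "\<And>v w. H v w = H w v"
  obtains e where "frame e" "\<And>i j. i \<noteq> j \<Longrightarrow> H (e i) (e j) = 0"
  using diagonal_family[OF H, of UNIV UNIV] unfolding frame_def by auto

end

section \<open>Principal curvatures\<close>

text \<open>The principal curvatures of multiplicities \<open>p\<close> and \<open>n - p\<close>: they solve \<open>\<lambda> * \<mu> = - c\<close>
  and \<open>(p - 1) * \<lambda>\<^sup>2 = (n - p - 1) * \<mu>\<^sup>2\<close>.\<close>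

definition major_curv :: "real \<Rightarrow> nat \<Rightarrow> nat \<Rightarrow> real" where
  "major_curv c n p = sqrt (\<bar>c\<bar> * sqrt ((real (n - p) - 1) / (real p - 1)))"

definition minor_curv :: "real \<Rightarrow> nat \<Rightarrow> nat \<Rightarrow> real" where
  "minor_curv c n p = - c / major_curv c n p"

text \<open>The inequality \<open>2 * p < n\<close> makes \<open>p\<close> the smaller multiplicity,
  to which the principal curvature of larger absolute value belongs. Equal multiplicities would give
  opposite principal curvatures, which is an Einstein point.\<close>

definition admissible :: "real \<Rightarrow> nat \<Rightarrow> nat \<Rightarrow> bool" where
  "admissible c n p \<longleftrightarrow> c \<noteq> 0 \<and> 2 \<le> p \<and> 2 * p < n"

text \<open>Eliminating the minor curvature from the two equations shows that the fourth power of
  the major one is \<open>c\<^sup>2\<close> times the ratio under the root. Hence the two squares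
  are \<bar>c\<bar> multiplied and divided by the same \<open>s\<close>.\<close>

lemma admissible_curv:
  assumes "admissible c n p"
  defines "s \<equiv> sqrt ((real (n - p) - 1) / (real p - 1))"
  shows "s > 1" "major_curv c n p > 0" "major_curv c n p ^ 2 = \<bar>c\<bar> * s"
    "major_curv c n p * minor_curv c n p = - c"
    "(real p - 1) * major_curv c n p ^ 2 = (real (n - p) - 1) * minor_curv c n p ^ 2"
    "minor_curv c n p ^ 2 = \<bar>c\<bar> / s" "\<bar>minor_curv c n p\<bar> < major_curv c n p"
proof -
  have p: "c \<noteq> 0" "real p - 1 > 0" "real (n - p) - 1 > real p - 1"
    using assms(1) by (auto simp: admissible_def of_nat_diff)
  have r: "(real (n - p) - 1) / (real p - 1) > 1" using p by (simp add: less_divide_eq)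
  then show s: "s > 1" unfolding s_def using real_sqrt_less_mono[OF r] by simp
  have cs: "\<bar>c\<bar> * s > 0" using p s by simp
  show pos: "major_curv c n p > 0" using cs by (simp add: major_curv_def s_def)
  show sq: "major_curv c n p ^ 2 = \<bar>c\<bar> * s" using cs by (simp add: major_curv_def s_def)
  show "major_curv c n p * minor_curv c n p = - c" using pos by (simp add: minor_curv_def)
  have "minor_curv c n p ^ 2 = c\<^sup>2 / (\<bar>c\<bar> * s)"
    by (simp add: minor_curv_def power_divide sq)
  then show sq': "minor_curv c n p ^ 2 = \<bar>c\<bar> / s"
    using p by (simp add: power2_eq_square abs_if field_simps split: if_splits)
  have s2: "s * s = (real (n - p) - 1) / (real p - 1)" 
    unfolding s_def power2_eq_square[symmetric]
    by (rule real_sqrt_pow2[OF less_imp_le[OF order.strict_trans[OF zero_less_one r]]])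
  then have "(real p - 1) * (s * s) = real (n - p) - 1" using p by simp
  then have "(real p - 1) * s = (real (n - p) - 1) / s" using s by (simp add: field_simps)
  then have "\<bar>c\<bar> * ((real p - 1) * s) = \<bar>c\<bar> * ((real (n - p) - 1) / s)" by simp
  then show "(real p - 1) * major_curv c n p ^ 2 = (real (n - p) - 1) * minor_curv c n p ^ 2"
    unfolding sq sq' by (simp add: mult_ac)
  have "\<bar>c\<bar> / s < \<bar>c\<bar> * s"
  proof -
    have "\<bar>c\<bar> / s < \<bar>c\<bar>" "\<bar>c\<bar> < \<bar>c\<bar> * s" using p s by (simp_all add: divide_less_eq)
    then show ?thesis by linarith
  qed
  then have "minor_curv c n p ^ 2 < major_curv c n p ^ 2" unfolding sq sq' .
  then show "\<bar>minor_curv c n p\<bar> < major_curv c n p"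
    using pos by (metis abs_of_pos power2_abs power2_less_imp_less less_imp_le)
qed

text \<open>Equality of the two ratios reduces to
  \<open>(real n - 2) * (real p' - real p) = 0\<close>. Consequently the largest principal curvature
  determines the multiplicities.\<close>

lemma major_curv_inj:
  assumes "admissible c n p" "admissible c n p'" "major_curv c n p = major_curv c n p'"
  shows "p = p'"
proof -
  have "\<bar>c\<bar> * sqrt ((real (n - p) - 1) / (real p - 1)) = \<bar>c\<bar> * sqrt ((real (n - p') - 1) / (real p' - 1))"
    using assms admissible_curv(3) by metis
  then have "(real (n - p) - 1) / (real p - 1) = (real (n - p') - 1) / (real p' - 1)"
    using assms(1) by (simp add: admissible_def)
  then have "(real n - real p - 1) * (real p' - 1) = (real n - real p' - 1) * (real p - 1)"
    using assms by (simp add: admissible_def of_nat_diff frac_eq_eq)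
  then have "(real n - 2) * (real p' - real p) = 0" by (simp add: algebra_simps)
  then show ?thesis using assms by (auto simp: admissible_def)
qed

section \<open>Algebra of the principal curvatures\<close>

lemma sum_two_valued:
  fixes I :: "'n::finite set" and u v :: real
  assumes "a \<in> I"
  shows "(\<Sum>i\<in>UNIV - {a}. if i \<in> I then u else v) = (real (card I) - 1) * u + real (card (- I)) * v"
proof -
  have "(\<Sum>i\<in>UNIV. if i \<in> I then u else v) = real (card I) * u + real (card (- I)) * v"
    by (simp add: sum.If_cases Compl_eq)
  moreover have "(\<Sum>i\<in>UNIV. if i \<in> I then u else v) = u + (\<Sum>i\<in>UNIV - {a}. if i \<in> I then u else v)"
    using assms by (subst sum.remove[of UNIV a]) auto
  ultimately show ?thesis by (simp add: algebra_simps)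
qed

text \<open>Since \<open>x * y = - c\<close>, sectional curvatures mixing the blocks vanish, and
  within the blocks they are \<open>x * (x - y)\<close> and \<open>y * (y - x)\<close>. The weak
  Einstein condition compares sums of their squares, the Einstein condition sums of their first
  powers.\<close>

lemma two_principal_curvatures:
  fixes lam :: "'n::finite \<Rightarrow> real"
  assumes n: "CARD('n) \<ge> 3"
    and lam: "\<And>i. lam i = (if i \<in> I then x else y)"
    and I: "I \<noteq> {}" "- I \<noteq> {}" "card I \<le> card (- I)"
    and xy: "x \<noteq> y" "x * y = - c"
    and W: "\<And>a b. (\<Sum>i\<in>UNIV - {a}. (c + lam a * lam i)\<^sup>2) = (\<Sum>i\<in>UNIV - {b}. (c + lam b * lam i)\<^sup>2)"
  shows "(\<forall>a b. (\<Sum>i\<in>UNIV - {a}. c + lam a * lam i) = (\<Sum>i\<in>UNIV - {b}. c + lam b * lam i)) \<or>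
    (admissible c CARD('n) (card I) \<and> \<bar>x\<bar> = major_curv c CARD('n) (card I))"
proof -
  define p q where "p = card I" and "q = card (- I)"
  have pq: "CARD('n) = p + q"
    unfolding p_def q_def using card_Un_disjoint[of I "- I"] by simp
  have pq0: "p \<ge> 1" "q \<ge> 1" "p \<le> q"
    using I by (auto simp: p_def q_def Suc_le_eq card_gt_0_iff)
  \<comment> \<open>\<phi> will be squaring for the weak Einstein condition and the identity for
    Ricci curvature; \<open>\<phi> 0 = 0\<close> removes the mixed terms.\<close>
  have sI: "(\<Sum>i\<in>UNIV - {a}. \<phi> (c + lam a * lam i)) = (real p - 1) * \<phi> (x * (x - y))"
    if "a \<in> I" "\<phi> 0 = 0" for a and \<phi> :: "real \<Rightarrow> real"
  proof -
    have c: "c = - (x * y)" using xy by simp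
    have "(\<Sum>i\<in>UNIV - {a}. \<phi> (c + lam a * lam i)) = (\<Sum>i\<in>UNIV - {a}. if i \<in> I then \<phi> (x * (x - y)) else 0)"
      using that c by (intro sum.cong) (auto simp: lam algebra_simps)
    then show ?thesis using sum_two_valued[OF that(1), of "\<phi> (x * (x - y))" 0] by (simp add: p_def)
  qed
  have sJ: "(\<Sum>i\<in>UNIV - {a}. \<phi> (c + lam a * lam i)) = (real q - 1) * \<phi> (y * (y - x))"
    if "a \<in> - I" "\<phi> 0 = 0" for a and \<phi> :: "real \<Rightarrow> real"
  proof -
    have c: "c = - (x * y)" using xy by simp
    have "(\<Sum>i\<in>UNIV - {a}. \<phi> (c + lam a * lam i)) = (\<Sum>i\<in>UNIV - {a}. if i \<in> - I then \<phi> (y * (y - x)) else 0)"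
      using that c by (intro sum.cong) (auto simp: lam algebra_simps)
    then show ?thesis using sum_two_valued[OF that(1), of "\<phi> (y * (y - x))" 0] by (simp add: q_def)
  qed
  obtain i0 j0 where ij: "i0 \<in> I" "j0 \<in> - I" using I by blast
  have "(real p - 1) * (x * (x - y))\<^sup>2 = (real q - 1) * (y * (y - x))\<^sup>2"
    using W[of i0 j0] sI[OF ij(1), of "\<lambda>t. t\<^sup>2"] sJ[OF ij(2), of "\<lambda>t. t\<^sup>2"] by simp
  then have "((real p - 1) * x\<^sup>2 - (real q - 1) * y\<^sup>2) * (x - y)\<^sup>2 = 0"
    by (simp add: power2_eq_square algebra_simps)
  then have W': "(real p - 1) * x\<^sup>2 = (real q - 1) * y\<^sup>2" using xy by simp
  show ?thesis
  \<comment> \<open>This equation is equality of the Ricci curvatures of the two blocks, divided by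
    \<open>x - y\<close>.\<close>
  proof (cases "(real p - 1) * x = - ((real q - 1) * y)")
    case True
    have "(real p - 1) * (x * (x - y)) = (real q - 1) * (y * (y - x))"
      using arg_cong[OF True, of "\<lambda>t. t * (x - y)"] by (simp add: algebra_simps)
    then have "(\<Sum>i\<in>UNIV - {a}. c + lam a * lam i) = (real p - 1) * (x * (x - y))" for a
      using sI[of a "\<lambda>t. t"] sJ[of a "\<lambda>t. t"] by (cases "a \<in> I") auto
    then show ?thesis by simp
  next
    case False
    have c: "c \<noteq> 0"
    proof
      assume "c = 0"
      then have "x = 0 \<or> y = 0" using xy by simp
      then have "(real p - 1) * x = 0 \<and> (real q - 1) * y = 0" using W' by auto
      with False show False by simp
    qed
    then have nz: "x \<noteq> 0" "y \<noteq> 0" using xy by auto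
    have "p \<noteq> 1"
    proof
      assume "p = 1"
      then have "q = 1" using W' nz by simp
      with \<open>p = 1\<close> pq n show False by simp
    qed
    then have p2: "p \<ge> 2" using pq0 by simp
    have "p \<noteq> q"
    proof
      assume "p = q"
      then have "x\<^sup>2 = y\<^sup>2" using W' p2 by simp
      then have "x = - y" using xy power2_eq_iff by blast
      with False \<open>p = q\<close> show False by simp
    qed
    then have adm: "admissible c CARD('n) p"
      using c p2 pq0 pq by (simp add: admissible_def)
    have q: "CARD('n) - p = q" using pq by simp
    have "x ^ 2 * ((real p - 1) * x ^ 2) = x ^ 2 * ((real q - 1) * y ^ 2)" using W' by simp
    also have "\<dots> = (real q - 1) * (x * y) ^ 2" by (simp add: power2_eq_square algebra_simps)
    finally have "(x ^ 2) ^ 2 = c ^ 2 * ((real q - 1) / (real p - 1))"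
      using p2 xy by (simp add: power2_eq_square field_simps)
    then have "x ^ 2 = sqrt (c ^ 2 * ((real q - 1) / (real p - 1)))"
      by (metis real_sqrt_abs abs_of_nonneg zero_le_power2)
    then have "x ^ 2 = \<bar>c\<bar> * sqrt ((real q - 1) / (real p - 1))"
      by (simp only: real_sqrt_mult real_sqrt_abs)
    then have "\<bar>x\<bar> = major_curv c CARD('n) p"
      unfolding major_curv_def q by (metis real_sqrt_abs)
    then show ?thesis using adm by (simp add: p_def)
  qed
qed

definition type_curv :: "real \<Rightarrow> 'n::finite set \<Rightarrow> 'n \<Rightarrow> real" where
  "type_curv c I i = (if i \<in> I then major_curv c CARD('n) (card I) else minor_curv c CARD('n) (card I))"

lemma principal_curvatures_cases:
  fixes lam :: "'n::finite \<Rightarrow> real"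
  assumes n: "CARD('n) \<ge> 3"
    and S: "\<And>i j k. i \<noteq> j \<Longrightarrow> j \<noteq> k \<Longrightarrow> i \<noteq> k \<Longrightarrow> (c + lam i * lam j) * (lam k * (lam j - lam i)) = 0"
    and W: "\<And>a b. (\<Sum>i\<in>UNIV - {a}. (c + lam a * lam i)\<^sup>2) = (\<Sum>i\<in>UNIV - {b}. (c + lam b * lam i)\<^sup>2)"
  shows "(\<forall>a b. (\<Sum>i\<in>UNIV - {a}. c + lam a * lam i) = (\<Sum>i\<in>UNIV - {b}. c + lam b * lam i)) \<or>
    (\<exists>I \<sigma>. admissible c CARD('n) (card I) \<and> \<sigma>\<^sup>2 = (1 :: real) \<and> (\<forall>i. lam i = \<sigma> * type_curv c I i))"
    (is "?E \<or> ?T")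
proof -
  have cn: "real (card (UNIV - {a})) = real CARD('n) - 1" for a :: 'n
    by (simp add: card_Diff_singleton of_nat_diff Suc_leI)
  have const: ?E if "\<And>i j. i \<noteq> j \<Longrightarrow> c + lam i * lam j = k" for k
  proof -
    have "(\<Sum>i\<in>UNIV - {a}. c + lam a * lam i) = (\<Sum>i\<in>UNIV - {a}. k)" for a
      by (intro sum.cong refl that) auto
    then show ?thesis by (simp add: cn)
  qed
  show ?thesis
  proof (cases "\<exists>i j. i \<noteq> j \<and> lam i \<noteq> lam j \<and> c + lam i * lam j \<noteq> 0")
    case True
    then obtain i j where ij: "i \<noteq> j" "lam i \<noteq> lam j" "c + lam i * lam j \<noteq> 0" by blast
    \<comment> \<open>Semisymmetry for such a pair makes every other principal curvature vanish. The
      case ends up Einstein or contradictory.\<close>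
    have z: "lam k = 0" if "k \<noteq> i" "k \<noteq> j" for k
      using S[of i j k] ij that by simp
    have "\<not> UNIV \<subseteq> {i, j}"
    proof
      assume "UNIV \<subseteq> {i, j}"
      then have "CARD('n) \<le> card {i, j}" by (intro card_mono) auto
      with n ij(1) show False by simp
    qed
    then obtain k where k: "k \<noteq> i" "k \<noteq> j" by blast
    have "(c + lam i * lam k) * (lam j * (lam k - lam i)) = 0"
      using k ij(1) by (intro S) auto
    then have "c = 0 \<or> lam i = 0 \<or> lam j = 0" using z[OF k] by auto
    \<comment> \<open>At most one principal curvature is nonzero, so all products of distinct ones
      vanish and the sectional curvature is constantly \<open>c\<close>.\<close>
    moreover have ?E if "lam i = 0 \<or> lam j = 0"
    proof (rule const)
      show "c + lam a * lam b = c" if "a \<noteq> b" for a b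
        using \<open>lam i = 0 \<or> lam j = 0\<close> z[of a] z[of b] that by auto
    qed
    \<comment> \<open>With \<open>c = 0\<close> the direction \<open>k\<close> is flat while
      \<open>i\<close> is not, which violates the weak Einstein condition.\<close>
    moreover have False if nz: "lam i \<noteq> 0" "lam j \<noteq> 0" and c: "c = 0"
    proof -
      have "(\<Sum>l\<in>UNIV - {k}. (c + lam k * lam l)\<^sup>2) = 0" using z[OF k] c by simp
      then have "(\<Sum>l\<in>UNIV - {i}. (c + lam i * lam l)\<^sup>2) = 0" using W by metis
      then have "(c + lam i * lam j)\<^sup>2 = 0"
        using ij(1) by (subst (asm) sum_nonneg_eq_0_iff) auto
      with ij(3) show False by simp
    qed
    ultimately show ?thesis by blast
  next
    case False
    then have dich: "lam i = lam j \<or> c + lam i * lam j = 0" for i j by (cases "i = j") auto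
    show ?thesis
    proof (cases "\<forall>i j. lam i = lam j")
      case True
      have "c + lam i * lam j = c + lam undefined * lam undefined" for i j
        using True[rule_format, of i undefined] True[rule_format, of j undefined] by (simp only:)
      then show ?thesis by (intro disjI1 const)
    next
      case False
      then obtain i0 j0 where ij: "lam i0 \<noteq> lam j0" by blast
      define x y where "x = lam i0" and "y = lam j0"
      have xy: "x \<noteq> y" "x * y = - c" using ij dich[of i0 j0] by (auto simp: x_def y_def)
      \<comment> \<open>A third value would have product \<open>- c\<close> with both
        \<open>x\<close> and \<open>y\<close>, hence be zero; then \<open>c = 0\<close>, and one of
        \<open>x\<close>, \<open>y\<close> is already zero.\<close>
      have two: "lam k = x \<or> lam k = y" for k
      proof (rule ccontr)
        assume neq: "\<not> (lam k = x \<or> lam k = y)"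
        then have "c + lam k * x = 0" "c + lam k * y = 0"
          using dich[of k i0] dich[of k j0] by (auto simp: x_def y_def)
        then have "lam k * (x - y) = 0" by (simp only: right_diff_distrib)
        then have "lam k = 0" using xy by simp
        then have "c = 0" using \<open>c + lam k * x = 0\<close> by simp
        then have "x = 0 \<or> y = 0" using xy by simp
        with neq \<open>lam k = 0\<close> show False by auto
      qed
      define I where "I = {i. lam i = x}"
      have lamI: "lam i = (if i \<in> I then x else y)" for i using two[of i] by (auto simp: I_def)
      have "i0 \<in> I" "j0 \<in> - I" using ij by (auto simp: I_def x_def)
      then have ne: "I \<noteq> {}" "- I \<noteq> {}" by blast+
      \<comment> \<open>The common sign is that of \<open>u\<close>: the two principal curvatures
        are known only up to reversing the normal.\<close>
      have fin: ?T if "admissible c CARD('n) (card K)" "\<bar>u\<bar> = major_curv c CARD('n) (card K)"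
        "u * v = - c" "\<And>i. lam i = (if i \<in> K then u else v)" for K u v
      proof -
        have pos: "major_curv c CARD('n) (card K) > 0" using admissible_curv(2)[OF that(1)] .
        have u: "u = sgn u * major_curv c CARD('n) (card K)" "(sgn u)\<^sup>2 = 1"
          using that(2) pos by (auto simp: sgn_if abs_if split: if_splits)
        have "v = sgn u * minor_curv c CARD('n) (card K)"
        proof -
          let ?m = "major_curv c CARD('n) (card K)"
          have "?m * (sgn u * v) = (sgn u * ?m) * v" by simp
          also have "\<dots> = - c" unfolding u(1)[symmetric] by (rule that(3))
          finally have "sgn u * v = minor_curv c CARD('n) (card K)"
            using pos unfolding minor_curv_def
            by (metis less_irrefl nonzero_mult_div_cancel_left)
          then have "sgn u * (sgn u * v) = sgn u * minor_curv c CARD('n) (card K)" by simp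
          moreover have "sgn u * (sgn u * v) = (sgn u)\<^sup>2 * v" by (simp only: power2_eq_square mult.assoc)
          ultimately show ?thesis using u(2) by simp
        qed
        then have "lam i = sgn u * type_curv c K i" for i
          using that(4)[of i] u(1) by (simp add: type_curv_def)
        then show ?T using that(1) u(2) by blast
      qed
      show ?thesis
      \<comment> \<open>The block that carries the major curvature must be the smaller one;
        otherwise \<open>I\<close> is exchanged with its complement.\<close>
      proof (cases "card I \<le> card (- I)")
        case True
        from two_principal_curvatures[OF n lamI ne True xy W]
        have "?E \<or> (admissible c CARD('n) (card I) \<and> \<bar>x\<bar> = major_curv c CARD('n) (card I))" .
        moreover have ?T if "admissible c CARD('n) (card I)" "\<bar>x\<bar> = major_curv c CARD('n) (card I)"
          by (rule fin[OF that xy(2) lamI])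
        ultimately show ?thesis by argo
      next
        case False
        have lamJ: "lam i = (if i \<in> - I then y else x)" for i using lamI[of i] by auto
        have "card (- I) \<le> card (- (- I))" using False by simp
        moreover have "- (- I) \<noteq> {}" "y \<noteq> x" and yx: "y * x = - c"
          using ne xy by (auto simp: mult.commute)
        ultimately
        have "?E \<or> (admissible c CARD('n) (card (- I)) \<and> \<bar>y\<bar> = major_curv c CARD('n) (card (- I)))"
          using two_principal_curvatures[OF n lamJ ne(2) _ _ _ yx W] by argo
        moreover have ?T if "admissible c CARD('n) (card (- I))" "\<bar>y\<bar> = major_curv c CARD('n) (card (- I))"
          by (rule fin[OF that yx lamJ])
        ultimately show ?thesis by argo
      qed
    qed
  qed
qed

lemma square_one_mult: "(\<sigma> :: real)\<^sup>2 = 1 \<Longrightarrow> (\<sigma> * x) * (\<sigma> * y) = x * y"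
  by (simp add: power2_eq_square algebra_simps)

text \<open>\<open>RR\<close> is the right-hand side of the Gauss equation for the second fundamental form \<open>H\<close>.\<close>

locale gauss_curvature = inner_form G
  for G :: "real ^ 'n::finite \<Rightarrow> real ^ 'n \<Rightarrow> real" +
  fixes H :: "real ^ 'n \<Rightarrow> real ^ 'n \<Rightarrow> real" and c :: real
  assumes linH: "linear (H v)"
    and symH: "H v w = H w v"
begin

definition RR :: "real ^ 'n \<Rightarrow> real ^ 'n \<Rightarrow> real ^ 'n \<Rightarrow> real ^ 'n \<Rightarrow> real" where
  "RR v w u z = c * (G w u * G v z - G v u * G w z) + H w u * H v z - H v u * H w z"

lemma linH': "linear (\<lambda>v. H v w)"
  using linH[of w] by (simp add: symH[of _ w])

lemmas H_simps = linear_add[OF linH] linear_cmul[OF linH] linear_add[OF linH'] linear_cmul[OF linH']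

definition einstein_frame :: "('n \<Rightarrow> real ^ 'n) \<Rightarrow> real \<Rightarrow> bool" where
  "einstein_frame e \<rho> \<longleftrightarrow> frame e \<and>
     (\<forall>a b. (\<Sum>i\<in>UNIV. RR (e i) (e a) (e b) (e i)) = (if a = b then \<rho> else 0))"

text \<open>Stated through products of two values of \<open>H\<close>, so that it is invariant under
  \<open>N\<close> becoming \<open>- N\<close>.\<close>

definition type_frame :: "('n \<Rightarrow> real ^ 'n) \<Rightarrow> 'n set \<Rightarrow> bool" where
  "type_frame e I \<longleftrightarrow> frame e \<and> (\<forall>i j k l. H (e i) (e j) * H (e k) (e l) =
     (if i = j \<and> k = l then type_curv c I i * type_curv c I k else 0))"

lemma RR_bilinear:
  "linear (RR v w u)" "linear (\<lambda>v. RR v w u z)" "linear (\<lambda>u. RR v w u z)" "linear (\<lambda>w. RR v w u z)"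
  unfolding RR_def by (intro linearI; simp add: H_simps G_simps algebra_simps)+

lemma ricci_bilinear:
  "linear (\<lambda>w. \<Sum>i\<in>UNIV. RR (e i) v w (e i))" "linear (\<lambda>v. \<Sum>i\<in>UNIV. RR (e i) v w (e i))"
  using linear_add[OF RR_bilinear(3)] linear_cmul[OF RR_bilinear(3)]
    linear_add[OF RR_bilinear(4)] linear_cmul[OF RR_bilinear(4)]
  by (auto intro!: linearI simp: sum.distrib sum_distrib_left)

text \<open>The Ricci trace does not depend on the frame, so one good frame yields the condition in
  all frames, as \<open>einstein\<close> demands.\<close>

lemma einstein_frame_ricci:
  assumes e: "einstein_frame e \<rho>" and e': "frame e'"
  shows "(\<Sum>i\<in>UNIV. RR (e' i) v w (e' i)) = \<rho> * G v w"
proof -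
  have fe: "frame e" using e by (simp add: einstein_frame_def)
  have T: "linear (\<lambda>b. RR a v w b)" "linear (\<lambda>a. RR a v w b)" for a b
    using RR_bilinear by auto
  have "(\<Sum>i\<in>UNIV. RR (e' i) v w (e' i)) = (\<Sum>i\<in>UNIV. RR (e i) v w (e i))"
    using trace_frame_independent[OF fe e', of "\<lambda>a b. RR a v w b"] T by blast
  also have "\<dots> = (\<Sum>a\<in>UNIV. \<Sum>b\<in>UNIV. G v (e a) * G w (e b) * (\<Sum>i\<in>UNIV. RR (e i) (e a) (e b) (e i)))"
    using bilinear_frame_expand[OF fe, of "\<lambda>v w. \<Sum>i\<in>UNIV. RR (e i) v w (e i)" v w] ricci_bilinear by blast
  also have "\<dots> = (\<Sum>a\<in>UNIV. \<rho> * (G v (e a) * G w (e a)))"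
    using e by (simp add: einstein_frame_def if_distrib[of "\<lambda>x. _ * x"] mult_ac cong: if_cong)
  also have "\<dots> = \<rho> * G v w" by (simp add: parseval[OF fe, of v w] sum_distrib_left)
  finally show ?thesis .
qed

lemma RR_diagonal:
  assumes e: "frame e" and H: "\<And>i j. H (e i) (e j) = (if i = j then lam i else 0)"
  shows "RR (e i) (e j) (e k) (e l) = (c + lam i * lam j) *
    ((if j = k \<and> i = l then 1 else 0) - (if i = k \<and> j = l then 1 else 0))"
  unfolding RR_def frameD[OF e] H by (auto simp: algebra_simps)

lemma ricci_diagonal:
  assumes e: "frame e" and H: "\<And>i j. H (e i) (e j) = (if i = j then lam i else 0)"
  shows "(\<Sum>i\<in>UNIV. RR (e i) (e a) (e b) (e i)) =
    (if a = b then \<Sum>i\<in>UNIV - {a}. c + lam a * lam i else 0)"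
proof (cases "a = b")
  case True
  have "(\<Sum>i\<in>UNIV. RR (e i) (e a) (e a) (e i)) = (\<Sum>i\<in>UNIV - {a}. RR (e i) (e a) (e a) (e i))"
    by (subst sum.remove[of UNIV a]) (auto simp: RR_diagonal[OF e H])
  also have "\<dots> = (\<Sum>i\<in>UNIV - {a}. c + lam a * lam i)"
    by (intro sum.cong) (auto simp: RR_diagonal[OF e H])
  finally show ?thesis using True by simp
next
  case False
  then have "RR (e i) (e a) (e b) (e i) = 0" for i by (auto simp: RR_diagonal[OF e H])
  then show ?thesis using False by simp
qed

text \<open>For each \<open>i\<close> other than \<open>a\<close> exactly two index pairs
  contribute, namely \<open>(i, a)\<close> and \<open>(a, i)\<close>; hence the factor 2.\<close>

lemma curvature_square_diagonal:
  assumes e: "frame e" and H: "\<And>i j. H (e i) (e j) = (if i = j then lam i else 0)"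
  shows "(\<Sum>i\<in>UNIV. \<Sum>j\<in>UNIV. \<Sum>k\<in>UNIV. (RR (e a) (e i) (e j) (e k))\<^sup>2)
    = 2 * (\<Sum>i\<in>UNIV - {a}. (c + lam a * lam i)\<^sup>2)"
proof -
  have "(\<Sum>j\<in>UNIV. \<Sum>k\<in>UNIV. (RR (e a) (e i) (e j) (e k))\<^sup>2) = (if i = a then 0 else 2 * (c + lam a * lam i)\<^sup>2)" for i
  proof (cases "i = a")
    case True
    then show ?thesis by (simp add: RR_diagonal[OF e H])
  next
    case False
    have "(RR (e a) (e i) (e j) (e k))\<^sup>2 = (if j = i then if k = a then (c + lam a * lam i)\<^sup>2 else 0 else 0)
        + (if j = a then if k = i then (c + lam a * lam i)\<^sup>2 else 0 else 0)" for j k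
      using False by (auto simp: RR_diagonal[OF e H])
    moreover have "(\<Sum>k\<in>UNIV. if j = a' then if k = b' then x else 0 else 0) = (if j = a' then x else 0)"
      for j a' b' :: 'n and x :: real by simp
    ultimately show ?thesis using False by (simp add: sum.distrib)
  qed
  then show ?thesis
    by (simp add: sum.remove[of UNIV a] sum_distrib_left)
qed

text \<open>The sign lost in the products is read off from one value \<open>H (e a) (e a)\<close>
  with \<open>a\<close> in \<open>I\<close>, which is nonzero.\<close>

lemma type_frame_diagonal:
  assumes t: "type_frame e I" and adm: "admissible c CARD('n) (card I)"
  obtains \<sigma> where "\<sigma>\<^sup>2 = 1" "\<And>i j. H (e i) (e j) = (if i = j then \<sigma> * type_curv c I i else 0)"
proof -
  have HH: "H (e i) (e j) * H (e k) (e l) = (if i = j \<and> k = l then type_curv c I i * type_curv c I k else 0)"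
    for i j k l using t by (simp add: type_frame_def)
  have "I \<noteq> {}" using adm by (auto simp: admissible_def)
  then obtain a where a: "a \<in> I" by blast
  let ?m = "type_curv c I a"
  have pos: "?m > 0" using a admissible_curv(2)[OF adm] by (simp add: type_curv_def)
  define \<sigma> where "\<sigma> = H (e a) (e a) / ?m"
  have "\<sigma>\<^sup>2 = 1" using HH[of a a a a] pos by (simp add: \<sigma>_def power2_eq_square)
  then have s: "\<sigma> * \<sigma> = 1" by (simp add: power2_eq_square)
  have aa: "H (e a) (e a) = \<sigma> * ?m" using pos by (simp add: \<sigma>_def)
  have "H (e i) (e j) = (if i = j then \<sigma> * type_curv c I i else 0)" for i j
  proof -
    have "\<sigma> * (\<sigma> * ?m * H (e i) (e j)) = \<sigma> * (if i = j then ?m * type_curv c I i else 0)"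
      using HH[of a a i j] aa by simp
    then have "?m * H (e i) (e j) = ?m * (if i = j then \<sigma> * type_curv c I i else 0)"
      using s by (simp add: mult.assoc[symmetric] split: if_splits)
    then show ?thesis using pos by (simp only: mult_cancel_left) simp
  qed
  with \<open>\<sigma>\<^sup>2 = 1\<close> show thesis by (rule that)
qed

text \<open>The Ricci curvatures of the blocks are \<open>c + \<lambda>\<^sup>2\<close> and
  \<open>c + \<mu>\<^sup>2\<close>, weighted by the multiplicities minus one. The weighted squares
  agree already, so equality would force the multiplicities to agree.\<close>

lemma type_not_einstein:
  assumes t: "type_frame e I" and adm: "admissible c CARD('n) (card I)" and E: "einstein_frame e' \<rho>"
  shows False
proof -
  obtain \<sigma> where \<sigma>: "\<sigma>\<^sup>2 = 1" "\<And>i j. H (e i) (e j) = (if i = j then \<sigma> * type_curv c I i else 0)"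
    using type_frame_diagonal[OF t adm] by blast
  have e: "frame e" using t by (simp add: type_frame_def)
  let ?l = "major_curv c CARD('n) (card I)" and ?m = "minor_curv c CARD('n) (card I)"
  note adm' = admissible_curv[OF adm]
  have cI: "real (card (- I)) = real (CARD('n) - card I)"
    using card_Un_disjoint[of I "- I"] by simp
  have "I \<noteq> {}" "- I \<noteq> {}"
    using adm cI by (auto simp: admissible_def)
  then obtain a b where ab: "a \<in> I" "b \<in> - I" by blast
  have ric: "(\<Sum>i\<in>UNIV - {a}. c + (\<sigma> * type_curv c I a) * (\<sigma> * type_curv c I i)) = \<rho>" for a
    using einstein_frame_ricci[OF E e, of "e a" "e a"] ricci_diagonal[OF e \<sigma>(2), of a a] frameD[OF e]
    by simp
  have "(\<Sum>i\<in>UNIV - {a}. if i \<in> I then c + ?l ^ 2 else 0) = \<rho>"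
    unfolding ric[of a, symmetric] square_one_mult[OF \<sigma>(1)]
    using ab adm'(4) by (intro sum.cong) (auto simp: type_curv_def power2_eq_square)
  then have 1: "(real (card I) - 1) * (c + ?l ^ 2) = \<rho>"
    using sum_two_valued[OF ab(1), of "c + ?l ^ 2" 0] by simp
  have "(\<Sum>i\<in>UNIV - {b}. if i \<in> - I then c + ?m ^ 2 else 0) = \<rho>"
    unfolding ric[of b, symmetric] square_one_mult[OF \<sigma>(1)]
    using ab adm'(4) by (intro sum.cong) (auto simp: type_curv_def power2_eq_square mult.commute)
  then have 2: "(real (CARD('n) - card I) - 1) * (c + ?m ^ 2) = \<rho>"
    using sum_two_valued[OF ab(2), of "c + ?m ^ 2" 0] cI by simp
  have "(real (card I) - 1) * c = (real (CARD('n) - card I) - 1) * c"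
    using 1 2 adm'(5) unfolding distrib_left by linarith
  then show False using adm by (auto simp: admissible_def of_nat_diff)
qed

lemma type_second_form_bound:
  assumes t: "type_frame e I" and adm: "admissible c CARD('n) (card I)"
  shows "\<bar>H v v\<bar> \<le> major_curv c CARD('n) (card I) * G v v"
proof -
  obtain \<sigma> where \<sigma>: "\<sigma>\<^sup>2 = 1" "\<And>i j. H (e i) (e j) = (if i = j then \<sigma> * type_curv c I i else 0)"
    using type_frame_diagonal[OF t adm] by blast
  have e: "frame e" using t by (simp add: type_frame_def)
  have "H v v = (\<Sum>i\<in>UNIV. G v (e i) * G v (e i) * (\<sigma> * type_curv c I i))"
    using bilinear_frame_expand[OF e linH linH', of v v] by (simp add: \<sigma>(2) if_distrib[of "\<lambda>x. _ * x"] cong: if_cong)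
  also have "\<bar>\<dots>\<bar> \<le> (\<Sum>i\<in>UNIV. \<bar>G v (e i) * G v (e i) * (\<sigma> * type_curv c I i)\<bar>)"
    by (rule sum_abs)
  also have "\<dots> \<le> (\<Sum>i\<in>UNIV. (G v (e i) * G v (e i)) * major_curv c CARD('n) (card I))"
  proof (rule sum_mono)
    fix i
    have "\<bar>\<sigma>\<bar> = 1" using \<sigma>(1) by (simp add: power2_eq_1_iff) linarith
    then have "\<bar>\<sigma> * type_curv c I i\<bar> \<le> major_curv c CARD('n) (card I)"
      using admissible_curv(2,7)[OF adm] by (simp add: abs_mult type_curv_def)
    then show "\<bar>G v (e i) * G v (e i) * (\<sigma> * type_curv c I i)\<bar>
        \<le> (G v (e i) * G v (e i)) * major_curv c CARD('n) (card I)"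
      unfolding abs_mult[of "G v (e i) * G v (e i)"] by (simp add: mult_left_mono)
  qed
  also have "\<dots> = major_curv c CARD('n) (card I) * G v v"
    by (simp add: parseval[OF e, of v v] sum_distrib_left mult.commute)
  finally show ?thesis .
qed

text \<open>The major curvature is the maximum of \<bar>H v v\<bar> over unit vectors
  \<open>v\<close>, hence independent of the frame, and it determines the multiplicity.\<close>

lemma type_frame_unique:
  assumes "type_frame e I" "admissible c CARD('n) (card I)" "type_frame e' J" "admissible c CARD('n) (card J)"
  shows "card I = card J"
proof -
  have *: "major_curv c CARD('n) (card J) \<le> major_curv c CARD('n) (card I)"
    if t: "type_frame e I" "admissible c CARD('n) (card I)" and t': "type_frame e' J" "admissible c CARD('n) (card J)"
    for e e' I J
  proof -
    have "J \<noteq> {}" using t'(2) by (auto simp: admissible_def)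
    then obtain a where a: "a \<in> J" by blast
    have "H (e' a) (e' a) * H (e' a) (e' a) = major_curv c CARD('n) (card J) * major_curv c CARD('n) (card J)"
      using t'(1) a by (simp add: type_frame_def type_curv_def)
    then have "\<bar>H (e' a) (e' a)\<bar> = major_curv c CARD('n) (card J)"
      using admissible_curv(2)[OF t'(2)] by (metis abs_of_pos abs_mult_self_eq abs_ge_zero power2_eq_iff_nonneg power2_eq_square less_imp_le)
    moreover have "G (e' a) (e' a) = 1" using t'(1) by (simp add: type_frame_def frameD)
    ultimately show ?thesis using type_second_form_bound[OF t, of "e' a"] by simp
  qed
  show ?thesis
    using *[OF assms] *[OF assms(3,4,1,2)] major_curv_inj[OF assms(2,4)] by linarith
qed

lemma pointwise_classification:
  assumes n: "CARD('n) \<ge> 3"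
    and R: "\<And>v w u z. G (R v w u) z = RR v w u z"
    and semi: "\<And>v w a b u. R v w (R a b u) - R a b (R v w u) - R (R v w a) b u - R a (R v w b) u = 0"
    and weak: "\<And>e a. frame e \<Longrightarrow>
      (\<Sum>i\<in>UNIV. \<Sum>j\<in>UNIV. \<Sum>k\<in>UNIV. (G (R (e a) (e i) (e j)) (e k))\<^sup>2) = r e"
  shows "(\<exists>e \<rho>. einstein_frame e \<rho>) \<or> (\<exists>e I. type_frame e I \<and> admissible c CARD('n) (card I))"
proof -
  obtain e where e: "frame e" and off: "\<And>i j. i \<noteq> j \<Longrightarrow> H (e i) (e j) = 0"
    by (rule diagonal_frame[of H, OF linH symH]) blast
  define lam where "lam i = H (e i) (e i)" for i
  have H: "H (e i) (e j) = (if i = j then lam i else 0)" for i j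
    by (simp add: lam_def off)
  have W: "(\<Sum>i\<in>UNIV - {a}. (c + lam a * lam i)\<^sup>2) = (\<Sum>i\<in>UNIV - {b}. (c + lam b * lam i)\<^sup>2)" for a b
    using weak[OF e, of a] weak[OF e, of b] curvature_square_diagonal[OF e H, of a]
      curvature_square_diagonal[OF e H, of b] by (simp add: R)
  have Re: "R (e i) (e j) (e k) = (c + lam i * lam j) *\<^sub>R ((if j = k then e i else 0) - (if i = k then e j else 0))"
    for i j k
  proof (rule frame_eqI[OF e])
    fix l
    have "G ((if j = k then e i else 0) - (if i = k then e j else 0)) (e l)
      = (if j = k \<and> i = l then 1 else 0) - (if i = k \<and> j = l then 1 else 0)"
      by (cases "j = k"; cases "i = k") (simp_all add: G_simps frameD[OF e])
    then show "G (R (e i) (e j) (e k)) (e l) = G ((c + lam i * lam j) *\<^sub>R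
        ((if j = k then e i else 0) - (if i = k then e j else 0))) (e l)"
      by (simp only: R RR_diagonal[OF e H] linear_cmul[OF linG'] real_scaleR_def)
  qed
  have R3: "R v w (r *\<^sub>R u) = r *\<^sub>R R v w u" for v w u r
    by (rule G_eqI) (simp add: R G_simps linear_cmul[OF RR_bilinear(3)])
  have R1: "R (r *\<^sub>R v) w u = r *\<^sub>R R v w u" for v w u r
    by (rule G_eqI) (simp add: R G_simps linear_cmul[OF RR_bilinear(2)])
  have R20: "R v 0 u = 0" for v u
    by (rule G_eqI) (simp add: R G_simps linear_0[OF RR_bilinear(4)])
  have R30: "R v w 0 = 0" for v w
    using R3[of v w 0 0] by simp
  \<comment> \<open>Evaluates the derivation \<open>R(e i, e j)\<close> of the curvature on
    \<open>e i\<close>, \<open>e k\<close>, \<open>e k\<close>; two of the four terms vanish and the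
    other two are multiples of \<open>e j\<close>.\<close>
  have S: "(c + lam i * lam j) * (lam k * (lam j - lam i)) = 0" if "i \<noteq> j" "j \<noteq> k" "i \<noteq> k" for i j k
  proof -
    have 1: "R (e i) (e j) (R (e i) (e k) (e k)) = ((c + lam i * lam k) * (c + lam i * lam j)) *\<^sub>R (- e j)"
      using that by (simp add: Re R3)
    have 2: "R (e i) (e j) (e k) = 0" using that by (simp add: Re)
    have 30: "R (e i) (e j) (e i) = (- (c + lam i * lam j)) *\<^sub>R e j"
      using that by (simp add: Re algebra_simps)
    have 31: "R (e j) (e k) (e k) = (c + lam j * lam k) *\<^sub>R e j"
      using that by (simp add: Re)
    have 3: "R (R (e i) (e j) (e i)) (e k) (e k) = (- (c + lam i * lam j) * (c + lam j * lam k)) *\<^sub>R e j"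
      by (simp only: 30 31 R1 scaleR_scaleR)
    have "((c + lam i * lam k) * (c + lam i * lam j)) *\<^sub>R (- e j)
        - (- (c + lam i * lam j) * (c + lam j * lam k)) *\<^sub>R e j = 0"
      using semi[of "e i" "e j" "e i" "e k" "e k"] unfolding 1 2 3 R20 R30 by simp
    then have "((c + lam i * lam j) * (c + lam j * lam k) - (c + lam i * lam k) * (c + lam i * lam j)) *\<^sub>R e j = 0"
      by (simp add: algebra_simps)
    moreover have "e j \<noteq> 0"
      using frameD[OF e, of j j] G_simps(4)[of "e j"] by auto
    ultimately have "(c + lam i * lam j) * (c + lam j * lam k) - (c + lam i * lam k) * (c + lam i * lam j) = 0"
      by simp
    then show ?thesis by (simp add: algebra_simps)
  qed
  have "(\<forall>a b. (\<Sum>i\<in>UNIV - {a}. c + lam a * lam i) = (\<Sum>i\<in>UNIV - {b}. c + lam b * lam i)) \<or>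
    (\<exists>I \<sigma>. admissible c CARD('n) (card I) \<and> \<sigma>\<^sup>2 = (1 :: real) \<and> (\<forall>i. lam i = \<sigma> * type_curv c I i))"
  proof (rule principal_curvatures_cases[OF n])
    show "(c + lam i * lam j) * (lam k * (lam j - lam i)) = 0"
      if "i \<noteq> j" "j \<noteq> k" "i \<noteq> k" for i j k by (rule S[OF that])
  qed (rule W)
  then show ?thesis
  proof (rule disjE)
    assume E: "\<forall>a b. (\<Sum>i\<in>UNIV - {a}. c + lam a * lam i) = (\<Sum>i\<in>UNIV - {b}. c + lam b * lam i)"
    define \<rho> where "\<rho> = (\<Sum>i\<in>UNIV - {undefined}. c + lam undefined * lam i)"
    have "(\<Sum>i\<in>UNIV. RR (e i) (e a) (e b) (e i)) = (if a = b then \<rho> else 0)" for a b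
      unfolding ricci_diagonal[OF e H] \<rho>_def using E[rule_format, of a undefined] by (cases "a = b") simp_all
    then have "einstein_frame e \<rho>" unfolding einstein_frame_def using e by simp
    then show ?thesis by blast
  next
    assume "\<exists>I \<sigma>. admissible c CARD('n) (card I) \<and> \<sigma>\<^sup>2 = (1 :: real) \<and> (\<forall>i. lam i = \<sigma> * type_curv c I i)"
    then obtain I \<sigma> where I: "admissible c CARD('n) (card I)" "\<sigma>\<^sup>2 = (1::real)" "\<forall>i. lam i = \<sigma> * type_curv c I i"
      by blast
    have "type_frame e I"
      unfolding type_frame_def H I(3)[rule_format]
    proof (intro conjI allI e)
      show "(if i = j then \<sigma> * type_curv c I i else 0) * (if k = l then \<sigma> * type_curv c I k else 0) =
          (if i = j \<and> k = l then type_curv c I i * type_curv c I k else 0)" for i j k l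
        by (cases "i = j"; cases "k = l") (simp_all only: if_True if_False simp_thms mult_zero_left mult_zero_right
            square_one_mult[OF I(2)])
    qed
    then show ?thesis using I(1) by blast
  qed
qed

end

section \<open>Second fundamental form and types of points\<close>

text \<open>\<open>S v w u z\<close> stands for the inner product of the normal vectors \<open>II(v, w)\<close> and \<open>II(u, z)\<close>, where
  \<open>II\<close> is the second fundamental form in the flat ambient space. In contrast to the scalar second
  fundamental form it does not depend on the choice of a unit normal.\<close>

definition orthonormal :: "('v \<Rightarrow> 'v \<Rightarrow> real) \<Rightarrow> ('n \<Rightarrow> 'v) \<Rightarrow> bool" where
  "orthonormal G e \<longleftrightarrow> (\<forall>i j. G (e i) (e j) = (if i = j then 1 else 0))"

text \<open>By the Gauss equation the summand is the curvature component
  \<open>R(e i, e a, e b, e i)\<close>, so the sum is the Ricci tensor.\<close>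

definition einstein_at ::
  "('v \<Rightarrow> 'v \<Rightarrow> real) \<Rightarrow> ('v \<Rightarrow> 'v \<Rightarrow> 'v \<Rightarrow> 'v \<Rightarrow> real) \<Rightarrow> ('n::finite \<Rightarrow> 'v) \<Rightarrow> bool" where
  "einstein_at G S e \<longleftrightarrow> orthonormal G e \<and> (\<exists>\<rho>. \<forall>a b.
     (\<Sum>i\<in>UNIV. S (e a) (e b) (e i) (e i) - S (e i) (e b) (e a) (e i)) = (if a = b then \<rho> else 0))"

text \<open>The added \<open>c\<close> is the part of \<open>S\<close> that comes from the position
  vector, as in \<open>B_Vn_Vn\<close>.\<close>

definition type_at ::
  "real \<Rightarrow> ('v \<Rightarrow> 'v \<Rightarrow> real) \<Rightarrow> ('v \<Rightarrow> 'v \<Rightarrow> 'v \<Rightarrow> 'v \<Rightarrow> real) \<Rightarrow> 'n::finite set \<Rightarrow> ('n \<Rightarrow> 'v) \<Rightarrow> bool" where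
  "type_at c G S I e \<longleftrightarrow> orthonormal G e \<and> (\<forall>i j k l.
     S (e i) (e j) (e k) (e l) = (if i = j \<and> k = l then type_curv c I i * type_curv c I k + c else 0))"

lemma continuous_on_open_tendsto:
  fixes h :: "'a::t2_space \<Rightarrow> 'b::topological_space"
  assumes "open U" "continuous_on U h" "y \<in> U" "x \<longlonglongrightarrow> y"
  shows "(\<lambda>k. h (x k)) \<longlonglongrightarrow> h y"
proof -
  have "isCont h y" using assms(1-3) by (simp add: continuous_on_eq_continuous_at)
  then show ?thesis using assms(4) by (rule isCont_tendsto_compose)
qed

lemma bilinear_axis_sum:
  fixes T :: "real ^ 'n::finite \<Rightarrow> real ^ 'n \<Rightarrow> 'b::real_vector"
  assumes "\<And>v. linear (T v)" "\<And>w. linear (\<lambda>v. T v w)"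
  shows "T v w = (\<Sum>i\<in>UNIV. (v $ i) *\<^sub>R (\<Sum>j\<in>UNIV. (w $ j) *\<^sub>R T (axis i 1) (axis j 1)))"
proof -
  have "T v w = (\<Sum>i\<in>UNIV. (v $ i) *\<^sub>R T (axis i 1) w)"
    by (rule linear_axis_sum[OF assms(2), symmetric])
  also have "\<dots> = (\<Sum>i\<in>UNIV. (v $ i) *\<^sub>R (\<Sum>j\<in>UNIV. (w $ j) *\<^sub>R T (axis i 1) (axis j 1)))"
    by (simp only: linear_axis_sum[OF assms(1)])
  finally show ?thesis .
qed

context chart_hypersurface
begin

definition S :: "real ^ 'n \<Rightarrow> real ^ 'n \<Rightarrow> real ^ 'n \<Rightarrow> real ^ 'n \<Rightarrow> real ^ 'n \<Rightarrow> real" where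
  "S y v w u z = B (Vn y v w) (Vn y u z)"

lemma gauss_curvature:
  assumes y: "y \<in> U"
  shows "gauss_curvature (g y) (\<lambda>v w. B (D2 y v w) N)"
proof (intro gauss_curvature.intro inner_form.intro gauss_curvature_axioms.intro)
  show "linear (\<lambda>w. B (D2 y v w) N)" for v
    using linear_compose[OF linear_D2[OF y] linear_B'] by (simp add: o_def)
  show "B (D2 y v w) N = B (D2 y w v) N" for v w by (simp add: D2_sym[OF y, of v w])
qed (use linear_g[OF y] g_sym[OF y] g_pos[OF y] in blast)+

lemma curv_RR:
  assumes y: "y \<in> U" and N: "unit_normal y N"
  shows "g y (curv g y v w u) z = gauss_curvature.RR (g y) (\<lambda>v w. B (D2 y v w) N) c v w u z"
  using gauss_equation[OF y] 
  by (simp add: gauss_curvature.RR_def[OF gauss_curvature[OF y]] B_Vn_Vn[OF y N] algebra_simps)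

lemma frame_iff:
  assumes y: "y \<in> U"
  shows "orthonormal_frame g y e \<longleftrightarrow> inner_form.frame (g y) e"
    and "orthonormal (g y) e \<longleftrightarrow> inner_form.frame (g y) e"
  using inner_form.frame_def[OF gauss_curvature.axioms(1)[OF gauss_curvature[OF y]]]
  by (auto simp: orthonormal_frame_def orthonormal_def)

lemma einstein_at_iff:
  assumes y: "y \<in> U" and N: "unit_normal y N"
  shows "einstein_at (g y) (S y) e \<longleftrightarrow>
    (\<exists>\<rho>. gauss_curvature.einstein_frame (g y) (\<lambda>v w. B (D2 y v w) N) c e \<rho>)"
  by (simp add: einstein_at_def gauss_curvature.einstein_frame_def[OF gauss_curvature[OF y]]
      gauss_curvature.RR_def[OF gauss_curvature[OF y]] S_def B_Vn_Vn[OF y N] frame_iff(2)[OF y] algebra_simps)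

lemma type_at_iff:
  assumes y: "y \<in> U" and N: "unit_normal y N"
  shows "type_at c (g y) (S y) I e \<longleftrightarrow>
    gauss_curvature.type_frame (g y) (\<lambda>v w. B (D2 y v w) N) c e I"
proof -
  interpret gauss_curvature "g y" "\<lambda>v w. B (D2 y v w) N" c by (rule gauss_curvature[OF y])
  have "B (Vn y (e i) (e j)) (Vn y (e k) (e l)) = (if i = j \<and> k = l then type_curv c I i * type_curv c I k + c else 0)
    \<longleftrightarrow> B (D2 y (e i) (e j)) N * B (D2 y (e k) (e l)) N = (if i = j \<and> k = l then type_curv c I i * type_curv c I k else 0)"
    if "frame e" for i j k l
    unfolding B_Vn_Vn[OF y N] by (cases "i = j"; cases "k = l") (simp_all add: frameD[OF that])
  then show ?thesis
    unfolding type_at_def type_frame_def S_def frame_iff(2)[OF y] by blast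
qed

lemma classification_at:
  assumes y: "y \<in> U" and n: "CARD('n) \<ge> 3"
    and semi: "\<And>v w a b. curv_action g y v w a b = (\<lambda>_. 0)"
    and weak: "\<And>e v w. orthonormal_frame g y e \<Longrightarrow>
      R_check g y e v w = R_norm_sq g y e / real CARD('n) * g y v w"
  shows "(\<exists>e :: 'n \<Rightarrow> _. einstein_at (g y) (S y) e) \<or>
    (\<exists>e I. type_at c (g y) (S y) I (e :: 'n \<Rightarrow> _) \<and> admissible c CARD('n) (card I))"
proof -
  obtain N where N: "unit_normal y N" using unit_normal_exists[OF y] by blast
  interpret gauss_curvature "g y" "\<lambda>v w. B (D2 y v w) N" c by (rule gauss_curvature[OF y])
  have "(\<exists>e \<rho>. einstein_frame e \<rho>) \<or> (\<exists>e I. type_frame e I \<and> admissible c CARD('n) (card I))"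
  proof (rule pointwise_classification[OF n])
    show "g y (curv g y v w u) z = RR v w u z" for v w u z by (rule curv_RR[OF y N])
    show "curv g y v w (curv g y a b u) - curv g y a b (curv g y v w u)
        - curv g y (curv g y v w a) b u - curv g y a (curv g y v w b) u = 0" for v w a b u
      using fun_cong[OF semi, of v w a b u] by (simp add: curv_action_def)
    show "(\<Sum>i\<in>UNIV. \<Sum>j\<in>UNIV. \<Sum>k\<in>UNIV. (g y (curv g y (e a) (e i) (e j)) (e k))\<^sup>2)
        = R_norm_sq g y e / real CARD('n)" if e: "frame e" for e a
      using weak[of e "e a" "e a"] e frameD[OF e, of a a]
      by (simp add: frame_iff(1)[OF y] R_check_def curv4_def power2_eq_square)
  qed
  then show ?thesis by (simp only: einstein_at_iff[OF y N] type_at_iff[OF y N])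
qed

lemma einstein_at_ricci:
  assumes y: "y \<in> U" and E: "einstein_at (g y) (S y) (e' :: 'n \<Rightarrow> _)" and e: "orthonormal_frame g y e"
  shows "ricci g y e v w = scalar_curv g y e / real CARD('n) * g y v w"
proof -
  obtain N where N: "unit_normal y N" using unit_normal_exists[OF y] by blast
  interpret gauss_curvature "g y" "\<lambda>v w. B (D2 y v w) N" c by (rule gauss_curvature[OF y])
  obtain \<rho> where \<rho>: "einstein_frame e' \<rho>" using E by (auto simp: einstein_at_iff[OF y N])
  have fe: "frame e" using e by (simp add: frame_iff(1)[OF y])
  have ric: "ricci g y e v w = \<rho> * g y v w" for v w
    unfolding ricci_def curv4_def curv_RR[OF y N] by (rule einstein_frame_ricci[OF \<rho> fe])
  have "scalar_curv g y e = real CARD('n) * \<rho>"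
    by (simp add: scalar_curv_def ric frameD[OF fe])
  then show ?thesis by (simp add: ric)
qed

lemma type_at_not_einstein_at:
  assumes y: "y \<in> U" and t: "type_at c (g y) (S y) (I :: 'n set) e" "admissible c CARD('n) (card I)"
    and E: "einstein_at (g y) (S y) (e' :: 'n \<Rightarrow> _)"
  shows False
proof -
  obtain N where N: "unit_normal y N" using unit_normal_exists[OF y] by blast
  obtain \<rho> where "gauss_curvature.einstein_frame (g y) (\<lambda>v w. B (D2 y v w) N) c e' \<rho>"
    using E unfolding einstein_at_iff[OF y N] by blast
  with t(1)[unfolded type_at_iff[OF y N]] t(2) show ?thesis
    by (rule gauss_curvature.type_not_einstein[OF gauss_curvature[OF y]])
qed

lemma type_at_unique:
  assumes y: "y \<in> U" and t: "type_at c (g y) (S y) (I :: 'n set) e" "admissible c CARD('n) (card I)"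
    "type_at c (g y) (S y) (J :: 'n set) e'" "admissible c CARD('n) (card J)"
  shows "card I = card J"
proof -
  obtain N where N: "unit_normal y N" using unit_normal_exists[OF y] by blast
  show ?thesis
    by (rule gauss_curvature.type_frame_unique[OF gauss_curvature[OF y]
          t(1)[unfolded type_at_iff[OF y N]] t(2) t(3)[unfolded type_at_iff[OF y N]] t(4)])
qed

section \<open>Closedness of the pointwise conditions\<close>

lemma tendsto_bilinear:
  fixes T :: "real ^ 'n \<Rightarrow> real ^ 'n \<Rightarrow> real ^ 'n \<Rightarrow> 'b::real_normed_vector"
  assumes cont: "\<And>v w. continuous_on U (\<lambda>y. T y v w)"
    and T: "\<And>y v. y \<in> U \<Longrightarrow> linear (T y v)" "\<And>y w. y \<in> U \<Longrightarrow> linear (\<lambda>v. T y v w)"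
    and x: "\<And>k. x k \<in> U" "y \<in> U" "x \<longlonglongrightarrow> y" and v: "v \<longlonglongrightarrow> v0" and w: "w \<longlonglongrightarrow> w0"
  shows "(\<lambda>k. T (x k) (v k) (w k)) \<longlonglongrightarrow> T y v0 w0"
proof -
  let ?E = "\<lambda>y v w. \<Sum>i\<in>UNIV. (v $ i) *\<^sub>R (\<Sum>j\<in>UNIV. (w $ j) *\<^sub>R T y (axis i 1) (axis j 1))"
  have "(\<lambda>k. ?E (x k) (v k) (w k)) \<longlonglongrightarrow> ?E y v0 w0"
    by (intro tendsto_sum tendsto_scaleR tendsto_vec_nth v w continuous_on_open_tendsto[OF open_U cont x(2,3)])
  moreover have eq: "?E z a b = T z a b" if "z \<in> U" for z a b
    by (rule bilinear_axis_sum[OF T[OF that], symmetric])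
  ultimately show ?thesis by (simp only: eq[OF x(1)] eq[OF x(2)])
qed

lemma continuous_Vn: "continuous_on U (\<lambda>y. Vn y v w)"
  unfolding Vn_def D2_def
  by (rule smooth_on_continuous_on[OF smooth_on_diff[OF open_U smooth_on_ddir[OF smooth_on_ddir[OF smooth_f]]
          smooth_on_ddir_field(1)[OF open_U smooth_f smooth_christoffel]]])

lemma tendsto_g:
  assumes "\<And>k. x k \<in> U" "y \<in> U" "x \<longlonglongrightarrow> y" "v \<longlonglongrightarrow> v0" "w \<longlonglongrightarrow> w0"
  shows "(\<lambda>k. g (x k) (v k) (w k)) \<longlonglongrightarrow> g y v0 w0"
  by (rule tendsto_bilinear[where T = g])
    (fact smooth_on_continuous_on[OF smooth_g] linear_g linear_g' assms)+

lemma tendsto_S: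
  assumes "\<And>k. x k \<in> U" "y \<in> U" "x \<longlonglongrightarrow> y" "a \<longlonglongrightarrow> a0" "b \<longlonglongrightarrow> b0" "d \<longlonglongrightarrow> d0" "h \<longlonglongrightarrow> h0"
  shows "(\<lambda>k. S (x k) (a k) (b k) (d k) (h k)) \<longlonglongrightarrow> S y a0 b0 d0 h0"
  unfolding S_def
  by (rule bounded_bilinear.tendsto[OF bil]; rule tendsto_bilinear[where T = Vn])
    (fact continuous_Vn linear_Vn linear_Vn' assms)+

text \<open>The metric attains a positive minimum on a compact ball times the unit sphere. This
  uniform bound keeps orthonormal frames over the ball bounded.\<close>

lemma g_lower_bound:
  assumes y: "y \<in> U"
  obtains r m where "r > 0" "m > 0" "cball y r \<subseteq> U" "\<And>z v. z \<in> cball y r \<Longrightarrow> m * (norm v)\<^sup>2 \<le> g z v v"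
proof -
  obtain r where r: "r > 0" "cball y r \<subseteq> U" using open_U y open_contains_cball by blast
  let ?K = "cball y r \<times> sphere (0 :: real ^ 'n) 1"
  have "continuous_on ?K (\<lambda>p. \<Sum>i\<in>UNIV. (snd p $ i) *\<^sub>R (\<Sum>j\<in>UNIV. (snd p $ j) *\<^sub>R g (fst p) (axis i 1) (axis j 1)))"
  proof (intro continuous_on_sum continuous_on_scaleR continuous_on_component continuous_on_snd continuous_on_id)
    show "continuous_on ?K (\<lambda>p. g (fst p) (axis i 1) (axis j 1))" for i j
      using r(2)
      by (intro continuous_on_compose2[OF smooth_on_continuous_on[OF smooth_g]] continuous_on_fst continuous_on_id) auto
  qed
  moreover have "(\<Sum>i\<in>UNIV. (snd p $ i) *\<^sub>R (\<Sum>j\<in>UNIV. (snd p $ j) *\<^sub>R g (fst p) (axis i 1) (axis j 1)))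
      = g (fst p) (snd p) (snd p)" if "p \<in> ?K" for p
  proof -
    have z: "fst p \<in> U" using that r(2) by auto
    show ?thesis by (rule bilinear_axis_sum[OF linear_g[OF z] linear_g'[OF z], symmetric])
  qed
  ultimately have "continuous_on ?K (\<lambda>p. g (fst p) (snd p) (snd p))"
    by (rule continuous_on_eq)
  moreover have "compact ?K" by (intro compact_Times compact_cball compact_sphere)
  moreover have "(y, axis undefined 1) \<in> ?K" using r(1) by simp
  ultimately obtain p where p: "p \<in> ?K" "\<And>q. q \<in> ?K \<Longrightarrow> g (fst p) (snd p) (snd p) \<le> g (fst q) (snd q) (snd q)"
    using continuous_attains_inf[of ?K "\<lambda>p. g (fst p) (snd p) (snd p)"] by blast
  define m where "m = g (fst p) (snd p) (snd p)"
  have "fst p \<in> U" "snd p \<noteq> 0" using p(1) r(2) by auto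
  then have m: "m > 0" unfolding m_def by (rule g_pos)
  have "m * (norm v)\<^sup>2 \<le> g z v v" if z: "z \<in> cball y r" for z v
  proof (cases "v = 0")
    case True
    then show ?thesis using linear_0[OF linear_g, of z 0] z r(2) by auto
  next
    case False
    have zU: "z \<in> U" using z r(2) by auto
    have "(z, v /\<^sub>R norm v) \<in> ?K" using z False by simp
    from p(2)[OF this] have "m \<le> g z (v /\<^sub>R norm v) (v /\<^sub>R norm v)" by (simp add: m_def)
    also have "\<dots> = g z v v / (norm v)\<^sup>2"
      using linear_cmul[OF linear_g[OF zU]] linear_cmul[OF linear_g'[OF zU]]
      by (simp add: power2_eq_square divide_inverse)
    finally show ?thesis using False by (simp add: pos_le_divide_eq)
  qed
  with r m show thesis using that by blast
qed

text \<open>A frame is packed into one vector of a Euclidean space, where Bolzano-Weierstrass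
  applies; the shift by \<open>k0\<close> discards the points outside the ball of
  \<open>g_lower_bound\<close>.\<close>

lemma frames_converge:
  assumes x: "\<And>k. x k \<in> U" "y \<in> U" "x \<longlonglongrightarrow> y" and e: "\<And>k. orthonormal (g (x k)) (e k :: 'n \<Rightarrow> _)"
  obtains \<rho> e0 where "strict_mono \<rho>" "orthonormal (g y) e0" "\<And>i. (\<lambda>k. e (\<rho> k) i) \<longlonglongrightarrow> e0 i"
proof -
  obtain r m where rm: "r > 0" "m > 0" "cball y r \<subseteq> U" "\<And>z v. z \<in> cball y r \<Longrightarrow> m * (norm v)\<^sup>2 \<le> g z v v"
    using g_lower_bound[OF x(2)] by blast
  obtain k0 where k0: "\<And>k. k \<ge> k0 \<Longrightarrow> dist (x k) y < r"
    using x(3) rm(1) unfolding lim_sequentially by blast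
  define E :: "nat \<Rightarrow> (real ^ 'n) ^ 'n" where "E k = (\<chi> i. e (k + k0) i)" for k
  have Ei: "norm (E k $ i) \<le> 1 / m + 1" for k i
  proof -
    have "m * (norm (e (k + k0) i))\<^sup>2 \<le> g (x (k + k0)) (e (k + k0) i) (e (k + k0) i)"
      using k0[of "k + k0"] by (intro rm(4)) (simp add: dist_commute less_imp_le)
    also have "\<dots> = 1" using e by (simp add: orthonormal_def)
    finally have "(norm (e (k + k0) i))\<^sup>2 \<le> 1 / m" using rm(2) by (simp add: pos_le_divide_eq mult.commute)
    moreover have "norm (e (k + k0) i) \<le> (norm (e (k + k0) i))\<^sup>2 + 1"
      using zero_le_power2[of "norm (e (k + k0) i) - 1"] norm_ge_zero[of "e (k + k0) i"]
      unfolding power2_diff power_one mult_1_right by linarith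
    ultimately show ?thesis by (simp add: E_def)
  qed
  have "norm (E k) \<le> (\<Sum>i\<in>(UNIV :: 'n set). 1 / m + 1)" for k
  proof -
    have "norm (E k) \<le> (\<Sum>i\<in>UNIV. norm (E k $ i))"
      unfolding norm_vec_def[of "E k"] by (rule L2_set_le_sum) simp
    also have "\<dots> \<le> (\<Sum>i\<in>(UNIV :: 'n set). 1 / m + 1)"
      by (intro sum_mono Ei)
    finally show ?thesis .
  qed
  then have "bounded (range E)" unfolding bounded_iff by blast
  then obtain l \<rho> where l: "strict_mono \<rho>" "(E \<circ> \<rho>) \<longlonglongrightarrow> l"
    using bounded_imp_convergent_subsequence by blast
  have lim: "(\<lambda>k. e (\<rho> k + k0) i) \<longlonglongrightarrow> l $ i" for i
    using tendsto_vec_nth[OF l(2), of i] by (simp add: E_def o_def)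
  have sm: "strict_mono (\<lambda>k. \<rho> k + k0)" using l(1) by (simp add: strict_mono_def)
  have "g y (l $ i) (l $ j) = (if i = j then 1 else 0)" for i j
  proof (rule LIMSEQ_unique)
    have "(\<lambda>k. x (\<rho> k + k0)) \<longlonglongrightarrow> y"
      using LIMSEQ_subseq_LIMSEQ[OF x(3) sm] by (simp add: o_def)
    then show "(\<lambda>k. g (x (\<rho> k + k0)) (e (\<rho> k + k0) i) (e (\<rho> k + k0) j)) \<longlonglongrightarrow> g y (l $ i) (l $ j)"
      by (intro tendsto_g x lim)
    show "(\<lambda>k. g (x (\<rho> k + k0)) (e (\<rho> k + k0) i) (e (\<rho> k + k0) j)) \<longlonglongrightarrow> (if i = j then 1 else 0)"
      using e by (simp add: orthonormal_def)
  qed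
  then have "orthonormal (g y) (($) l)" by (simp add: orthonormal_def)
  then show thesis by (rule that[OF sm _ lim])
qed

text \<open>A property of the array of numbers \<open>S\<close> in a frame, if preserved by
  pointwise limits, passes to limit points because the witnessing frames subconverge.\<close>

lemma closed_frame_condition:
  fixes C :: "('n \<Rightarrow> 'n \<Rightarrow> 'n \<Rightarrow> 'n \<Rightarrow> real) \<Rightarrow> bool"
  assumes C: "\<And>qs q. (\<And>k. C (qs k)) \<Longrightarrow> (\<And>a b d h. (\<lambda>k. qs k a b d h) \<longlonglongrightarrow> q a b d h) \<Longrightarrow> C q"
  shows "open {y \<in> U. \<not> (\<exists>e. orthonormal (g y) (e :: 'n \<Rightarrow> _) \<and> C (\<lambda>a b d h. S y (e a) (e b) (e d) (e h)))}"
    (is "open {y \<in> U. \<not> ?P y}")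
proof -
  have "?P y" if yU: "y \<in> U" and cl: "y \<in> closure {y \<in> U. ?P y}" for y
  proof -
    obtain x where x: "\<And>k. x k \<in> {y \<in> U. ?P y}" "x \<longlonglongrightarrow> y"
      using cl unfolding closure_sequential by blast
    then have xU: "\<And>k. x k \<in> U" and "\<forall>k. \<exists>e. orthonormal (g (x k)) (e :: 'n \<Rightarrow> _) \<and>
        C (\<lambda>a b d h. S (x k) (e a) (e b) (e d) (e h))" by auto
    then obtain e where e: "\<And>k. orthonormal (g (x k)) (e k :: 'n \<Rightarrow> _)"
      "\<And>k. C (\<lambda>a b d h. S (x k) (e k a) (e k b) (e k d) (e k h))" by metis
    obtain \<rho> e0 where \<rho>: "strict_mono \<rho>" "orthonormal (g y) e0" "\<And>i. (\<lambda>k. e (\<rho> k) i) \<longlonglongrightarrow> e0 i"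
      by (rule frames_converge[OF xU yU x(2) e(1)]) blast
    have xr: "(\<lambda>k. x (\<rho> k)) \<longlonglongrightarrow> y"
      using LIMSEQ_subseq_LIMSEQ[OF x(2) \<rho>(1)] by (simp add: o_def)
    have "C (\<lambda>a b d h. S y (e0 a) (e0 b) (e0 d) (e0 h))"
      by (rule C[of "\<lambda>k a b d h. S (x (\<rho> k)) (e (\<rho> k) a) (e (\<rho> k) b) (e (\<rho> k) d) (e (\<rho> k) h)"])
        (rule e(2), intro tendsto_S xU yU xr \<rho>(3))
    with \<rho>(2) show ?thesis by blast
  qed
  then have "{y \<in> U. \<not> ?P y} = U - closure {y \<in> U. ?P y}"
    using closure_subset[of "{y \<in> U. ?P y}"] by blast
  then show ?thesis using open_U by auto
qed

lemma open_not_einstein_at: "open {y \<in> U. \<not> (\<exists>e :: 'n \<Rightarrow> _. einstein_at (g y) (S y) e)}"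
proof -
  let ?ric = "\<lambda>q a b. \<Sum>i\<in>UNIV. q a b i i - q i b a i"
  \<comment> \<open>The quantified Einstein constant is replaced by one diagonal entry, which turns
    the condition into equations that survive limits.\<close>
  let ?C = "\<lambda>q. \<forall>a b. ?ric q a b = (if a = b then ?ric q undefined undefined else (0::real))"
  have eq: "(\<exists>\<rho>. \<forall>a b. ?ric q a b = (if a = b then \<rho> else (0::real))) \<longleftrightarrow> ?C q"
    for q :: "'n \<Rightarrow> 'n \<Rightarrow> 'n \<Rightarrow> 'n \<Rightarrow> real"
  proof
    assume "\<exists>\<rho>. \<forall>a b. ?ric q a b = (if a = b then \<rho> else (0::real))"
    then obtain \<rho> where "\<forall>a b. ?ric q a b = (if a = b then \<rho> else (0::real))" ..
    moreover from this have "?ric q undefined undefined = \<rho>" by simp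
    ultimately show "?C q" by simp
  qed blast
  have E: "einstein_at (g y) (S y) e \<longleftrightarrow>
      orthonormal (g y) e \<and> ?C (\<lambda>a b d h. S y (e a) (e b) (e d) (e h))" for y and e :: "'n \<Rightarrow> _"
    unfolding einstein_at_def using eq[of "\<lambda>a b d h. S y (e a) (e b) (e d) (e h)"] by simp
  show ?thesis
    unfolding E
  proof (rule closed_frame_condition[of ?C], intro allI)
    fix qs and q :: "'n \<Rightarrow> 'n \<Rightarrow> 'n \<Rightarrow> 'n \<Rightarrow> real" and a b
    assume C: "\<And>k. ?C (qs k)" and lim: "\<And>a b d h. (\<lambda>k. qs k a b d h) \<longlonglongrightarrow> q a b d h"
    have L: "(\<lambda>k. ?ric (qs k) a b) \<longlonglongrightarrow> ?ric q a b" for a b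
      by (intro tendsto_sum tendsto_diff lim)
    have "(\<lambda>k. ?ric (qs k) a b) \<longlonglongrightarrow> (if a = b then ?ric q undefined undefined else 0)"
    proof (cases "a = b")
      case True
      have "?ric (qs k) b b = ?ric (qs k) undefined undefined" for k using C[of k] by metis
      then show ?thesis using L[of undefined undefined] True by simp
    next
      case False
      have "?ric (qs k) a b = 0" for k using C[of k] False by metis
      then show ?thesis using False by simp
    qed
    with L[of a b] show "?ric q a b = (if a = b then ?ric q undefined undefined else 0)"
      by (rule LIMSEQ_unique)
  qed
qed

lemma open_not_type_at: "open {y \<in> U. \<not> (\<exists>e. type_at c (g y) (S y) I (e :: 'n \<Rightarrow> _))}"
proof -
  let ?C = "\<lambda>q. \<forall>i j k l. q i j k l = (if i = j \<and> k = l then type_curv c I i * type_curv c I k + c else 0)"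
  show ?thesis
    unfolding type_at_def
  proof (rule closed_frame_condition[of ?C], intro allI)
    fix qs and q :: "'n \<Rightarrow> 'n \<Rightarrow> 'n \<Rightarrow> 'n \<Rightarrow> real" and i j k l
    assume C: "\<And>k. ?C (qs k)" and lim: "\<And>a b d h. (\<lambda>k. qs k a b d h) \<longlonglongrightarrow> q a b d h"
    show "q i j k l = (if i = j \<and> k = l then type_curv c I i * type_curv c I k + c else 0)"
      using lim[of i j k l] unfolding C[rule_format] by (rule LIMSEQ_unique[OF _ tendsto_const])
  qed
qed

end

text \<open>By the chain rule the two versions of \<open>D2\<close> differ by a tangent vector. So
  the difference of the two \<open>Vn\<close> is tangent and normal at once, hence zero.\<close>

lemma second_form_chart_change:
  fixes U U' U0 :: "(real ^ 'n::finite) set" and f f' :: "real ^ 'n \<Rightarrow> 'e::euclidean_space"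
  assumes h: "chart_hypersurface U f B c g" and h': "chart_hypersurface U' f' B c g'"
    and U0: "open U0" "U0 \<subseteq> U" and \<phi>: "smooth_on U0 \<phi>" "\<phi> ` U0 \<subseteq> U'"
    and ff: "\<And>z. z \<in> U0 \<Longrightarrow> f z = f' (\<phi> z)" and y: "y \<in> U0"
  shows "g y v w = g' (\<phi> y) (ddir \<phi> y v) (ddir \<phi> y w)"
    and "chart_hypersurface.S f B g y v w a b =
      chart_hypersurface.S f' B g' (\<phi> y) (ddir \<phi> y v) (ddir \<phi> y w) (ddir \<phi> y a) (ddir \<phi> y b)"
proof -
  interpret h: chart_hypersurface U f B c g by fact
  interpret h': chart_hypersurface U' f' B c g' by fact
  have D: "ddir f z v = ddir f' (\<phi> z) (ddir \<phi> z v)" if z: "z \<in> U0" for z v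
  proof -
    have "\<phi> z \<in> U'" using z \<phi>(2) by auto
    then have "((\<lambda>z. f' (\<phi> z)) has_derivative (\<lambda>v. ddir f' (\<phi> z) (ddir \<phi> z v))) (at z)"
      by (intro has_derivative_compose[OF smooth_on_has_derivative[OF \<phi>(1) z]] h'.D_derivative)
    then have "(f has_derivative (\<lambda>v. ddir f' (\<phi> z) (ddir \<phi> z v))) (at z)"
      by (rule has_derivative_transform_within_open[OF _ U0(1) z]) (simp add: ff)
    then show ?thesis by (rule ddirI)
  qed
  have yU: "y \<in> U" "\<phi> y \<in> U'" using y U0 \<phi>(2) by auto
  let ?A = "ddir \<phi> y"
  show gg: "g y v w = g' (\<phi> y) (?A v) (?A w)" for v w
    using yU y by (simp add: h.g_eq h'.g_eq D)
  have D2: "h.D2 y v w = h'.D2 (\<phi> y) (?A v) (?A w) + ddir f' (\<phi> y) (ddir (\<lambda>z. ddir \<phi> z v) y w)" for v w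
  proof -
    have 1: "((\<lambda>z. ddir f' z b) has_derivative h'.D2 (\<phi> y) b) (at (\<phi> y))" for b
      using h'.D2_derivative[OF yU(2)] .
    have sX: "((\<lambda>z. ddir \<phi> z v) has_derivative ddir (\<lambda>z. ddir \<phi> z v) y) (at y)"
      by (rule smooth_on_has_derivative[OF smooth_on_ddir[OF \<phi>(1)] y])
    have "((\<lambda>z. \<Sum>b\<in>Basis. (ddir \<phi> z v \<bullet> b) *\<^sub>R ddir f' (\<phi> z) b) has_derivative
       (\<lambda>w. \<Sum>b\<in>Basis. (?A v \<bullet> b) *\<^sub>R h'.D2 (\<phi> y) b (?A w) + (ddir (\<lambda>z. ddir \<phi> z v) y w \<bullet> b) *\<^sub>R ddir f' (\<phi> y) b)) (at y)"
      by (intro has_derivative_sum has_derivative_scaleR has_derivative_inner_left sX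
          has_derivative_compose[OF smooth_on_has_derivative[OF \<phi>(1) y] 1])
    then have "((\<lambda>z. ddir f z v) has_derivative
       (\<lambda>w. \<Sum>b\<in>Basis. (?A v \<bullet> b) *\<^sub>R h'.D2 (\<phi> y) b (?A w) + (ddir (\<lambda>z. ddir \<phi> z v) y w \<bullet> b) *\<^sub>R ddir f' (\<phi> y) b)) (at y)"
    proof (rule has_derivative_transform_within_open[OF _ U0(1) y])
      fix z assume z: "z \<in> U0"
      then have "\<phi> z \<in> U'" using \<phi>(2) by auto
      from linear_eq_sum_Basis[OF h'.linear_D[OF this], of "ddir \<phi> z v"]
      show "(\<Sum>b\<in>Basis. (ddir \<phi> z v \<bullet> b) *\<^sub>R ddir f' (\<phi> z) b) = ddir f z v" by (simp add: D[OF z])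
    qed
    then have "h.D2 y v w = (\<Sum>b\<in>Basis. (?A v \<bullet> b) *\<^sub>R h'.D2 (\<phi> y) b (?A w)
        + (ddir (\<lambda>z. ddir \<phi> z v) y w \<bullet> b) *\<^sub>R ddir f' (\<phi> y) b)"
      unfolding h.D2_def by (rule ddirI)
    then show ?thesis
      using linear_eq_sum_Basis[OF h'.linear_D2'[OF yU(2)], of "?A v" "?A w"]
        linear_eq_sum_Basis[OF h'.linear_D[OF yU(2)], of "ddir (\<lambda>z. ddir \<phi> z v) y w"]
      by (simp add: sum.distrib)
  qed
  have bij: "surj ?A"
  proof -
    have lin: "linear ?A" using smooth_on_linear_ddir[OF \<phi>(1) y] .
    have "v = 0" if "?A v = 0" for v
      using that D[OF y, of v] linear_0[OF h'.linear_D[OF yU(2)]] h.D_eq_0[OF yU(1)] by simp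
    then have "inj ?A" using linear_injective_0[OF lin] by blast
    then show ?thesis using linear_injective_imp_surjective[OF lin] by simp
  qed
  have Vn: "h.Vn y v w = h'.Vn (\<phi> y) (?A v) (?A w)" for v w
  proof -
    let ?d = "ddir (\<lambda>z. ddir \<phi> z v) y w - ?A (christoffel g y v w) + christoffel g' (\<phi> y) (?A v) (?A w)"
    have diff: "h.Vn y v w - h'.Vn (\<phi> y) (?A v) (?A w) = ddir f' (\<phi> y) ?d"
      using linear_add[OF h'.linear_D[OF yU(2)]] linear_diff[OF h'.linear_D[OF yU(2)]]
      by (simp add: h.Vn_def h'.Vn_def D2 D[OF y])
    obtain t where t: "?A t = ?d" using bij by (metis surjD)
    have "B (ddir f' (\<phi> y) ?d) (ddir f' (\<phi> y) ?d) = B (h.Vn y v w) (ddir f y t) - B (h'.Vn (\<phi> y) (?A v) (?A w)) (ddir f' (\<phi> y) ?d)"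
      unfolding D[OF y] t by (simp add: diff[symmetric] h.B_simps)
    then have "g' (\<phi> y) ?d ?d = 0"
      using h.Vn_normal[OF yU(1)] h'.Vn_normal[OF yU(2)] h'.g_eq[OF yU(2)] by simp
    then have "?d = 0" using h'.g_pos[OF yU(2), of ?d] by fastforce
    then show ?thesis using diff linear_0[OF h'.linear_D[OF yU(2)]] by simp
  qed
  show "h.S y v w a b = h'.S (\<phi> y) (?A v) (?A w) (?A a) (?A b)"
    by (simp add: h.S_def h'.S_def Vn)
qed

section \<open>Splitting of a hypersurface with two constant principal curvatures\<close>

text \<open>A hypersurface of a space form with two constant principal curvatures decomposes as
  \<open>f = \<Phi> + \<Psi>\<close>, where \<open>\<Phi>\<close> is constant along one principal distribution and \<open>\<Psi>\<close> along the other.\<close>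

locale split_hypersurface = chart_hypersurface U f B c g
  for U :: "(real ^ 'n::finite) set" and f :: "real ^ 'n \<Rightarrow> 'e::euclidean_space" and B c g +
  fixes V :: "(real ^ 'n) set" and \<Phi> \<Psi> :: "real ^ 'n \<Rightarrow> 'e" and k l :: real
  assumes V: "open V" "convex V" "V \<subseteq> U"
    and smooth_\<Phi>: "smooth_on V \<Phi>" and smooth_\<Psi>: "smooth_on V \<Psi>"
    and f_split: "y \<in> V \<Longrightarrow> f y = \<Phi> y + \<Psi> y"
    and \<Phi>\<Psi>: "y \<in> V \<Longrightarrow> B (\<Phi> y) (\<Psi> y) = 0"
    and \<Phi>\<Phi>: "y \<in> V \<Longrightarrow> k * B (\<Phi> y) (\<Phi> y) = 1"
    and \<Psi>\<Psi>: "y \<in> V \<Longrightarrow> l * B (\<Psi> y) (\<Psi> y) = 1"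
    and split_frame: "y \<in> V \<Longrightarrow> \<exists>e I. inner_form.frame (g y) e \<and>
      (\<forall>i\<in>I. ddir \<Psi> y (e i) = 0) \<and> (\<forall>i\<in>-I. ddir \<Phi> y (e i) = 0)"
    and split_nondegenerate: "y \<in> V \<Longrightarrow> (\<And>w. B a (ddir f y w) = 0) \<Longrightarrow> B a (\<Phi> y) = 0 \<Longrightarrow> B a (\<Psi> y) = 0 \<Longrightarrow> a = 0"
begin

lemma inner: "y \<in> V \<Longrightarrow> inner_form (g y)"
  using gauss_curvature.axioms(1)[OF gauss_curvature] V(3) by blast

text \<open>The assumptions are symmetric in the two summands; through this each fact about \<Phi>
  is also available for \<Psi>.\<close>

lemma swap: "split_hypersurface U f B c g V \<Psi> \<Phi> l k"
proof (intro split_hypersurface.intro split_hypersurface_axioms.intro)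
  show "chart_hypersurface U f B c g" by unfold_locales
  show "\<exists>e I. inner_form.frame (g y) e \<and>
      (\<forall>i\<in>I. ddir \<Phi> y (e i) = 0) \<and> (\<forall>i\<in>-I. ddir \<Psi> y (e i) = 0)" if y: "y \<in> V" for y
  proof -
    obtain e I where "inner_form.frame (g y) e"
      "\<forall>i\<in>I. ddir \<Psi> y (e i) = 0" "\<forall>i\<in>-I. ddir \<Phi> y (e i) = 0"
      using split_frame[OF y] by blast
    then show ?thesis by (intro exI[of _ e] exI[of _ "- I"]) simp
  qed
  show "f y = \<Psi> y + \<Phi> y" if "y \<in> V" for y using f_split[OF that] by simp
  show "B (\<Psi> y) (\<Phi> y) = 0" if "y \<in> V" for y using \<Phi>\<Psi>[OF that] by (simp add: sym)
  show "a = 0" if "y \<in> V" "\<And>w. B a (ddir f y w) = 0" "B a (\<Psi> y) = 0" "B a (\<Phi> y) = 0" for y a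
    by (rule split_nondegenerate[OF that(1,2,4,3)])
qed (fact V smooth_\<Psi> smooth_\<Phi> \<Psi>\<Psi> \<Phi>\<Phi>)+

lemma \<Phi>_derivative: "y \<in> V \<Longrightarrow> (\<Phi> has_derivative ddir \<Phi> y) (at y)"
  by (rule smooth_on_has_derivative[OF smooth_\<Phi>])

lemma \<Psi>_derivative: "y \<in> V \<Longrightarrow> (\<Psi> has_derivative ddir \<Psi> y) (at y)"
  by (rule smooth_on_has_derivative[OF smooth_\<Psi>])

lemma D\<Phi>_derivative: "y \<in> V \<Longrightarrow> ((\<lambda>z. ddir \<Phi> z v) has_derivative ddir (\<lambda>z. ddir \<Phi> z v) y) (at y)"
  by (rule smooth_on_has_derivative[OF smooth_on_ddir[OF smooth_\<Phi>]])

lemma D\<Psi>_derivative: "y \<in> V \<Longrightarrow> ((\<lambda>z. ddir \<Psi> z v) has_derivative ddir (\<lambda>z. ddir \<Psi> z v) y) (at y)"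
  by (rule smooth_on_has_derivative[OF smooth_on_ddir[OF smooth_\<Psi>]])

lemma linear_D\<Phi>: "y \<in> V \<Longrightarrow> linear (ddir \<Phi> y)"
  by (rule smooth_on_linear_ddir[OF smooth_\<Phi>])

lemma linear_D\<Psi>: "y \<in> V \<Longrightarrow> linear (ddir \<Psi> y)"
  by (rule smooth_on_linear_ddir[OF smooth_\<Psi>])

lemma Df_split:
  assumes y: "y \<in> V"
  shows "ddir f y v = ddir \<Phi> y v + ddir \<Psi> y v"
proof -
  have "((\<lambda>z. \<Phi> z + \<Psi> z) has_derivative (\<lambda>v. ddir \<Phi> y v + ddir \<Psi> y v)) (at y)"
    by (intro has_derivative_add \<Phi>_derivative \<Psi>_derivative y)
  then have "(f has_derivative (\<lambda>v. ddir \<Phi> y v + ddir \<Psi> y v)) (at y)"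
    by (rule has_derivative_transform_within_open[OF _ V(1) y]) (simp add: f_split)
  then show ?thesis by (rule ddirI)
qed

lemma linear_BD:
  assumes y: "y \<in> V"
  shows "linear (\<lambda>w. B a (ddir \<Psi> y w))" "linear (\<lambda>w. B (ddir \<Phi> y w) a)" "linear (\<lambda>w. B (ddir \<Psi> y w) a)"
  using linear_compose[OF linear_D\<Psi>[OF y] linear_B] linear_compose[OF linear_D\<Phi>[OF y] linear_B']
    linear_compose[OF linear_D\<Psi>[OF y] linear_B']
  by (simp_all add: o_def)

text \<open>On frame vectors, either one factor vanishes or the product equals
  \<open>g y (e i) (e j)\<close> with \<open>i \<noteq> j\<close>.\<close>

lemma D\<Phi>_D\<Psi>:
  assumes y: "y \<in> V"
  shows "B (ddir \<Phi> y v) (ddir \<Psi> y w) = 0"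
proof -
  obtain e I where e: "inner_form.frame (g y) e"
    and I: "\<And>i. i \<in> I \<Longrightarrow> ddir \<Psi> y (e i) = 0" "\<And>i. i \<notin> I \<Longrightarrow> ddir \<Phi> y (e i) = 0"
    using split_frame[OF y] by blast
  have yU: "y \<in> U" using y V(3) by blast
  have "B (ddir \<Phi> y (e i)) (ddir \<Psi> y (e j)) = 0" for i j
  proof (cases "i \<in> I \<and> j \<notin> I")
    case True
    then have "B (ddir \<Phi> y (e i)) (ddir \<Psi> y (e j)) = g y (e i) (e j)"
      using I by (simp add: g_eq[OF yU] Df_split[OF y])
    moreover have "i \<noteq> j" using True by auto
    ultimately show ?thesis using inner_form.frameD[OF inner[OF y] e] by simp
  qed (use I in \<open>auto simp: B_simps\<close>)
  then have "B (ddir \<Phi> y (e i)) (ddir \<Psi> y w) = 0" for i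
    by (rule inner_form.linear_frame_zero[OF inner[OF y] e linear_BD(1)[OF y]])
  then show ?thesis by (rule inner_form.linear_frame_zero[OF inner[OF y] e linear_BD(2)[OF y]])
qed

text \<open>Along each frame vector one of the two maps has zero derivative, so one term in the
  derivative of \<open>B (\<Phi> y) (\<Psi> y) = 0\<close> is absent.\<close>

lemma \<Phi>_D\<Psi>:
  assumes y: "y \<in> V"
  shows "B (\<Phi> y) (ddir \<Psi> y w) = 0"
proof -
  obtain e I where e: "inner_form.frame (g y) e"
    and I: "\<And>i. i \<in> I \<Longrightarrow> ddir \<Psi> y (e i) = 0" "\<And>i. i \<notin> I \<Longrightarrow> ddir \<Phi> y (e i) = 0"
    using split_frame[OF y] by blast
  have "B (\<Phi> y) (ddir \<Psi> y (e i)) = 0" for i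
    using constant_product_derivative[OF bil V(1) y \<Phi>\<Psi> \<Phi>_derivative[OF y] \<Psi>_derivative[OF y], of "e i"] I[of i]
    by (cases "i \<in> I") (simp_all add: B_simps)
  then show ?thesis by (rule inner_form.linear_frame_zero[OF inner[OF y] e linear_BD(1)[OF y]])
qed

lemma D\<Phi>_\<Psi>:
  assumes y: "y \<in> V"
  shows "B (ddir \<Phi> y w) (\<Psi> y) = 0"
  using constant_product_derivative[OF bil V(1) y \<Phi>\<Psi> \<Phi>_derivative[OF y] \<Psi>_derivative[OF y], of w] \<Phi>_D\<Psi>[OF y, of w]
  by simp

lemma D\<Phi>_\<Phi>:
  assumes y: "y \<in> V"
  shows "B (ddir \<Phi> y w) (\<Phi> y) = 0"
proof -
  have k: "k \<noteq> 0" using \<Phi>\<Phi>[OF y] by auto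
  have "B (\<Phi> z) (\<Phi> z) = 1 / k" if "z \<in> V" for z using \<Phi>\<Phi>[OF that] k by (simp add: field_simps)
  from constant_product_derivative[OF bil V(1) y this \<Phi>_derivative[OF y] \<Phi>_derivative[OF y], of w]
  show ?thesis by (simp add: sym[of "\<Phi> y"])
qed

lemma D2\<Phi>_\<Psi>:
  assumes y: "y \<in> V"
  shows "B (ddir (\<lambda>z. ddir \<Phi> z v) y w) (\<Psi> y) = 0"
  using constant_product_derivative[OF bil V(1) y D\<Phi>_\<Psi> D\<Phi>_derivative[OF y] \<Psi>_derivative[OF y], of v w]
    D\<Phi>_D\<Psi>[OF y] by simp

text \<open>This trilinear form is symmetric and vanishes when one argument is a principal vector, of
  either kind.\<close>

lemma D2\<Phi>_D\<Psi>:
  assumes y: "y \<in> V"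
  shows "B (ddir (\<lambda>z. ddir \<Phi> z v) y w) (ddir \<Psi> y u) = 0"
proof -
  define b where "b v w u = B (ddir (\<lambda>z. ddir \<Phi> z v) y w) (ddir \<Psi> y u)" for v w u
  obtain e I where e: "inner_form.frame (g y) e"
    and I: "\<And>i. i \<in> I \<Longrightarrow> ddir \<Psi> y (e i) = 0" "\<And>i. i \<notin> I \<Longrightarrow> ddir \<Phi> y (e i) = 0"
    using split_frame[OF y] by blast
  have alt: "b v w u = - B (ddir \<Phi> y v) (ddir (\<lambda>z. ddir \<Psi> z u) y w)" for v w u
    using constant_product_derivative[OF bil V(1) y D\<Phi>_D\<Psi> D\<Phi>_derivative[OF y] D\<Psi>_derivative[OF y], of v u w]
    by (simp add: b_def)
  have s1: "b v w u = b w v u" for v w u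
    unfolding b_def by (simp only: ddir_commute[OF V(1) smooth_\<Phi> y, of v w])
  have s2: "b v w u = b v u w" for v w u
    unfolding alt by (simp only: ddir_commute[OF V(1) smooth_\<Psi> y, of u w])
  have "b v w (e i) = 0" for i
  proof (cases "i \<in> I")
    case True
    then show ?thesis by (simp add: b_def I B_simps)
  next
    case False
    have "b v w (e i) = b w v (e i)" by (rule s1)
    also have "\<dots> = b w (e i) v" by (rule s2)
    also have "\<dots> = b (e i) w v" by (rule s1)
    also have "\<dots> = 0" using I(2)[OF False] by (simp add: alt B_simps)
    finally show ?thesis .
  qed
  then show ?thesis
    unfolding b_def by (rule inner_form.linear_frame_zero[OF inner[OF y] e linear_BD(1)[OF y]])
qed

section \<open>The two complementary projections of the ambient space\<close>

definition coord :: "'e \<Rightarrow> real ^ 'n \<Rightarrow> real ^ 'n" where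
  "coord a y = matrix_inv (gram g y) *v (\<chi> i. B a (ddir f y (axis i 1)))"

lemma g_coord: 
  assumes y: "y \<in> V"
  shows "g y (coord a y) u = B a (ddir f y u)"
proof -
  have yU: "y \<in> U" using y V(3) by blast
  have "linear (\<lambda>u. B a (ddir f y u))"
    using linear_compose[OF linear_D[OF yU] linear_B] by (simp add: o_def)
  then show ?thesis unfolding coord_def by (intro matrix_inv_gram yU) auto
qed

lemma smooth_coord: "smooth_on V (coord a)"
  unfolding coord_def
proof (intro smooth_matrix_inv_gram V)
  fix i
  have "smooth_on V (\<lambda>y. B a (ddir f y (axis i 1)))"
    using smooth_on_subset[OF smooth_f V(3)]
    by (intro smooth_on_bilinear[OF bil V(1)] smooth_on_const smooth_on_ddir)
  then show "smooth_on V (\<lambda>y. (\<chi> i. B a (ddir f y (axis i 1))) $ i)" by simp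
qed

text \<open>The \<open>B\<close>-orthogonal projection onto the span of \<open>\<Phi> y\<close> and
  the image of its differential. Its independence of \<open>y\<close> is what fixes the two ambient
  subspaces.\<close>

definition proj :: "'e \<Rightarrow> real ^ 'n \<Rightarrow> 'e" where
  "proj a y = ddir \<Phi> y (coord a y) + (k * B a (\<Phi> y)) *\<^sub>R \<Phi> y"

lemma smooth_proj: "smooth_on V (proj a)"
  unfolding proj_def
  by (rule smooth_on_add[OF V(1) smooth_on_ddir_field(1)[OF V(1) smooth_\<Phi> smooth_coord]
        smooth_on_scaleR[OF V(1) smooth_on_mult[OF V(1) smooth_on_const
          smooth_on_bilinear[OF bil V(1) smooth_on_const smooth_\<Phi>]] smooth_\<Phi>]])

text \<open>The derivative of the projection involves \<Phi> and its first and second derivatives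
  only, and all of these are orthogonal to \<open>\<Psi> y\<close> and to the image of its
  differential.\<close>

lemma Dproj_orthogonal:
  assumes y: "y \<in> V" and b: "b = \<Psi> y \<or> b = ddir \<Psi> y w"
  shows "B (ddir (proj a) y v) b = 0"
proof -
  have z: "B (\<Phi> y) b = 0" "\<And>v. B (ddir \<Phi> y v) b = 0" "\<And>v u. B (ddir (\<lambda>z. ddir \<Phi> z v) y u) b = 0"
    using b \<Phi>\<Psi>[OF y] \<Phi>_D\<Psi>[OF y] D\<Phi>_\<Psi>[OF y] D\<Phi>_D\<Psi>[OF y] D2\<Phi>_\<Psi>[OF y] D2\<Phi>_D\<Psi>[OF y] by auto
  have "(proj a has_derivative (\<lambda>v. (ddir \<Phi> y (ddir (coord a) y v)
        + (\<Sum>d\<in>Basis. (coord a y \<bullet> d) *\<^sub>R ddir (\<lambda>z. ddir \<Phi> z d) y v))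
      + ((k * B a (\<Phi> y)) *\<^sub>R ddir \<Phi> y v + (k * B a (ddir \<Phi> y v)) *\<^sub>R \<Phi> y))) (at y)"
  proof -
    have "((\<lambda>z. k * B a (\<Phi> z)) has_derivative (\<lambda>v. k * B a (ddir \<Phi> y v))) (at y)"
      using bounded_bilinear.FDERIV[OF bil has_derivative_const[of a] \<Phi>_derivative[OF y]]
      by (intro has_derivative_mult_right) (simp add: B_simps)
    from has_derivative_add[OF smooth_on_ddir_field(2)[OF V(1) smooth_\<Phi> smooth_coord y]
        has_derivative_scaleR[OF this \<Phi>_derivative[OF y]]]
    show ?thesis by (simp only: proj_def[abs_def])
  qed
  then have "ddir (proj a) y v = (ddir \<Phi> y (ddir (coord a) y v)
        + (\<Sum>d\<in>Basis. (coord a y \<bullet> d) *\<^sub>R ddir (\<lambda>z. ddir \<Phi> z d) y v))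
      + ((k * B a (\<Phi> y)) *\<^sub>R ddir \<Phi> y v + (k * B a (ddir \<Phi> y v)) *\<^sub>R \<Phi> y)"
    by (rule ddirI)
  then show ?thesis
    by (simp add: B_simps z linear_sum[OF linear_B'])
qed

end

context split_hypersurface
begin

interpretation sw: split_hypersurface U f B c g V \<Psi> \<Phi> l k
  by (rule swap)

lemma proj_sum:
  assumes y: "y \<in> V"
  shows "proj a y + sw.proj a y = a"
proof -
  have yU: "y \<in> U" using y V(3) by blast
  have "a - (proj a y + sw.proj a y) = 0"
  proof (rule split_nondegenerate[OF y])
    have t: "ddir \<Phi> y (coord a y) + ddir \<Psi> y (coord a y) = ddir f y (coord a y)"
      by (simp add: Df_split[OF y])
    have s: "proj a y + sw.proj a y = ddir f y (coord a y) + (k * B a (\<Phi> y)) *\<^sub>R \<Phi> y + (l * B a (\<Psi> y)) *\<^sub>R \<Psi> y"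
      unfolding t[symmetric] by (simp add: proj_def sw.proj_def)
    note z = D\<Phi>_\<Phi>[OF y] D\<Phi>_\<Psi>[OF y] sw.D\<Phi>_\<Phi>[OF y] sw.D\<Phi>_\<Psi>[OF y]
    have z': "B (\<Phi> y) (ddir \<Phi> y w) = 0" "B (\<Phi> y) (ddir \<Psi> y w) = 0"
       "B (\<Psi> y) (ddir \<Phi> y w) = 0" "B (\<Psi> y) (ddir \<Psi> y w) = 0" for w
      using z[of w] by (simp_all add: sym)
    show "B (a - (proj a y + sw.proj a y)) (ddir f y w) = 0" for w
      using g_coord[OF y, of a w]
      unfolding s by (simp add: B_simps g_eq[OF yU] Df_split[OF y] z z')
    have "k * B a (\<Phi> y) * B (\<Phi> y) (\<Phi> y) = B a (\<Phi> y)" "l * B a (\<Psi> y) * B (\<Psi> y) (\<Psi> y) = B a (\<Psi> y)"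
      using \<Phi>\<Phi>[OF y] \<Psi>\<Psi>[OF y] by (metis mult.assoc mult.commute mult.right_neutral)+
    then show "B (a - (proj a y + sw.proj a y)) (\<Phi> y) = 0" "B (a - (proj a y + sw.proj a y)) (\<Psi> y) = 0"
      unfolding s using \<Phi>\<Psi>[OF y] sw.\<Phi>\<Psi>[OF y] by (simp_all add: B_simps Df_split[OF y] z)
  qed
  then show ?thesis by simp
qed

text \<open>The derivatives of the two complementary projections are opposite and take values in
  complementary subspaces, so both vanish.\<close>

lemma proj_constant:
  assumes y: "y \<in> V" "y0 \<in> V"
  shows "proj a y = proj a y0"
proof -
  have 0: "ddir (proj a) y v = 0" if y: "y \<in> V" for y v
  proof -
    have "((\<lambda>z. proj a z + sw.proj a z) has_derivative (\<lambda>v. ddir (proj a) y v + ddir (sw.proj a) y v)) (at y)"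
      by (intro has_derivative_add smooth_on_has_derivative[OF smooth_proj y]
          smooth_on_has_derivative[OF sw.smooth_proj y])
    moreover have "((\<lambda>z. proj a z + sw.proj a z) has_derivative (\<lambda>v. 0)) (at y)"
      by (rule has_derivative_transform_within_open[OF has_derivative_const[of a] V(1) y])
        (simp add: proj_sum)
    ultimately have "(\<lambda>v. ddir (proj a) y v + ddir (sw.proj a) y v) = (\<lambda>v. 0)"
      by (rule has_derivative_unique)
    from fun_cong[OF this] have neg: "ddir (proj a) y v = - ddir (sw.proj a) y v" for v
      by (simp add: eq_neg_iff_add_eq_0)
    have \<Phi>0: "B (ddir (proj a) y v) (\<Phi> y) = 0" "B (ddir (proj a) y v) (ddir \<Phi> y w) = 0" for w
      unfolding neg using sw.Dproj_orthogonal[OF y, of "\<Phi> y" _ a v] sw.Dproj_orthogonal[OF y, of "ddir \<Phi> y w" w a v]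
      by (simp_all add: B_simps)
    have \<Psi>0: "B (ddir (proj a) y v) (\<Psi> y) = 0" "B (ddir (proj a) y v) (ddir \<Psi> y w) = 0" for w
      using Dproj_orthogonal[OF y, of "\<Psi> y" _ a v] Dproj_orthogonal[OF y, of "ddir \<Psi> y w" w a v] by simp_all
    show ?thesis
      by (rule split_nondegenerate[OF y]) (simp_all add: \<Phi>0 \<Psi>0 Df_split[OF y] B_simps)
  qed
  have "(proj a has_derivative (\<lambda>v. 0)) (at z within V)" if "z \<in> V" for z
  proof -
    have "ddir (proj a) z = (\<lambda>v. 0)" using 0[OF that] by (rule ext)
    then show ?thesis
      using smooth_on_has_derivative[OF smooth_proj that, of a] by (simp add: has_derivative_at_withinI)
  qed
  then show ?thesis by (rule has_derivative_zero_unique[OF V(2) _ y])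
qed

text \<open>\<open>\<Phi> y\<close> is its own projection at \<open>y\<close>, hence also at
  \<open>y0\<close>, so it lies in the subspace spanned at \<open>y0\<close>.\<close>

lemma \<Phi>_range:
  assumes y: "y \<in> V" and y0: "y0 \<in> V"
  shows "B (\<Phi> y) (\<Psi> y0) = 0" "B (\<Phi> y) (ddir \<Psi> y0 w) = 0"
proof -
  have yU: "y \<in> U" using y V(3) by blast
  have "g y (coord (\<Phi> y) y) u = g y 0 u" for u
    using D\<Phi>_\<Phi>[OF y, of u] \<Phi>_D\<Psi>[OF y, of u] linear_0[OF linear_g'[OF yU]]
    by (simp add: g_coord[OF y] Df_split[OF y] B_simps sym)
  then have "coord (\<Phi> y) y = 0" by (rule g_eqI[OF yU])
  then have "proj (\<Phi> y) y = \<Phi> y"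
    using \<Phi>\<Phi>[OF y] linear_0[OF linear_D\<Phi>[OF y]] by (simp add: proj_def)
  then have eq: "\<Phi> y = ddir \<Phi> y0 (coord (\<Phi> y) y0) + (k * B (\<Phi> y) (\<Phi> y0)) *\<^sub>R \<Phi> y0"
    using proj_constant[OF y y0, of "\<Phi> y"] by (simp add: proj_def)
  have "B (ddir \<Phi> y0 t + r *\<^sub>R \<Phi> y0) (\<Psi> y0) = 0" "B (ddir \<Phi> y0 t + r *\<^sub>R \<Phi> y0) (ddir \<Psi> y0 w) = 0" for t r
    using D\<Phi>_\<Psi>[OF y0] D\<Phi>_D\<Psi>[OF y0] \<Phi>\<Psi>[OF y0] \<Phi>_D\<Psi>[OF y0] by (simp_all add: B_simps)
  then show "B (\<Phi> y) (\<Psi> y0) = 0" "B (\<Phi> y) (ddir \<Psi> y0 w) = 0"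
    using eq by metis+
qed

text \<open>\<open>B\<close> is diagonal in the basis formed by \<Phi>, \<Psi> and the tangent
  frame; the coordinates on the product model will be taken with respect to it.\<close>

lemma ambient_parseval:
  assumes y: "y \<in> V" and e: "inner_form.frame (g y) e"
  shows "B a b = k * (B a (\<Phi> y) * B b (\<Phi> y)) + l * (B a (\<Psi> y) * B b (\<Psi> y))
    + (\<Sum>i\<in>UNIV. B a (ddir f y (e i)) * B b (ddir f y (e i)))"
proof -
  have yU: "y \<in> U" using y V(3) by blast
  have "a = proj a y + sw.proj a y" by (simp add: proj_sum[OF y])
  also have "\<dots> = ddir f y (coord a y) + (k * B a (\<Phi> y)) *\<^sub>R \<Phi> y + (l * B a (\<Psi> y)) *\<^sub>R \<Psi> y"
    by (simp add: proj_def sw.proj_def Df_split[OF y])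
  finally have a: "B a b = B (ddir f y (coord a y) + (k * B a (\<Phi> y)) *\<^sub>R \<Phi> y + (l * B a (\<Psi> y)) *\<^sub>R \<Psi> y) b"
    by (rule arg_cong)
  have lin: "linear (\<lambda>u. B (ddir f y u) b)"
    using linear_compose[OF linear_D[OF yU] linear_B'] by (simp add: o_def)
  have "B (ddir f y (coord a y)) b = B (ddir f y (\<Sum>i\<in>UNIV. g y (coord a y) (e i) *\<^sub>R e i)) b"
    by (simp only: inner_form.frame_expand[OF inner[OF y] e])
  also have "\<dots> = (\<Sum>i\<in>UNIV. B a (ddir f y (e i)) * B b (ddir f y (e i)))"
    by (simp only: linear_sum[OF lin] linear_cmul[OF lin] g_coord[OF y] real_scaleR_def sym[of b])
  finally show ?thesis unfolding a by (simp add: B_simps sym)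
qed

end

section \<open>Construction of the splitting from the unit normal\<close>

context chart_hypersurface
begin

lemma normal_derivative:
  assumes V: "open V" "V \<subseteq> U" and N: "smooth_on V N" "\<And>y. y \<in> V \<Longrightarrow> unit_normal y (N y)" and y: "y \<in> V"
  shows "B (ddir N y v) (N y) = 0" "c * B (ddir N y v) (f y) = 0"
    "B (ddir N y v) (ddir f y w) = - B (D2 y v w) (N y)"
proof -
  have yU: "y \<in> U" using y V by blast
  note dN = smooth_on_has_derivative[OF N(1) y]
  note const = constant_product_derivative[OF bil V(1) y]
  have "B (N z) (N z) = 1" if "z \<in> V" for z using N(2)[OF that] by (simp add: unit_normal_def)
  from const[OF this dN dN, of v] show "B (ddir N y v) (N y) = 0" by (simp add: sym[of "N y"])
  show "c * B (ddir N y v) (f y) = 0"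
  proof (cases "c = 0")
    case False
    have "B (N z) (f z) = 0" if "z \<in> V" for z using N(2)[OF that] False by (simp add: unit_normal_def)
    from const[OF this dN D_derivative[OF yU], of v] show ?thesis
      using N(2)[OF y] by (simp add: unit_normal_def)
  qed simp
  have "B (N z) (ddir f z w) = 0" if "z \<in> V" for z using N(2)[OF that] by (simp add: unit_normal_def)
  from const[OF this dN D2_derivative[OF yU], of v]
  show "B (ddir N y v) (ddir f y w) = - B (D2 y v w) (N y)"
    by (simp add: D2_sym[OF yU, of v w] sym[of "N y"])
qed

text \<open>Rodrigues' formula: the derivative of the normal has no component along \<open>N\<close>
  or \<open>f\<close>, and its tangential part is minus the shape operator.\<close>

lemma principal_direction:
  assumes V: "open V" "V \<subseteq> U" and N: "smooth_on V N" "\<And>y. y \<in> V \<Longrightarrow> unit_normal y (N y)" and y: "y \<in> V"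
    and e: "inner_form.frame (g y) e"
    and H: "\<And>i j. B (D2 y (e i) (e j)) (N y) = (if i = j then lam i else 0)"
  shows "ddir N y (e i) = - lam i *\<^sub>R ddir f y (e i)"
proof -
  have yU: "y \<in> U" using y V by blast
  interpret gauss_curvature "g y" "\<lambda>v w. B (D2 y v w) (N y)" c by (rule gauss_curvature[OF yU])
  note dN = normal_derivative[OF V N y]
  have "B (D2 y (e i) w) (N y) - lam i * g y (e i) w = 0" for w
    by (rule linear_frame_zero[OF e linear_compose_sub[OF linH]])
      (simp_all add: H frameD[OF e] linear_compose_scale_right[OF linG, of "lam i", simplified])
  then have h: "B (D2 y (e i) w) (N y) = lam i * g y (e i) w" for w by simp
  have "ddir N y (e i) + lam i *\<^sub>R ddir f y (e i) = 0"
  proof (rule nondegenerate[OF yU N(2)[OF y]])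
    show "B (ddir N y (e i) + lam i *\<^sub>R ddir f y (e i)) (ddir f y w) = 0" for w
      using h[of w] by (simp add: B_simps dN(3) g_eq[OF yU])
    show "c * B (ddir N y (e i) + lam i *\<^sub>R ddir f y (e i)) (f y) = 0"
      using dN(2)[of "e i"] B_D_f[OF yU, of "e i"] by (auto simp: B_simps)
    have "B (ddir f y (e i)) (N y) = 0" using N(2)[OF y] by (simp add: unit_normal_def sym)
    then show "B (ddir N y (e i) + lam i *\<^sub>R ddir f y (e i)) (N y) = 0"
      using dN(1)[of "e i"] by (simp add: B_simps)
  qed
  then show ?thesis by (simp add: eq_neg_iff_add_eq_0)
qed

lemma oriented_type_frames:
  assumes adm: "admissible c CARD('n) p"
    and types: "\<And>y. y \<in> U \<Longrightarrow> \<exists>e I. type_at c (g y) (S y) (I :: 'n set) e \<and> card I = p"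
    and y0: "y0 \<in> U"
  obtains V N where "open V" "convex V" "V \<subseteq> U" "y0 \<in> V" "smooth_on V N"
    "\<And>y. y \<in> V \<Longrightarrow> unit_normal y (N y)"
    "\<And>y. y \<in> V \<Longrightarrow> \<exists>e I. card I = p \<and> inner_form.frame (g y) e \<and>
       (\<forall>i j. B (D2 y (e i) (e j)) (N y) = (if i = j then type_curv c (I :: 'n set) i else 0))"
proof -
  let ?l = "major_curv c CARD('n) p" and ?m = "minor_curv c CARD('n) p"
  have diag: "\<exists>e I \<sigma>. card I = p \<and> inner_form.frame (g y) e \<and> \<sigma>\<^sup>2 = 1 \<and>
      (\<forall>i j. B (D2 y (e i) (e j)) N = (if i = j then \<sigma> * type_curv c (I :: 'n set) i else 0))"
    if y: "y \<in> U" and N: "unit_normal y N" for y N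
  proof -
    interpret gauss_curvature "g y" "\<lambda>v w. B (D2 y v w) N" c by (rule gauss_curvature[OF y])
    obtain e and I :: "'n set" where e: "type_frame e I" "card I = p"
      using types[OF y] by (auto simp: type_at_iff[OF y N])
    moreover obtain \<sigma> where "\<sigma>\<^sup>2 = 1"
      "\<And>i j. B (D2 y (e i) (e j)) N = (if i = j then \<sigma> * type_curv c I i else 0)"
      using type_frame_diagonal[OF e(1)] adm e(2) by blast
    ultimately show ?thesis unfolding type_frame_def by blast
  qed
  obtain N1 where N1: "unit_normal y0 N1" using unit_normal_exists[OF y0] by blast
  obtain e0 and I0 :: "'n set" and \<sigma> where 0: "card I0 = p" "inner_form.frame (g y0) e0" "\<sigma>\<^sup>2 = 1"
    "\<forall>i j. B (D2 y0 (e0 i) (e0 j)) N1 = (if i = j then \<sigma> * type_curv c I0 i else 0)"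
    using diag[OF y0 N1] by blast
  have \<sigma>: "\<sigma> * \<sigma> = 1" using 0(3) by (simp add: power2_eq_square)
  \<comment> \<open>Multiplying by the sign \<sigma> makes the principal curvatures at
    \<open>y0\<close> exactly the values of \<open>type_curv\<close>.\<close>
  have N0: "unit_normal y0 (\<sigma> *\<^sub>R N1)"
    using N1 \<sigma> by (auto simp: unit_normal_def B_simps mult.assoc[symmetric])
  obtain V1 N where V1: "open V1" "y0 \<in> V1" "V1 \<subseteq> U" and N: "smooth_on V1 N" "N y0 = \<sigma> *\<^sub>R N1"
    "\<And>y. y \<in> V1 \<Longrightarrow> unit_normal y (N y)"
    by (rule smooth_normal_extension[OF y0 N0]) blast
  have "I0 \<noteq> {}" using adm 0(1) by (auto simp: admissible_def)
  then obtain a where a: "a \<in> I0" by blast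
  define v where "v = e0 a"
  \<comment> \<open>Detects the sign near \<open>y0\<close> with one constant vector
    \<open>v\<close>: \<open>q\<close> is positive at \<open>y0\<close>, whereas sign -1 at
    \<open>y\<close> would bound the second fundamental form by \<bar>?m\<bar> times the metric and
    make \<open>q y\<close> nonpositive.\<close>
  define q where "q y = B (D2 y v v) (N y) - \<bar>?m\<bar> * g y v v" for y
  have "smooth_on V1 q"
    unfolding q_def D2_def
    by (rule smooth_on_diff[OF V1(1) smooth_on_bilinear[OF bil V1(1)
          smooth_on_ddir[OF smooth_on_ddir[OF smooth_on_subset[OF smooth_f V1(3)]]] N(1)]
          smooth_on_mult[OF V1(1) smooth_on_const smooth_on_subset[OF smooth_g V1(3)]]])
  then have "open (V1 \<inter> q -` {0<..})"
    by (intro continuous_open_preimage V1(1) smooth_on_continuous_on) auto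
  moreover have "q y0 > 0"
  proof -
    have "B (D2 y0 v v) (N y0) = ?l"
      using 0(1,4) a \<sigma> by (simp add: v_def N(2) B_simps type_curv_def mult.assoc[symmetric])
    moreover have "g y0 v v = 1"
      using inner_form.frameD[OF gauss_curvature.axioms(1)[OF gauss_curvature[OF y0]] 0(2)] by (simp add: v_def)
    ultimately show ?thesis using admissible_curv(7)[OF adm] by (simp add: q_def)
  qed
  ultimately obtain r where r: "r > 0" "ball y0 r \<subseteq> V1 \<inter> q -` {0<..}"
    using V1(2) unfolding open_contains_ball by force
  show thesis
  proof (rule that[of "ball y0 r" N])
    show "ball y0 r \<subseteq> U" "y0 \<in> ball y0 r" using r V1 by auto
    show "smooth_on (ball y0 r) N" using smooth_on_subset[OF N(1)] r(2) by blast
    show "unit_normal y (N y)" if "y \<in> ball y0 r" for y using N(3) that r(2) by blast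
    fix y assume y: "y \<in> ball y0 r"
    then have yV: "y \<in> V1" and qy: "q y > 0" using r(2) by auto
    then have yU: "y \<in> U" using V1 by blast
    interpret gauss_curvature "g y" "\<lambda>v w. B (D2 y v w) (N y)" c by (rule gauss_curvature[OF yU])
    obtain e and I :: "'n set" and \<tau> where e: "card I = p" "frame e" "\<tau>\<^sup>2 = 1"
      "\<And>i j. B (D2 y (e i) (e j)) (N y) = (if i = j then \<tau> * type_curv c I i else 0)"
      using diag[OF yU N(3)[OF yV]] by blast
    have "\<tau> \<noteq> - 1"
    proof
      assume \<tau>: "\<tau> = - 1"
      have "B (D2 y v v) (N y) = (\<Sum>i\<in>UNIV. g y v (e i) * g y v (e i) * (- type_curv c I i))"
        using bilinear_frame_expand[OF e(2) linH linH', of v v]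
        by (simp add: e(4) \<tau> if_distrib[of "\<lambda>x. _ * x"] cong: if_cong)
      also have "\<dots> \<le> (\<Sum>i\<in>UNIV. g y v (e i) * g y v (e i) * \<bar>?m\<bar>)"
      proof (intro sum_mono mult_left_mono)
        show "- type_curv c I i \<le> \<bar>?m\<bar>" for i
          using admissible_curv(2)[OF adm] e(1) by (auto simp: type_curv_def)
      qed auto
      also have "\<dots> = \<bar>?m\<bar> * g y v v"
        by (simp add: parseval[OF e(2), of v v] sum_distrib_left mult.commute)
      finally show False using qy by (simp add: q_def)
    qed
    then have \<tau>: "\<tau> = 1" using e(3) by (simp add: power2_eq_1_iff)
    show "\<exists>e I. card I = p \<and> frame e \<and>
        (\<forall>i j. B (D2 y (e i) (e j)) (N y) = (if i = j then type_curv c (I :: 'n set) i else 0))"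
      using e(1,2) by (intro exI[of _ e] exI[of _ I]) (simp add: e(4) \<tau>)
  qed auto
qed

lemma split_hypersurface_exists:
  assumes adm: "admissible c CARD('n) p"
    and types: "\<And>y. y \<in> U \<Longrightarrow> \<exists>e I. type_at c (g y) (S y) (I :: 'n set) e \<and> card I = p"
    and y0: "y0 \<in> U"
  obtains V \<Phi> \<Psi> e and I :: "'n set" where "y0 \<in> V"
    "split_hypersurface U f B c g V \<Phi> \<Psi> (c + (major_curv c CARD('n) p)\<^sup>2) (c + (minor_curv c CARD('n) p)\<^sup>2)"
    "inner_form.frame (g y0) e" "card I = p"
    "\<And>i. i \<in> I \<Longrightarrow> ddir \<Psi> y0 (e i) = 0" "\<And>i. i \<notin> I \<Longrightarrow> ddir \<Phi> y0 (e i) = 0"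
proof -
  let ?l = "major_curv c CARD('n) p" and ?m = "minor_curv c CARD('n) p"
  obtain V N where V: "open V" "convex V" "V \<subseteq> U" "y0 \<in> V" and N: "smooth_on V N"
    "\<And>y. y \<in> V \<Longrightarrow> unit_normal y (N y)"
    and fr: "\<And>y. y \<in> V \<Longrightarrow> \<exists>e I. card I = p \<and> inner_form.frame (g y) e \<and>
       (\<forall>i j. B (D2 y (e i) (e j)) (N y) = (if i = j then type_curv c (I :: 'n set) i else 0))"
    by (rule oriented_type_frames[OF adm types y0]) blast+
  have lm: "?l * ?m = - c" "?l > 0" "\<bar>?m\<bar> < ?l" and c: "c \<noteq> 0"
    using admissible_curv[OF adm] adm by (auto simp: admissible_def)
  define d where "d = ?l - ?m"
  have d: "d > 0" using lm(3) by (simp add: d_def)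
  define \<Phi> where "\<Phi> y = (- (1 / d)) *\<^sub>R (N y + ?m *\<^sub>R f y)" for y
  define \<Psi> where "\<Psi> y = (1 / d) *\<^sub>R (N y + ?l *\<^sub>R f y)" for y
  have sf: "smooth_on V f" using smooth_on_subset[OF smooth_f V(3)] .
  have NN: "B (N y) (N y) = 1" "B (N y) (f y) = 0" "B (f y) (N y) = 0" "B (f y) (f y) = 1 / c" if "y \<in> V" for y
    using N(2)[OF that] quad[of y] c that V(3) by (auto simp: unit_normal_def sym field_simps)
  have D: "ddir \<Phi> y v = (- (1 / d)) *\<^sub>R (ddir N y v + ?m *\<^sub>R ddir f y v)"
    "ddir \<Psi> y v = (1 / d) *\<^sub>R (ddir N y v + ?l *\<^sub>R ddir f y v)" if "y \<in> V" for y v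
    unfolding \<Phi>_def \<Psi>_def
    by (rule ddirI; intro has_derivative_scaleR_right has_derivative_add
        smooth_on_has_derivative[OF N(1) that] smooth_on_has_derivative[OF sf that])+
  have kill: "\<exists>e I. card I = p \<and> inner_form.frame (g y) e \<and>
      (\<forall>i\<in>I. ddir \<Psi> y (e i) = 0) \<and> (\<forall>i\<in>- (I :: 'n set). ddir \<Phi> y (e i) = 0)" if y: "y \<in> V" for y
  proof -
    obtain e and I :: "'n set" where e: "card I = p" "inner_form.frame (g y) e"
      "\<And>i j. B (D2 y (e i) (e j)) (N y) = (if i = j then type_curv c I i else 0)"
      using fr[OF y] by blast
    have "ddir N y (e i) = - type_curv c I i *\<^sub>R ddir f y (e i)" for i
      by (rule principal_direction[OF V(1,3) N y e(2,3)])
    then have "\<forall>i\<in>I. ddir \<Psi> y (e i) = 0" "\<forall>i\<in>-I. ddir \<Phi> y (e i) = 0"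
      using e(1) by (auto simp: D[OF y] type_curv_def)
    with e show ?thesis by blast
  qed
  have split: "split_hypersurface U f B c g V \<Phi> \<Psi> (c + ?l\<^sup>2) (c + ?m\<^sup>2)"
  proof (intro split_hypersurface.intro split_hypersurface_axioms.intro V(1-3))
    show "chart_hypersurface U f B c g" by unfold_locales
    show "smooth_on V \<Phi>" "smooth_on V \<Psi>"
      unfolding \<Phi>_def \<Psi>_def
      by (intro smooth_on_scaleR smooth_on_const smooth_on_add V(1) N(1) sf)+
    have "(- r) *\<^sub>R (a + ?m *\<^sub>R b) + r *\<^sub>R (a + ?l *\<^sub>R b) = (r * d) *\<^sub>R b" for a b :: 'e and r
      by (simp add: d_def algebra_simps)
    from this[of "1 / d"] have "(- (1 / d)) *\<^sub>R (a + ?m *\<^sub>R b) + (1 / d) *\<^sub>R (a + ?l *\<^sub>R b) = b" for a b :: 'e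
      using d by simp
    then show sum: "f y = \<Phi> y + \<Psi> y" for y by (simp add: \<Phi>_def \<Psi>_def)
    fix y assume y: "y \<in> V"
    note NN' = NN[OF y]
    have prod: "B (N y + r *\<^sub>R f y) (N y + s *\<^sub>R f y) = 1 + r * s / c" for r s
      by (simp add: B_simps NN')
    have "1 + ?m * ?l / c = 0" using lm(1) c by (simp add: mult.commute)
    then show "B (\<Phi> y) (\<Psi> y) = 0"
      unfolding \<Phi>_def \<Psi>_def
      by (simp only: bounded_bilinear.scaleR_left[OF bil] bounded_bilinear.scaleR_right[OF bil] prod) simp
    \<comment> \<open>With \<open>c = - ?l * ?m\<close> the factors \<open>c + ?l\<^sup>2\<close>
      and \<open>c + ?m\<^sup>2\<close> become \<open>?l * (?l - ?m)\<close> and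
      \<open>?m * (?m - ?l)\<close>, whose product is \<open>c * (d * d)\<close>.\<close>
    have 1: "(c + ?l\<^sup>2) * (1 + ?m * ?m / c) = d * d" "(c + ?m\<^sup>2) * (1 + ?l * ?l / c) = d * d"
    proof -
      have key: "(- (u * w) + u\<^sup>2) * (- (u * w) + w * w) = - (u * w) * ((u - w) * (u - w))" for u w :: real
        by (simp add: power2_eq_square algebra_simps)
      have ml: "?m * ?l = - c" using lm(1) by (simp add: mult.commute)
      have "c * ((c + ?l\<^sup>2) * (1 + ?m * ?m / c)) = (c + ?l\<^sup>2) * (c + ?m * ?m)" 
        "c * ((c + ?m\<^sup>2) * (1 + ?l * ?l / c)) = (c + ?m\<^sup>2) * (c + ?l * ?l)"
        using c by (simp_all add: field_simps)
      moreover have "(c + ?l\<^sup>2) * (c + ?m * ?m) = c * (d * d)" "(c + ?m\<^sup>2) * (c + ?l * ?l) = c * (d * d)"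
        using key[of ?l ?m] key[of ?m ?l] unfolding d_def lm(1) ml minus_minus
        by (simp_all add: algebra_simps)
      ultimately show "(c + ?l\<^sup>2) * (1 + ?m * ?m / c) = d * d" "(c + ?m\<^sup>2) * (1 + ?l * ?l / c) = d * d"
        using c by (metis mult_left_cancel)+
    qed
    have "B (\<Phi> y) (\<Phi> y) = (1 + ?m * ?m / c) / (d * d)" "B (\<Psi> y) (\<Psi> y) = (1 + ?l * ?l / c) / (d * d)"
      unfolding \<Phi>_def \<Psi>_def
      by (simp_all only: bounded_bilinear.scaleR_left[OF bil] bounded_bilinear.scaleR_right[OF bil] prod) simp_all
    then show "(c + ?l\<^sup>2) * B (\<Phi> y) (\<Phi> y) = 1" "(c + ?m\<^sup>2) * B (\<Psi> y) (\<Psi> y) = 1"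
      using 1 d by simp_all
    show "\<exists>e I. inner_form.frame (g y) e \<and>
      (\<forall>i\<in>I. ddir \<Psi> y (e i) = 0) \<and> (\<forall>i\<in>-I. ddir \<Phi> y (e i) = 0)"
      using kill[OF y] by blast
    fix a assume a: "\<And>w. B a (ddir f y w) = 0" "B a (\<Phi> y) = 0" "B a (\<Psi> y) = 0"
    have af: "B a (f y) = 0" using a(2,3) by (simp add: sum B_simps)
    have "B a (N y) = 0"
      using a(2) d af by (simp add: \<Phi>_def B_simps)
    then show "a = 0" using nondegenerate[OF _ N(2)[OF y] a(1)] af y V(3) by auto
  qed
  obtain e and I :: "'n set" where e: "card I = p" "inner_form.frame (g y0) e"
    "\<forall>i\<in>I. ddir \<Psi> y0 (e i) = 0" "\<forall>i\<in>-I. ddir \<Phi> y0 (e i) = 0"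
    using kill[OF V(4)] by blast
  show thesis by (rule that[OF V(4) split e(2,1)]) (use e in auto)
qed

end

section \<open>Local isometry with the product model\<close>

lemma smooth_local_homeomorphism:
  fixes \<psi> :: "'a::euclidean_space \<Rightarrow> 'a"
  assumes V: "open V" and \<psi>: "smooth_on V \<psi>" and y0: "y0 \<in> V" and inj: "inj (ddir \<psi> y0)"
  obtains V' W h where "open V'" "y0 \<in> V'" "V' \<subseteq> V" "open W" "homeomorphism V' W \<psi> h"
proof -
  define \<psi>' where "\<psi>' x = Blinfun (ddir \<psi> x)" for x
  have ap: "blinfun_apply (\<psi>' x) = ddir \<psi> x" if "x \<in> V" for x
    unfolding \<psi>'_def using smooth_on_has_derivative[OF \<psi> that]
    by (intro bounded_linear_Blinfun_apply has_derivative_bounded_linear)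
  have "continuous_on V \<psi>'"
  proof (rule continuous_on_blinfun_componentwise)
    fix i :: 'a
    have "continuous_on V (\<lambda>x. ddir \<psi> x i)"
      by (rule smooth_on_continuous_on[OF smooth_on_ddir[OF \<psi>]])
    then show "continuous_on V (\<lambda>x. \<psi>' x i)"
      by (rule continuous_on_eq) (simp add: ap)
  qed
  moreover obtain L where L: "linear L" "L \<circ> ddir \<psi> y0 = id"
    using linear_injective_left_inverse[OF smooth_on_linear_ddir[OF \<psi> y0] inj] by blast
  moreover have "Blinfun L o\<^sub>L \<psi>' y0 = id_blinfun"
  proof (rule blinfun_eqI)
    fix v
    show "blinfun_apply (Blinfun L o\<^sub>L \<psi>' y0) v = blinfun_apply id_blinfun v"
      using fun_cong[OF L(2), of v] bounded_linear_Blinfun_apply[of L] linear_conv_bounded_linear[of L] L(1)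
      by (simp add: ap[OF y0])
  qed
  moreover have "(\<psi> has_derivative blinfun_apply (\<psi>' x)) (at x)" if "x \<in> V" for x
    unfolding ap[OF that] by (rule smooth_on_has_derivative[OF \<psi> that])
  ultimately obtain V' W h where "open V'" "V' \<subseteq> V" "y0 \<in> V'" "open W" "homeomorphism V' W \<psi> h"
    using inverse_function_theorem[OF V _ _ y0, of \<psi> \<psi>' "Blinfun L"] by metis
  then show thesis using that by blast
qed

lemma sum_atMost_bij:
  fixes F :: "nat \<Rightarrow> real"
  assumes "bij_betw \<alpha> I {1..p}"
  shows "(\<Sum>j\<le>p. F j) = F 0 + (\<Sum>i\<in>I. F (\<alpha> i))" "(\<Sum>j=1..p. F j) = (\<Sum>i\<in>I. F (\<alpha> i))"
proof -
  show 1: "(\<Sum>j=1..p. F j) = (\<Sum>i\<in>I. F (\<alpha> i))"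
    using sum.reindex_bij_betw[OF assms, of F] by simp
  have "{..p} = insert 0 {1..p}" by auto
  then have "(\<Sum>j\<le>p. F j) = F 0 + (\<Sum>j=1..p. F j)" by simp
  then show "(\<Sum>j\<le>p. F j) = F 0 + (\<Sum>i\<in>I. F (\<alpha> i))" unfolding 1 .
qed

text \<open>The second factor is a sphere or a hyperbolic space, according to the sign of its curvature;
  the two differ in the sign of the square of the coordinate with index \<open>0\<close>.\<close>

definition space_model :: "nat \<Rightarrow> real \<Rightarrow> nat model" where
  "space_model m k = (if k > 0 then sphere_model m k else hyperbolic_model m k)"

lemma bform_space_model:
  assumes "bij_betw \<alpha> I {1..m}"
  shows "bform (space_model m k) u v = (if k > 0 then 1 else - 1) * (u 0 * v 0) + (\<Sum>i\<in>I. u (\<alpha> i) * v (\<alpha> i))"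
  using sum_atMost_bij[OF assms, of "\<lambda>j. u j * v j"]
  by (simp add: space_model_def sphere_model_def hyperbolic_model_def Let_def)

lemma pts_space_model:
  assumes "u 0 > 0"
  shows "u \<in> pts (space_model m k) \<longleftrightarrow> (\<forall>i>m. u i = 0) \<and> bform (space_model m k) u u = 1 / k"
  using assms by (simp add: space_model_def sphere_model_def hyperbolic_model_def Let_def)

text \<open>The quadric equation determines the square of the coordinate with index 0 and positivity
  determines its sign, so the remaining coordinates form a chart of this half of the model.\<close>

lemma space_model_eqI:
  assumes \<alpha>: "bij_betw \<alpha> I {1..m}" and u: "u \<in> pts (space_model m k)" "u 0 > 0"
    and v: "v \<in> pts (space_model m k)" "v 0 > 0" and eq: "\<And>i. i \<in> I \<Longrightarrow> u (\<alpha> i) = v (\<alpha> i)"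
  shows "u = v"
proof
  fix j
  have "(\<Sum>i\<in>I. u (\<alpha> i) * u (\<alpha> i)) = (\<Sum>i\<in>I. v (\<alpha> i) * v (\<alpha> i))" by (simp add: eq)
  moreover have "(if k > 0 then 1 else - 1) * (u 0 * u 0) + (\<Sum>i\<in>I. u (\<alpha> i) * u (\<alpha> i))
      = (if k > 0 then 1 else - 1) * (v 0 * v 0) + (\<Sum>i\<in>I. v (\<alpha> i) * v (\<alpha> i))"
    using u v unfolding pts_space_model[of u, OF u(2)] pts_space_model[of v, OF v(2)] bform_space_model[OF \<alpha>] by simp
  ultimately have "u 0 * u 0 = v 0 * v 0" by (auto split: if_splits)
  then have 0: "u 0 = v 0" using u(2) v(2) by (metis less_imp_le power2_eq_iff_nonneg power2_eq_square)
  consider "j = 0" | "j \<in> {1..m}" | "j > m" by force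
  then show "u j = v j"
  proof cases
    case 2
    then have "j \<in> \<alpha> ` I" using \<alpha> by (simp add: bij_betw_def)
    then obtain i where "i \<in> I" "j = \<alpha> i" by blast
    then show ?thesis using eq by simp
  next
    case 3
    then show ?thesis using u v unfolding pts_space_model[of u, OF u(2)] pts_space_model[of v, OF v(2)] by simp
  qed (simp add: 0)
qed

context split_hypersurface
begin

interpretation sw: split_hypersurface U f B c g V \<Psi> \<Phi> l k
  by (rule swap)

text \<open>The coordinates are the \<open>B\<close>-products of \<open>f y\<close> with an adapted
  basis at \<open>y0\<close>, hence linear in \<open>f\<close>; by \<open>ambient_parseval\<close>
  they carry \<open>B\<close> to the form of the model. The inverse function theorem is applied to
  the tangential ones only, and \<open>space_model_eqI\<close> recovers the other two.\<close>

lemma local_model: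
  assumes y0: "y0 \<in> V" and e: "inner_form.frame (g y0) e"
    and I: "\<And>i. i \<in> I \<Longrightarrow> ddir \<Psi> y0 (e i) = 0" "\<And>i. i \<notin> I \<Longrightarrow> ddir \<Phi> y0 (e i) = 0"
    and k: "k > 0"
  defines "M \<equiv> product_model (space_model (card I) k) (space_model (card (- I)) l)"
  obtains V' W b h where "open V'" "y0 \<in> V'" "V' \<subseteq> V" "openin (top_of_set (pts M)) W"
    "homeomorphism V' W (\<lambda>y s. B (f y) (b s)) h"
    "\<And>u v. bform M (\<lambda>s. B u (b s)) (\<lambda>s. B v (b s)) = B u v"
proof -
  have y0U: "y0 \<in> U" using y0 V(3) by blast
  have l: "l \<noteq> 0" using \<Psi>\<Psi>[OF y0] by auto
  have nat_bij: "\<exists>\<alpha>. bij_betw \<alpha> J {1..card J}" for J :: "'n set"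
  proof -
    obtain \<beta> where "bij_betw \<beta> J {0..<card J}" using ex_bij_betw_finite_nat[of J] by auto
    moreover have "bij_betw Suc {0..<card J} {1..card J}"
      by (auto simp: bij_betw_def image_Suc_atLeastLessThan)
    ultimately show ?thesis using bij_betw_trans by blast
  qed
  obtain \<alpha> where \<alpha>: "bij_betw \<alpha> I {1..card I}" using nat_bij by blast
  obtain \<beta> where \<beta>: "bij_betw \<beta> (- I) {1..card (- I)}" using nat_bij by blast
  define \<epsilon> :: real where "\<epsilon> = (if l > 0 then 1 else - 1)"
  have \<epsilon>: "\<epsilon> * \<epsilon> = 1" "\<epsilon> * \<bar>l\<bar> = l" using l by (auto simp: \<epsilon>_def)
  \<comment> \<open>Index 0 of each block belongs to \<open>\<Phi> y0\<close> or
    \<open>\<Psi> y0\<close>, scaled to unit absolute square; indices from 1 on enumerate the frame,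
    the rest is zero. For \<open>l < 0\<close> the vector \<open>\<Psi> y0\<close> is timelike, and
    \<epsilon> makes the timelike coordinate of \<open>f y0\<close> positive.\<close>
  define b :: "nat + nat \<Rightarrow> 'e" where "b s = (case s of
      Inl j \<Rightarrow> if j = 0 then sqrt k *\<^sub>R \<Phi> y0 else if j \<le> card I then ddir f y0 (e (inv_into I \<alpha> j)) else 0
    | Inr j \<Rightarrow> if j = 0 then (\<epsilon> * sqrt \<bar>l\<bar>) *\<^sub>R \<Psi> y0 else if j \<le> card (- I) then ddir f y0 (e (inv_into (- I) \<beta> j)) else 0)" for s
  have b\<alpha>: "b (Inl (\<alpha> i)) = ddir f y0 (e i)" if "i \<in> I" for i
  proof -
    have "\<alpha> i \<in> {1..card I}" "inv_into I \<alpha> (\<alpha> i) = i" using \<alpha> that by (auto simp: bij_betw_def)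
    then show ?thesis by (simp add: b_def)
  qed
  have b\<beta>: "b (Inr (\<beta> i)) = ddir f y0 (e i)" if "i \<in> - I" for i
  proof -
    have "\<beta> i \<in> {1..card (- I)}" "inv_into (- I) \<beta> (\<beta> i) = i" using \<beta> that by (auto simp: bij_betw_def)
    then show ?thesis by (simp add: b_def)
  qed
  have b0: "b (Inl 0) = sqrt k *\<^sub>R \<Phi> y0" "b (Inr 0) = (\<epsilon> * sqrt \<bar>l\<bar>) *\<^sub>R \<Psi> y0" by (simp_all add: b_def)
  define T where "T a = (\<lambda>s. B a (b s))" for a
  let ?M1 = "space_model (card I) k" and ?M2 = "space_model (card (- I)) l"
  have form1: "bform ?M1 (T u \<circ> Inl) (T v \<circ> Inl)
      = k * (B u (\<Phi> y0) * B v (\<Phi> y0)) + (\<Sum>i\<in>I. B u (ddir f y0 (e i)) * B v (ddir f y0 (e i)))" for u v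
  proof -
    have "sqrt k * x * (sqrt k * z) = k * (x * z)" for x z
      using k by (metis abs_of_pos mult.assoc mult.left_commute real_sqrt_mult_self)
    then show ?thesis
      unfolding bform_space_model[OF \<alpha>] by (simp add: T_def k b\<alpha> b0 B_simps)
  qed
  have form2: "bform ?M2 (T u \<circ> Inr) (T v \<circ> Inr)
      = l * (B u (\<Psi> y0) * B v (\<Psi> y0)) + (\<Sum>i\<in>-I. B u (ddir f y0 (e i)) * B v (ddir f y0 (e i)))" for u v
  proof -
    have "\<epsilon> * ((\<epsilon> * sqrt \<bar>l\<bar> * x) * (\<epsilon> * sqrt \<bar>l\<bar> * z)) = l * (x * z)" for x z
    proof -
      have "\<epsilon> * ((\<epsilon> * sqrt \<bar>l\<bar> * x) * (\<epsilon> * sqrt \<bar>l\<bar> * z)) = (\<epsilon> * \<epsilon>) * (\<epsilon> * (sqrt \<bar>l\<bar> * sqrt \<bar>l\<bar>)) * (x * z)"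
        by (simp only: mult_ac)
      then show ?thesis by (simp only: \<epsilon> real_sqrt_mult_self abs_abs mult_1_left)
    qed
    then show ?thesis
      unfolding bform_space_model[OF \<beta>] \<epsilon>_def[symmetric] by (simp add: T_def b\<beta> b0 B_simps)
  qed
  have form: "bform M (T u) (T v) = B u v" for u v
  proof -
    have "(\<Sum>i\<in>UNIV. B u (ddir f y0 (e i)) * B v (ddir f y0 (e i)))
        = (\<Sum>i\<in>I. B u (ddir f y0 (e i)) * B v (ddir f y0 (e i))) + (\<Sum>i\<in>-I. B u (ddir f y0 (e i)) * B v (ddir f y0 (e i)))"
      by (simp add: sum.union_disjoint[symmetric])
    then show ?thesis
      unfolding M_def product_model_def by (simp add: form1 form2 ambient_parseval[OF y0 e, of u v])
  qed
  have De: "ddir f y0 (e i) = (if i \<in> I then ddir \<Phi> y0 (e i) else ddir \<Psi> y0 (e i))" for i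
    using I[of i] by (simp add: Df_split[OF y0])
  \<comment> \<open>By \<open>\<Phi>_range\<close> the first block sees only the summand \<Phi> of
    \<open>f\<close>, and the second block vanishes on \<open>\<Phi> y\<close>; so the first block
    carries the full square of \<open>\<Phi> y\<close>.\<close>
  have norm1: "bform ?M1 (T (f y) \<circ> Inl) (T (f y) \<circ> Inl) = 1 / k" if y: "y \<in> V" for y
  proof -
    have "bform ?M1 (T (f y) \<circ> Inl) (T (f y) \<circ> Inl) = bform ?M1 (T (\<Phi> y) \<circ> Inl) (T (\<Phi> y) \<circ> Inl)"
      unfolding form1 using sw.\<Phi>_range[OF y y0] by (simp add: f_split[OF y] B_simps De)
    also have "\<dots> = bform M (T (\<Phi> y)) (T (\<Phi> y))"
      unfolding M_def product_model_def using \<Phi>_range[OF y y0] by (simp add: form2 De)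
    also have "\<dots> = 1 / k" using \<Phi>\<Phi>[OF y] k by (simp add: form field_simps)
    finally show ?thesis .
  qed
  have norm2: "bform ?M2 (T (f y) \<circ> Inr) (T (f y) \<circ> Inr) = 1 / l" if y: "y \<in> V" for y
  proof -
    have "bform ?M2 (T (f y) \<circ> Inr) (T (f y) \<circ> Inr) = bform ?M2 (T (\<Psi> y) \<circ> Inr) (T (\<Psi> y) \<circ> Inr)"
      unfolding form2 using \<Phi>_range[OF y y0] by (simp add: f_split[OF y] B_simps De)
    also have "\<dots> = bform M (T (\<Psi> y)) (T (\<Psi> y))"
      unfolding M_def product_model_def using sw.\<Phi>_range[OF y y0] by (simp add: form1 De)
    also have "\<dots> = 1 / l" using \<Psi>\<Psi>[OF y] l by (simp add: form field_simps)
    finally show ?thesis .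
  qed
  have high: "\<forall>j>card I. (T a \<circ> Inl) j = 0" "\<forall>j>card (- I). (T a \<circ> Inr) j = 0" for a
    by (simp_all add: T_def b_def B_simps)
  have sT: "smooth_on V (\<lambda>y. T (f y) s)" for s
    unfolding T_def by (intro smooth_on_bilinear[OF bil V(1)] smooth_on_const smooth_on_subset[OF smooth_f V(3)])
  \<comment> \<open>Restricts to points where both coordinates with index 0 are positive, as
    \<open>space_model_eqI\<close> requires.\<close>
  define V1 where "V1 = V \<inter> ((\<lambda>y. T (f y) (Inl 0)) -` {0<..} \<inter> (\<lambda>y. T (f y) (Inr 0)) -` {0<..})"
  have "open (V \<inter> (\<lambda>y. T (f y) s) -` {0<..})" for s
    by (intro continuous_open_preimage V(1) smooth_on_continuous_on[OF sT]) auto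
  from open_Int[OF this[of "Inl 0"] this[of "Inr 0"]] have V1: "open V1"
    by (simp add: V1_def Int_assoc Int_left_commute Int_commute)
  have y0V1: "y0 \<in> V1"
  proof -
    have 1: "B (f y0) (\<Phi> y0) = 1 / k" "B (f y0) (\<Psi> y0) = 1 / l"
      using \<Phi>\<Phi>[OF y0] \<Psi>\<Psi>[OF y0] \<Phi>\<Psi>[OF y0] sw.\<Phi>\<Psi>[OF y0] k l
      by (simp_all add: f_split[OF y0] B_simps field_simps)
    have "\<epsilon> * sqrt \<bar>l\<bar> * (1 / l) > 0" using l by (auto simp: \<epsilon>_def divide_less_0_iff zero_less_divide_iff)
    then show ?thesis using y0 k by (simp add: V1_def T_def b0 B_simps 1)
  qed
  define \<psi> where "\<psi> y = (\<chi> i. B (f y) (ddir f y0 (e i)))" for y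
  define pr :: "(nat + nat \<Rightarrow> real) \<Rightarrow> real ^ 'n" where
    "pr w = (\<chi> i. if i \<in> I then w (Inl (\<alpha> i)) else w (Inr (\<beta> i)))" for w
  have pr\<psi>: "pr (T (f y)) = \<psi> y" for y
    by (simp add: pr_def \<psi>_def T_def vec_eq_iff b\<alpha> b\<beta>)
  have s\<psi>: "smooth_on V1 \<psi>"
  proof -
    have "smooth_on V \<psi>"
      unfolding \<psi>_def
      by (intro smooth_on_vec V(1) smooth_on_bilinear[OF bil V(1)] smooth_on_const smooth_on_subset[OF smooth_f V(3)])
    then show ?thesis by (rule smooth_on_subset) (auto simp: V1_def)
  qed
  have "inj (ddir \<psi> y0)"
  proof -
    have "(\<psi> has_derivative (\<lambda>v. \<chi> i. B (ddir f y0 v) (ddir f y0 (e i)))) (at y0)"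
      unfolding \<psi>_def
    proof (rule iffD2[OF has_derivative_componentwise_within], rule ballI)
      fix d :: "real ^ 'n" assume "d \<in> Basis"
      then obtain i where d: "d = axis i 1" by (auto simp: Basis_vec_def)
      have "((\<lambda>y. B (f y) (ddir f y0 (e i))) has_derivative (\<lambda>v. B (ddir f y0 v) (ddir f y0 (e i)))) (at y0)"
        using bounded_bilinear.FDERIV[OF bil D_derivative[OF y0U] has_derivative_const[of "ddir f y0 (e i)"]]
        by (simp add: B_simps)
      then show "((\<lambda>x. (\<chi> i. B (f x) (ddir f y0 (e i))) \<bullet> d) has_derivative
          (\<lambda>x. (\<chi> i. B (ddir f y0 x) (ddir f y0 (e i))) \<bullet> d)) (at y0)"
        by (simp add: d inner_axis)
    qed
    then have D: "ddir \<psi> y0 v = (\<chi> i. g y0 v (e i))" for v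
      by (simp add: ddirI g_eq[OF y0U])
    show ?thesis
    proof (rule injI)
      fix v w assume "ddir \<psi> y0 v = ddir \<psi> y0 w"
      then have "g y0 v (e i) = g y0 w (e i)" for i by (simp add: D vec_eq_iff)
      then show "v = w" by (rule inner_form.frame_eqI[OF inner[OF y0] e])
    qed
  qed
  from smooth_local_homeomorphism[OF V1 s\<psi> y0V1 this]
  obtain V' W' h where V': "open V'" "y0 \<in> V'" "V' \<subseteq> V1" "open W'" and h: "homeomorphism V' W' \<psi> h"
    by blast
  define Q where "Q = (\<lambda>w. w (Inl 0)) -` {0<..} \<inter> (\<lambda>w. w (Inr 0)) -` {0<..} \<inter> pr -` W'"
  define W where "W = pts M \<inter> Q"
  have cpr: "continuous_on A pr" for A
  proof -
    have "continuous_on UNIV (\<lambda>w. if i \<in> I then w (Inl (\<alpha> i)) else w (Inr (\<beta> i)))" for i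
      by (cases "i \<in> I") simp_all
    then show ?thesis
      unfolding pr_def by (intro continuous_on_vec_lambda) (rule continuous_on_subset[OF _ subset_UNIV])
  qed
  have "open Q"
    unfolding Q_def by (intro open_Int open_vimage V'(4) cpr open_greaterThan continuous_on_product_coordinates)
  then have W: "openin (top_of_set (pts M)) W" unfolding W_def by (simp add: openin_open_Int)
  have inW: "T (f y) \<in> W" if y: "y \<in> V'" for y
  proof -
    have yV: "y \<in> V" and p: "T (f y) (Inl 0) > 0" "T (f y) (Inr 0) > 0" using y V'(3) by (auto simp: V1_def)
    have "T (f y) \<in> pts M"
      using p norm1[OF yV] norm2[OF yV] high
      by (simp add: M_def product_model_def pts_space_model)
    moreover have "\<psi> y \<in> W'" using h y by (auto simp: homeomorphism_def)
    ultimately show ?thesis using p by (simp add: W_def Q_def pr\<psi>)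
  qed
  have inv: "h (pr w) \<in> V'" "T (f (h (pr w))) = w" if w: "w \<in> W" for w
  proof -
    have prw: "pr w \<in> W'" and p: "w (Inl 0) > 0" "w (Inr 0) > 0" and wM: "w \<in> pts M"
      using w by (auto simp: W_def Q_def)
    show hV: "h (pr w) \<in> V'" using h prw by (auto simp: homeomorphism_def)
    have prp: "pr (T (f (h (pr w)))) = pr w" using h prw by (simp add: pr\<psi> homeomorphism_def)
    have pri: "pr a $ i = (if i \<in> I then a (Inl (\<alpha> i)) else a (Inr (\<beta> i)))" for a i by (simp add: pr_def)
    have eq: "(if i \<in> I then T (f (h (pr w))) (Inl (\<alpha> i)) else T (f (h (pr w))) (Inr (\<beta> i)))
        = (if i \<in> I then w (Inl (\<alpha> i)) else w (Inr (\<beta> i)))" for i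
      using arg_cong[OF prp, of "\<lambda>v. v $ i"] unfolding pri[of _ i] .
    have eqI: "T (f (h (pr w))) (Inl (\<alpha> i)) = w (Inl (\<alpha> i))" if "i \<in> I" for i
      using eq[of i] that by simp
    have eqJ: "T (f (h (pr w))) (Inr (\<beta> i)) = w (Inr (\<beta> i))" if "i \<in> - I" for i
      using eq[of i] that by simp
    have TW: "T (f (h (pr w))) \<in> W" by (rule inW[OF hV])
    have 1: "T (f (h (pr w))) \<circ> Inl = w \<circ> Inl"
      by (rule space_model_eqI[OF \<alpha>, where k = k])
        (use TW wM p eqI in \<open>auto simp: W_def Q_def M_def product_model_def\<close>)
    have 2: "T (f (h (pr w))) \<circ> Inr = w \<circ> Inr"
      by (rule space_model_eqI[OF \<beta>, where k = l])
        (use TW wM p eqJ in \<open>auto simp: W_def Q_def M_def product_model_def\<close>)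
    show "T (f (h (pr w))) = w"
    proof
      fix s show "T (f (h (pr w))) s = w s"
        using fun_cong[OF 1] fun_cong[OF 2] by (cases s) auto
    qed
  qed
  have hom: "homeomorphism V' W (\<lambda>y. T (f y)) (\<lambda>w. h (pr w))"
  proof (rule homeomorphismI)
    have V'V: "V' \<subseteq> V" using V'(3) by (auto simp: V1_def)
    show "continuous_on V' (\<lambda>y. T (f y))"
      by (intro continuous_on_coordinatewise_then_product continuous_on_subset[OF smooth_on_continuous_on[OF sT] V'V])
    have "continuous_on W' h" using h by (simp add: homeomorphism_def)
    then show "continuous_on W (\<lambda>w. h (pr w))"
      by (rule continuous_on_compose2[OF _ cpr]) (auto simp: W_def Q_def)
    show "(\<lambda>y. T (f y)) ` V' \<subseteq> W" using inW by blast
    show "(\<lambda>w. h (pr w)) ` W \<subseteq> V'" using inv(1) by blast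
    show "h (pr (T (f y))) = y" if "y \<in> V'" for y using h that by (simp add: pr\<psi> homeomorphism_def)
    show "T (f (h (pr w))) = w" if "w \<in> W" for w by (rule inv(2)[OF that])
  qed
  show thesis
  proof (rule that[OF V'(1,2) _ W])
    show "V' \<subseteq> V" using V'(3) by (auto simp: V1_def)
    show "homeomorphism V' W (\<lambda>y s. B (f y) (b s)) (\<lambda>w. h (pr w))" using hom by (simp add: T_def)
    show "bform M (\<lambda>s. B u (b s)) (\<lambda>s. B v (b s)) = B u v" for u v
      using form[of u v] by (simp add: T_def)
  qed
qed

end

section \<open>Hypersurfaces of space forms\<close>

lemma homeomorphism_imp_homeomorphic_map:
  assumes "homeomorphism S T f h"
  shows "homeomorphic_map (top_of_set S) (top_of_set T) f"
proof -
  have "homeomorphic_maps (top_of_set S) (top_of_set T) f h"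
    using assms unfolding homeomorphic_maps_def homeomorphism_def continuous_map_in_subtopology
    by (auto simp: topspace_subtopology)
  then show ?thesis by (rule homeomorphic_maps_imp_map)
qed

text \<open>A hypersurface of a space form, with the coordinate space of the model identified with
  \<open>real ^ 'm\<close> along a numbering \<open>idx\<close> of the coordinates.\<close>

locale space_form_hypersurface =
  fixes X :: "'a topology"
    and A :: "('a, 'n::finite) chart set"
    and F :: "'a \<Rightarrow> nat \<Rightarrow> real"
    and c :: real
    and g :: "('a, 'n) chart \<Rightarrow> 'n local_metric"
    and idx :: "'m::finite \<Rightarrow> nat"
  assumes n3: "CARD('n) \<ge> 3"
    and manifold: "smooth_manifold X A"
    and connected: "connected_space X"
    and immersion: "immersion X A (space_form (CARD('n) + 1) c) F"
    and metric: "g = induced_metric (space_form (CARD('n) + 1) c) F"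
    and card_m: "CARD('m) = CARD('n) + (if c = 0 then 1 else 2)"
    and idx: "bij_betw idx UNIV {..<CARD('m)}"
begin

definition emb :: "(nat \<Rightarrow> real) \<Rightarrow> real ^ 'm" where
  "emb u = (\<chi> j. u (idx j))"

definition t0 :: 'm where
  "t0 = inv_into UNIV idx 0"

definition B :: "real ^ 'm \<Rightarrow> real ^ 'm \<Rightarrow> real" where
  "B a b = a \<bullet> b - (if c < 0 then 2 else 0) * (a $ t0 * b $ t0)"

definition f :: "('a, 'n) chart \<Rightarrow> real ^ 'n \<Rightarrow> real ^ 'm" where
  "f ch y = emb (F (chart_inv ch y))"

lemma idx_t0: "idx t0 = 0"
proof -
  have "0 \<in> idx ` UNIV" using idx by (simp add: bij_betw_def)
  then show ?thesis unfolding t0_def by (rule f_inv_into_f)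
qed

lemma emb_inner: "emb u \<bullet> emb v = (\<Sum>i<CARD('m). u i * v i)"
  using sum.reindex_bij_betw[OF idx, of "\<lambda>i. u i * v i"] by (simp add: inner_vec_def emb_def)

lemma bform_emb: "bform (space_form (CARD('n) + 1) c) u v = B (emb u) (emb v)"
proof -
  have t: "emb u $ t0 = u 0" for u by (simp add: emb_def idx_t0)
  consider "c > 0" | "c = 0" | "c < 0" by linarith
  then show ?thesis
  proof cases
    case 1
    then show ?thesis
      by (simp add: space_form_def sphere_model_def Let_def B_def emb_inner card_m lessThan_Suc_atMost)
  next
    case 2
    then show ?thesis
      unfolding B_def by (simp add: space_form_def euclidean_model_def emb_inner card_m)
  next
    case 3
    have "{..<CARD('n) + 2} = insert 0 {1..CARD('n) + 1}" by auto
    then show ?thesis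
      using 3 by (simp add: space_form_def hyperbolic_model_def Let_def B_def emb_inner card_m t)
  qed
qed

lemma space_form_high: "u \<in> pts (space_form (CARD('n) + 1) c) \<Longrightarrow> i \<ge> CARD('m) \<Longrightarrow> u i = 0"
  by (auto simp: space_form_def sphere_model_def hyperbolic_model_def euclidean_model_def Let_def card_m split: if_splits)

lemma space_form_quadric: "u \<in> pts (space_form (CARD('n) + 1) c) \<Longrightarrow> c \<noteq> 0 \<Longrightarrow> B (emb u) (emb u) = 1 / c"
  unfolding bform_emb[symmetric]
  by (auto simp: space_form_def sphere_model_def hyperbolic_model_def Let_def split: if_splits)

lemma bounded_bilinear_B: "bounded_bilinear B"
proof -
  have "bilinear B"
    unfolding bilinear_def B_def
    by (intro conjI allI linearI) (simp_all add: inner_add_left inner_add_right algebra_simps)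
  then show ?thesis by (simp add: bilinear_conv_bounded_bilinear)
qed

lemma B_sym: "B a b = B b a"
  by (simp add: B_def inner_commute mult.commute)

text \<open>For \<open>c < 0\<close> the vector \<open>emb u\<close> is timelike, and its orthogonal complement is positive definite.\<close>

lemma B_positive:
  assumes u: "u \<in> pts (space_form (CARD('n) + 1) c)" and 0: "c * B a (emb u) = 0" and a: "a \<noteq> 0"
  shows "B a a > 0"
proof (cases "c < 0")
  case False
  then show ?thesis using a by (simp add: B_def)
next
  case True
  define x where "x = emb u"
  \<comment> \<open>Spatial parts, without the timelike coordinate. Cauchy-Schwarz for them,
    together with \<open>x\<close> being timelike, gives the reverse estimate for
    \<open>a\<close>.\<close>
  define a' where "a' = a - (a $ t0) *\<^sub>R axis t0 1"
  define x' where "x' = x - (x $ t0) *\<^sub>R axis t0 1"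
  have e: "axis t0 (1::real) \<bullet> axis t0 1 = 1" by (simp add: inner_axis)
  have aa: "a' \<bullet> a' = a \<bullet> a - a $ t0 * a $ t0" "x' \<bullet> x' = x \<bullet> x - x $ t0 * x $ t0"
    "a' \<bullet> x' = a \<bullet> x - a $ t0 * x $ t0"
    by (simp_all add: a'_def x'_def inner_diff_left inner_diff_right inner_axis inner_axis' e)
  have xx: "x' \<bullet> x' < x $ t0 * x $ t0"
  proof -
    have "B x x < 0" using space_form_quadric[OF u] True by (simp add: x_def)
    then show ?thesis using True aa(2) by (simp add: B_def)
  qed
  have ax: "a' \<bullet> x' = a $ t0 * x $ t0" using 0 True aa(3) by (simp add: B_def x_def)
  have "a $ t0 * a $ t0 < a' \<bullet> a'"
  proof (cases "a' = 0")
    case True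
    have "x $ t0 \<noteq> 0"
    proof
      assume "x $ t0 = 0"
      then have "x' \<bullet> x' < 0" using xx by simp
      with inner_ge_zero[of x'] show False by linarith
    qed
    then have "a $ t0 = 0" using ax True by simp
    with True a show ?thesis by (simp add: a'_def)
  next
    case False
    have "(a $ t0 * x $ t0)\<^sup>2 \<le> (a' \<bullet> a') * (x' \<bullet> x')"
      using Cauchy_Schwarz_ineq[of a' x'] by (simp add: ax)
    also have "\<dots> < (a' \<bullet> a') * (x $ t0 * x $ t0)" using xx False by (intro mult_strict_left_mono) auto
    finally have "(a $ t0 * a $ t0) * (x $ t0 * x $ t0) < (a' \<bullet> a') * (x $ t0 * x $ t0)"
      by (simp add: power2_eq_square mult_ac)
    then show ?thesis using mult_right_less_imp_less zero_le_square by blast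
  qed
  then show ?thesis using True aa(1) by (simp add: B_def)
qed

lemma chart_facts:
  assumes ch: "ch \<in> A"
  shows "openin X (fst ch)" "open (chart_range ch)" "fst ch \<subseteq> topspace X"
    "homeomorphic_map (subtopology X (fst ch)) (top_of_set (chart_range ch)) (snd ch)"
    "inj_on (snd ch) (fst ch)"
proof -
  show 1: "openin X (fst ch)" "open (chart_range ch)"
    "homeomorphic_map (subtopology X (fst ch)) (top_of_set (chart_range ch)) (snd ch)"
    using manifold ch unfolding smooth_manifold_def by blast+
  show sub: "fst ch \<subseteq> topspace X" using 1(1) openin_subset by blast
  show "inj_on (snd ch) (fst ch)"
    using homeomorphic_imp_injective_map[OF 1(3)] sub by (simp add: Int_absorb1)
qed

lemma chart_inv_in: "y \<in> chart_range ch \<Longrightarrow> chart_inv ch y \<in> fst ch"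
  unfolding chart_range_def chart_inv_def by (rule inv_into_into)

lemma chart_chart_inv: "y \<in> chart_range ch \<Longrightarrow> snd ch (chart_inv ch y) = y"
  unfolding chart_range_def chart_inv_def by (rule f_inv_into_f)

lemma chart_inv_chart: "ch \<in> A \<Longrightarrow> x \<in> fst ch \<Longrightarrow> chart_inv ch (snd ch x) = x"
  unfolding chart_inv_def by (rule inv_into_f_f[OF chart_facts(5)])

lemma F_component:
  assumes ch: "ch \<in> A"
  shows "smooth_on (chart_range ch) (\<lambda>y. F (chart_inv ch y) i)"
proof -
  have "fst ch \<inter> topspace X = fst ch" using chart_facts(3)[OF ch] by blast
  then show ?thesis
    using immersion ch unfolding immersion_def smooth_map_on_def chart_range_def by metis
qed

lemma F_pts:
  assumes "ch \<in> A" "y \<in> chart_range ch"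
  shows "F (chart_inv ch y) \<in> pts (space_form (CARD('n) + 1) c)"
  using immersion chart_inv_in[OF assms(2)] chart_facts(3)[OF assms(1)] unfolding immersion_def by blast

lemma smooth_f: "ch \<in> A \<Longrightarrow> smooth_on (chart_range ch) (f ch)"
  unfolding f_def emb_def by (intro smooth_on_vec chart_facts F_component)

lemma ddir_f:
  assumes ch: "ch \<in> A" and y: "y \<in> chart_range ch"
  shows "ddir (f ch) y v = emb (differential F ch y v)"
proof -
  have "ddir (f ch) y v $ j = ddir (\<lambda>z. F (chart_inv ch z) (idx j)) y v" for j
  proof -
    have "((\<lambda>z. f ch z \<bullet> axis j 1) has_derivative (\<lambda>v. ddir (f ch) y v \<bullet> axis j 1)) (at y)"
      by (intro has_derivative_inner_left smooth_on_has_derivative[OF smooth_f[OF ch] y])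
    then have "((\<lambda>z. F (chart_inv ch z) (idx j)) has_derivative (\<lambda>v. ddir (f ch) y v $ j)) (at y)"
      by (simp add: inner_axis f_def emb_def)
    then show ?thesis by (simp add: ddirI)
  qed
  then show ?thesis by (simp add: vec_eq_iff emb_def differential_def)
qed

lemma chart_hypersurface:
  assumes ch: "ch \<in> A"
  shows "chart_hypersurface (chart_range ch) (f ch) B c (g ch)"
proof (rule chart_hypersurface.intro)
  show "open (chart_range ch)" by (rule chart_facts(2)[OF ch])
  show "smooth_on (chart_range ch) (f ch)" by (rule smooth_f[OF ch])
  show "bounded_bilinear B" by (rule bounded_bilinear_B)
  show "B a b = B b a" for a b by (rule B_sym)
  show "DIM(real ^ 'm) = CARD('n) + (if c = 0 then 1 else 2)" by (simp add: card_m)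
  fix y assume y: "y \<in> chart_range ch"
  show "inj (ddir (f ch) y)"
  proof (rule injI)
    fix v w assume eq: "ddir (f ch) y v = ddir (f ch) y w"
    have "differential F ch y v i = differential F ch y w i" for i
    proof (cases "i < CARD('m)")
      case True
      then have "i \<in> idx ` UNIV" using idx by (simp add: bij_betw_def)
      then obtain j where "i = idx j" by blast
      then show ?thesis using eq by (simp add: ddir_f[OF ch y] emb_def vec_eq_iff)
    next
      case False
      \<comment> \<open>Coordinates beyond \<open>CARD('m)\<close> vanish identically on the model,
        so dropping them in \<open>emb\<close> loses no injectivity.\<close>
      have "ddir (\<lambda>z. F (chart_inv ch z) i) y v = 0" for v
      proof -
        have "((\<lambda>z. F (chart_inv ch z) i) has_derivative (\<lambda>v. 0)) (at y)"
          by (rule has_derivative_transform_within_open[OF has_derivative_const[of 0] chart_facts(2)[OF ch] y])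
            (use False space_form_high[OF F_pts[OF ch]] in simp)
        then show ?thesis by (rule ddirI)
      qed
      then show ?thesis by (simp add: differential_def)
    qed
    then have "differential F ch y v = differential F ch y w" by (rule ext)
    moreover have "inj (differential F ch y)" using immersion ch y unfolding immersion_def by blast
    ultimately show "v = w" by (simp add: inj_eq)
  qed
  show "B a a > 0" if "c * B a (f ch y) = 0" "a \<noteq> 0" for a
    using B_positive[OF F_pts[OF ch y] _ that(2)] that(1) by (simp add: f_def)
  show "c * B (f ch y) (f ch y) = (if c = 0 then 0 else 1)"
    using space_form_quadric[OF F_pts[OF ch y]] by (simp add: f_def)
  show "g ch y v w = B (ddir (f ch) y v) (ddir (f ch) y w)" for v w
    by (simp only: metric induced_metric_def bform_emb ddir_f[OF ch y])
qed

section \<open>From charts to the connected manifold\<close>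

abbreviation S :: "('a, 'n) chart \<Rightarrow> real ^ 'n \<Rightarrow> real ^ 'n \<Rightarrow> real ^ 'n \<Rightarrow> real ^ 'n \<Rightarrow> real ^ 'n \<Rightarrow> real" where
  "S ch \<equiv> chart_hypersurface.S (f ch) B (g ch)"

text \<open>\<open>C\<close> speaks only about the array of numbers \<open>S\<close> takes in a
  frame, so a frame can be moved to another chart without changing what \<open>C\<close>
  sees.\<close>

definition frame_property where
  "frame_property C x \<longleftrightarrow> (\<exists>ch\<in>A. x \<in> fst ch \<and>
     (\<exists>e :: 'n \<Rightarrow> real ^ 'n. orthonormal (g ch (snd ch x)) e \<and>
        C (\<lambda>i j k l. S ch (snd ch x) (e i) (e j) (e k) (e l))))"

lemma frame_property_chart:
  assumes P: "frame_property C x" and ch': "ch' \<in> A" "x \<in> fst ch'"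
  shows "\<exists>e :: 'n \<Rightarrow> real ^ 'n. orthonormal (g ch' (snd ch' x)) e \<and>
    C (\<lambda>i j k l. S ch' (snd ch' x) (e i) (e j) (e k) (e l))"
proof -
  obtain ch and e :: "'n \<Rightarrow> real ^ 'n" where ch: "ch \<in> A" "x \<in> fst ch" and e: "orthonormal (g ch (snd ch x)) e"
    "C (\<lambda>i j k l. S ch (snd ch x) (e i) (e j) (e k) (e l))"
    using P unfolding frame_property_def by blast
  let ?U0 = "snd ch ` (fst ch \<inter> fst ch')"
  define \<phi> where "\<phi> z = snd ch' (chart_inv ch z)" for z
  have "openin (subtopology X (fst ch)) (fst ch \<inter> fst ch')"
    using chart_facts(1)[OF ch'(1)] by (simp add: openin_subtopology_Int2)
  then have "openin (top_of_set (chart_range ch)) ?U0"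
    using homeomorphic_map_openness_eq[OF chart_facts(4)[OF ch(1)]] by blast
  then have U0: "open ?U0" using chart_facts(2)[OF ch(1)] by (rule openin_open_trans)
  have U0s: "?U0 \<subseteq> chart_range ch" by (auto simp: chart_range_def)
  have "smooth_on ?U0 (snd ch' \<circ> chart_inv ch)"
    using manifold ch(1) ch'(1) unfolding smooth_manifold_def by blast
  then have s: "smooth_on ?U0 \<phi>" by (simp add: \<phi>_def[abs_def] o_def)
  have im: "\<phi> ` ?U0 \<subseteq> chart_range ch'"
    using chart_inv_chart[OF ch(1)] by (auto simp: chart_range_def \<phi>_def)
  have ff: "f ch z = f ch' (\<phi> z)" if "z \<in> ?U0" for z
    using that chart_inv_chart[OF ch(1)] chart_inv_chart[OF ch'(1)] by (auto simp: f_def \<phi>_def)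
  have xU0: "snd ch x \<in> ?U0" using ch ch' by blast
  have \<phi>x: "\<phi> (snd ch x) = snd ch' x" by (simp add: chart_inv_chart[OF ch] \<phi>_def)
  note change = second_form_chart_change[OF chart_hypersurface[OF ch(1)] chart_hypersurface[OF ch'(1)] U0 U0s s im ff xU0,
      unfolded \<phi>x]
  let ?e = "\<lambda>i. ddir \<phi> (snd ch x) (e i)"
  have "orthonormal (g ch' (snd ch' x)) ?e"
    using e(1) by (simp add: orthonormal_def change(1))
  moreover have "C (\<lambda>i j k l. S ch' (snd ch' x) (?e i) (?e j) (?e k) (?e l))"
    using e(2) by (simp add: change(2))
  ultimately show ?thesis by (intro exI[of _ ?e] conjI)
qed

text \<open>By \<open>frame_property_chart\<close> failure can be tested in any single chart, so the
  complement is the union of open preimages under the charts.\<close>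

lemma closedin_frame_property:
  assumes op: "\<And>ch. ch \<in> A \<Longrightarrow> open {y \<in> chart_range ch. \<not> (\<exists>e :: 'n \<Rightarrow> real ^ 'n. orthonormal (g ch y) e \<and>
      C (\<lambda>i j k l. S ch y (e i) (e j) (e k) (e l)))}"
  shows "closedin X {x \<in> topspace X. frame_property C x}"
proof -
  let ?N = "\<lambda>ch. {y \<in> chart_range ch. \<not> (\<exists>e :: 'n \<Rightarrow> real ^ 'n. orthonormal (g ch y) e \<and>
      C (\<lambda>i j k l. S ch y (e i) (e j) (e k) (e l)))}"
  have cover: "(\<Union>ch\<in>A. fst ch) = topspace X" using manifold unfolding smooth_manifold_def by blast
  have "topspace X - {x \<in> topspace X. frame_property C x} = (\<Union>ch\<in>A. {x \<in> fst ch. snd ch x \<in> ?N ch})"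
  proof (intro set_eqI iffI)
    fix x assume x: "x \<in> topspace X - {x \<in> topspace X. frame_property C x}"
    then obtain ch where ch: "ch \<in> A" "x \<in> fst ch" using cover by blast
    have "snd ch x \<in> ?N ch" using x ch unfolding frame_property_def chart_range_def by blast
    with ch show "x \<in> (\<Union>ch\<in>A. {x \<in> fst ch. snd ch x \<in> ?N ch})" by blast
  next
    fix x assume "x \<in> (\<Union>ch\<in>A. {x \<in> fst ch. snd ch x \<in> ?N ch})"
    then obtain ch where ch: "ch \<in> A" "x \<in> fst ch" "snd ch x \<in> ?N ch" by blast
    then have "\<not> frame_property C x" using frame_property_chart[OF _ ch(1,2)] by blast
    then show "x \<in> topspace X - {x \<in> topspace X. frame_property C x}" using ch(1,2) cover by blast
  qed
  moreover have "openin X {x \<in> fst ch. snd ch x \<in> ?N ch}" if ch: "ch \<in> A" for ch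
  proof -
    have "openin (top_of_set (chart_range ch)) (?N ch)"
      by (rule open_openin_trans[OF chart_facts(2)[OF ch] op[OF ch]]) auto
    from openin_continuous_map_preimage[OF homeomorphic_imp_continuous_map[OF chart_facts(4)[OF ch]] this]
    have "openin (subtopology X (fst ch)) {x \<in> fst ch. snd ch x \<in> ?N ch}"
      using chart_facts(3)[OF ch] by (simp add: Int_absorb1)
    then show ?thesis using chart_facts(1)[OF ch] openin_trans_full by blast
  qed
  ultimately have "openin X (topspace X - {x \<in> topspace X. frame_property C x})" by auto
  then show ?thesis by (simp add: closedin_def)
qed

lemma locally_isometric_model:
  assumes adm: "admissible c CARD('n) p"
    and types: "\<And>ch y. ch \<in> A \<Longrightarrow> y \<in> chart_range ch \<Longrightarrow>
      \<exists>e I. type_at c (g ch y) (S ch y) (I :: 'n set) e \<and> card I = p"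
  shows "locally_isometric X A g (product_model
    (space_model p (c + (major_curv c CARD('n) p)\<^sup>2)) (space_model (CARD('n) - p) (c + (minor_curv c CARD('n) p)\<^sup>2)))"
    (is "locally_isometric X A g ?M")
  unfolding locally_isometric_def
proof
  fix x assume "x \<in> topspace X"
  then obtain ch where ch: "ch \<in> A" "x \<in> fst ch" using manifold unfolding smooth_manifold_def by blast
  interpret h: chart_hypersurface "chart_range ch" "f ch" B c "g ch" by (rule chart_hypersurface[OF ch(1)])
  let ?k = "c + (major_curv c CARD('n) p)\<^sup>2" and ?l = "c + (minor_curv c CARD('n) p)\<^sup>2"
  have y0: "snd ch x \<in> chart_range ch" using ch(2) by (auto simp: chart_range_def)
  obtain V \<Phi> \<Psi> e and I :: "'n set" where V: "snd ch x \<in> V"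
    and sp: "split_hypersurface (chart_range ch) (f ch) B c (g ch) V \<Phi> \<Psi> ?k ?l"
    and e: "inner_form.frame (g ch (snd ch x)) e" "card I = p"
      "\<And>i. i \<in> I \<Longrightarrow> ddir \<Psi> (snd ch x) (e i) = 0" "\<And>i. i \<notin> I \<Longrightarrow> ddir \<Phi> (snd ch x) (e i) = 0"
    by (rule h.split_hypersurface_exists[OF adm types[OF ch(1)] y0]) blast+
  \<comment> \<open>The squared major curvature is \<bar>c\<bar> times a number greater than 1, so
    the first factor is a sphere for either sign of \<open>c\<close>.\<close>
  have k: "?k > 0"
  proof -
    have "\<bar>c\<bar> < \<bar>c\<bar> * sqrt ((real (CARD('n) - p) - 1) / (real p - 1))"
      using admissible_curv(1)[OF adm] adm by (simp add: admissible_def)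
    then show ?thesis using admissible_curv(3)[OF adm] by linarith
  qed
  have cI: "card (- I) = CARD('n) - p"
    using card_Un_disjoint[of I "- I"] e(2) by simp
  obtain V' W b h where V': "open V'" "snd ch x \<in> V'" "V' \<subseteq> V" and W: "openin (top_of_set (pts ?M)) W"
    and hom: "homeomorphism V' W (\<lambda>y s. B (f ch y) (b s)) h"
    and form: "\<And>u v. bform ?M (\<lambda>s. B u (b s)) (\<lambda>s. B v (b s)) = B u v"
    by (rule split_hypersurface.local_model[OF sp V e(1) _ _ k, where I = I, unfolded cI e(2)])
      (erule e(3), erule e(4), rule that, assumption+)
  have V'ch: "V' \<subseteq> chart_range ch" using V'(3) split_hypersurface.V(3)[OF sp] by blast
  define O' where "O' = {x \<in> fst ch. snd ch x \<in> V'}"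
  \<comment> \<open>A fixed linear image of \<open>F\<close>, defined on all of \<open>X\<close>;
    metric preservation in the other charts thus needs no transition maps. Only the homeomorphism
    property is local.\<close>
  define G where "G = (\<lambda>x s. B (emb (F x)) (b s))"
  have opO: "openin X O'"
  proof -
    have "openin (top_of_set (chart_range ch)) V'"
      by (rule open_openin_trans[OF chart_facts(2)[OF ch(1)] V'(1) V'ch])
    from openin_continuous_map_preimage[OF homeomorphic_imp_continuous_map[OF chart_facts(4)[OF ch(1)]] this]
    have "openin (subtopology X (fst ch)) O'"
      using chart_facts(3)[OF ch(1)] by (simp add: Int_absorb1 O'_def)
    then show ?thesis using chart_facts(1)[OF ch(1)] openin_trans_full by blast
  qed
  have snd: "homeomorphic_map (subtopology X O') (top_of_set V') (snd ch)"
  proof -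
    have "snd ch ` (topspace (subtopology X (fst ch)) \<inter> O') = topspace (top_of_set (chart_range ch)) \<inter> V'"
      using chart_facts(3)[OF ch(1)] V'ch by (auto simp: O'_def chart_range_def)
    from homeomorphic_map_subtopologies[OF chart_facts(4)[OF ch(1)] this]
    have "homeomorphic_map (subtopology X (fst ch \<inter> O')) (top_of_set (chart_range ch \<inter> V')) (snd ch)"
      by (simp add: subtopology_subtopology)
    moreover have "fst ch \<inter> O' = O'" "chart_range ch \<inter> V' = V'" using V'ch by (auto simp: O'_def)
    ultimately show ?thesis by simp
  qed
  have homG: "homeomorphic_map (subtopology X O') (top_of_set W) G"
  proof (rule homeomorphic_map_eq[OF homeomorphic_map_compose[OF snd homeomorphism_imp_homeomorphic_map[OF hom]]])
    fix z assume "z \<in> topspace (subtopology X O')"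
    then have "z \<in> fst ch" by (auto simp: O'_def)
    then show "((\<lambda>y s. B (f ch y) (b s)) \<circ> snd ch) z = G z"
      by (simp add: G_def f_def chart_inv_chart[OF ch(1)])
  qed
  have sub: "snd ch' ` (fst ch' \<inter> O') \<subseteq> chart_range ch'" for ch' by (auto simp: chart_range_def)
  have sG: "smooth_on (chart_range ch') (\<lambda>y. G (chart_inv ch' y) s)" if "ch' \<in> A" for ch' s
    using smooth_on_bilinear[OF bounded_bilinear_B chart_facts(2)[OF that] smooth_f[OF that] smooth_on_const]
    by (simp add: G_def f_def)
  have "smooth_map_on A O' G"
    unfolding smooth_map_on_def using smooth_on_subset[OF sG sub] by blast
  moreover have "bform ?M (differential G ch' y v) (differential G ch' y w) = g ch' y v w"
    if ch': "ch' \<in> A" and y: "y \<in> snd ch' ` (fst ch' \<inter> O')" for ch' y v w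
  proof -
    interpret h': chart_hypersurface "chart_range ch'" "f ch'" B c "g ch'" by (rule chart_hypersurface[OF ch'])
    have yU: "y \<in> chart_range ch'" using y sub by blast
    have "differential G ch' y v = (\<lambda>s. B (ddir (f ch') y v) (b s))" for v
    proof
      fix s
      have "((\<lambda>z. B (f ch' z) (b s)) has_derivative (\<lambda>v. B (ddir (f ch') y v) (b s))) (at y)"
        using bounded_bilinear.FDERIV[OF bounded_bilinear_B h'.D_derivative[OF yU] has_derivative_const[of "b s"]]
        by (simp add: h'.B_simps)
      then have "((\<lambda>z. G (chart_inv ch' z) s) has_derivative (\<lambda>v. B (ddir (f ch') y v) (b s))) (at y)"
        by (simp add: G_def f_def)
      then show "differential G ch' y v s = B (ddir (f ch') y v) (b s)"
        unfolding differential_def by (rule ddirI)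
    qed
    then show ?thesis by (simp add: form h'.g_eq[OF yU])
  qed
  moreover have "x \<in> O'" using ch(2) V'(2) by (simp add: O'_def)
  ultimately show "\<exists>U W \<Phi>. openin X U \<and> x \<in> U \<and> openin (top_of_set (pts ?M)) W \<and>
        homeomorphic_map (subtopology X U) (top_of_set W) \<Phi> \<and> smooth_map_on A U \<Phi> \<and>
        (\<forall>ch\<in>A. \<forall>y\<in>snd ch ` (fst ch \<inter> U). \<forall>v w.
           bform ?M (differential \<Phi> ch y v) (differential \<Phi> ch y w) = g ch y v w)"
    using opO W homG by (intro exI[of _ O'] exI[of _ W] exI[of _ G]) blast
qed

lemma constant_type:
  assumes weak: "weakly_einstein A g" and nE: "\<not> einstein A g" and semi: "semisymmetric A g"
  obtains p where "admissible c CARD('n) p"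
    "\<And>ch y. ch \<in> A \<Longrightarrow> y \<in> chart_range ch \<Longrightarrow>
      \<exists>e I. type_at c (g ch y) (S ch y) (I :: 'n set) e \<and> card I = p"
proof -
  define CE :: "('n \<Rightarrow> 'n \<Rightarrow> 'n \<Rightarrow> 'n \<Rightarrow> real) \<Rightarrow> bool" where
    "CE q \<longleftrightarrow> (\<exists>\<rho>. \<forall>a b. (\<Sum>i\<in>UNIV. q a b i i - q i b a i) = (if a = b then \<rho> else 0))" for q
  define CT :: "'n set \<Rightarrow> ('n \<Rightarrow> 'n \<Rightarrow> 'n \<Rightarrow> 'n \<Rightarrow> real) \<Rightarrow> bool" where
    "CT I q \<longleftrightarrow> (\<forall>i j k l. q i j k l = (if i = j \<and> k = l then type_curv c I i * type_curv c I k + c else 0))" for I q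
  have E: "einstein_at G T e \<longleftrightarrow> orthonormal G e \<and> CE (\<lambda>i j k l. T (e i) (e j) (e k) (e l))"
    for G T and e :: "'n \<Rightarrow> real ^ 'n" by (simp add: einstein_at_def CE_def)
  have TT: "type_at c G T I e \<longleftrightarrow> orthonormal G e \<and> CT I (\<lambda>i j k l. T (e i) (e j) (e k) (e l))"
    for G T I and e :: "'n \<Rightarrow> real ^ 'n" by (simp add: type_at_def CT_def)
  note h = chart_hypersurface
  have clE: "closedin X {x \<in> topspace X. frame_property CE x}"
  proof (rule closedin_frame_property)
    fix ch assume "ch \<in> A"
    from chart_hypersurface.open_not_einstein_at[OF h[OF this]]
    show "open {y \<in> chart_range ch. \<not> (\<exists>e :: 'n \<Rightarrow> real ^ 'n. orthonormal (g ch y) e \<and>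
      CE (\<lambda>i j k l. S ch y (e i) (e j) (e k) (e l)))}" by (simp only: E)
  qed
  have clT: "closedin X {x \<in> topspace X. frame_property (CT I) x}" for I
  proof (rule closedin_frame_property)
    fix ch assume "ch \<in> A"
    from chart_hypersurface.open_not_type_at[OF h[OF this]]
    show "open {y \<in> chart_range ch. \<not> (\<exists>e :: 'n \<Rightarrow> real ^ 'n. orthonormal (g ch y) e \<and>
      CT I (\<lambda>i j k l. S ch y (e i) (e j) (e k) (e l)))}" by (simp only: TT)
  qed
  have cover: "(\<Union>ch\<in>A. fst ch) = topspace X" using manifold unfolding smooth_manifold_def by blast
  have cases: "frame_property CE x \<or> (\<exists>I. frame_property (CT I) x \<and> admissible c CARD('n) (card I))"
    if x: "x \<in> topspace X" for x
  proof -
    obtain ch where ch: "ch \<in> A" "x \<in> fst ch" using x cover by blast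
    have y: "snd ch x \<in> chart_range ch" using ch by (auto simp: chart_range_def)
    have "(\<exists>e :: 'n \<Rightarrow> _. einstein_at (g ch (snd ch x)) (S ch (snd ch x)) e) \<or>
      (\<exists>e I. type_at c (g ch (snd ch x)) (S ch (snd ch x)) I (e :: 'n \<Rightarrow> _) \<and> admissible c CARD('n) (card I))"
      by (rule chart_hypersurface.classification_at[OF h[OF ch(1)] y n3])
        (use semi weak ch(1) y in \<open>auto simp: semisymmetric_def weakly_einstein_def\<close>)
    then show ?thesis unfolding E TT frame_property_def using ch by blast
  qed
  have E_chart: "\<exists>e :: 'n \<Rightarrow> _. einstein_at (g ch (snd ch x)) (S ch (snd ch x)) e"
    if "frame_property CE x" "ch \<in> A" "x \<in> fst ch" for x ch
    unfolding E by (rule frame_property_chart[OF that])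
  have T_chart: "\<exists>e. type_at c (g ch (snd ch x)) (S ch (snd ch x)) I (e :: 'n \<Rightarrow> _)"
    if "frame_property (CT I) x" "ch \<in> A" "x \<in> fst ch" for x ch I
    unfolding TT by (rule frame_property_chart[OF that])
  have ET: False if "frame_property CE x" "frame_property (CT I) x" "admissible c CARD('n) (card I)"
    and x: "x \<in> topspace X" for x I
  proof -
    obtain ch where ch: "ch \<in> A" "x \<in> fst ch" using x cover by blast
    have y: "snd ch x \<in> chart_range ch" using ch by (auto simp: chart_range_def)
    show ?thesis
      using E_chart[OF that(1) ch] T_chart[OF that(2) ch]
        chart_hypersurface.type_at_not_einstein_at[OF h[OF ch(1)] y _ that(3)] by blast
  qed
  have T_unique: "card I = card J" if "frame_property (CT I) x" "admissible c CARD('n) (card I)"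
    "frame_property (CT J) x" "admissible c CARD('n) (card J)" and x: "x \<in> topspace X" for x I J
  proof -
    obtain ch where ch: "ch \<in> A" "x \<in> fst ch" using x cover by blast
    have y: "snd ch x \<in> chart_range ch" using ch by (auto simp: chart_range_def)
    show ?thesis
      using T_chart[OF that(1) ch] T_chart[OF that(3) ch]
        chart_hypersurface.type_at_unique[OF h[OF ch(1)] y _ that(2) _ that(4)] by blast
  qed
  obtain ch1 y1 e1 v w where 1: "ch1 \<in> A" "y1 \<in> chart_range ch1" "orthonormal_frame (g ch1) y1 e1"
    "ricci (g ch1) y1 e1 v w \<noteq> scalar_curv (g ch1) y1 e1 / real CARD('n) * g ch1 y1 v w"
    using nE unfolding einstein_def by blast
  define x1 where "x1 = chart_inv ch1 y1"
  have x1: "x1 \<in> fst ch1" "snd ch1 x1 = y1" "x1 \<in> topspace X"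
    using chart_inv_in[OF 1(2)] chart_chart_inv[OF 1(2)] chart_facts(3)[OF 1(1)] by (auto simp: x1_def)
  have "\<not> frame_property CE x1"
    using E_chart[OF _ 1(1) x1(1)] chart_hypersurface.einstein_at_ricci[OF h[OF 1(1)] 1(2) _ 1(3)] 1(4)
    unfolding x1(2) by blast
  then obtain I1 where I1: "frame_property (CT I1) x1" "admissible c CARD('n) (card I1)"
    using cases[OF x1(3)] by blast
  define p where "p = card I1"
  \<comment> \<open>The set \<open>I\<close> merely labels frame vectors, so types are grouped by
    cardinality. Finitely many sets \<open>I\<close> exist, which keeps both unions closed.\<close>
  define K1 where "K1 = (\<Union>I\<in>{I. card I = p}. {x \<in> topspace X. frame_property (CT I) x})"
  define K2 where "K2 = {x \<in> topspace X. frame_property CE x} \<union>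
    (\<Union>I\<in>{I. admissible c CARD('n) (card I) \<and> card I \<noteq> p}. {x \<in> topspace X. frame_property (CT I) x})"
  have "closedin X (\<Union>I\<in>J. {x \<in> topspace X. frame_property (CT I) x})" for J
    by (intro closedin_Union finite_imageI finite) (use clT in auto)
  then have "closedin X K1" "closedin X K2"
    unfolding K1_def K2_def using clE by (auto intro: closedin_Un)
  moreover have "topspace X \<subseteq> K1 \<union> K2"
    using cases unfolding K1_def K2_def by blast
  moreover have "K1 \<inter> K2 = {}"
  proof -
    have False if x: "x \<in> K1" "x \<in> K2" for x
    proof -
      obtain I where I: "card I = p" "x \<in> topspace X" "frame_property (CT I) x"
        using x(1) unfolding K1_def by blast
      have adm: "admissible c CARD('n) (card I)" using I(1) I1(2) by (simp add: p_def)
      from x(2) consider "frame_property CE x" |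
          J where "frame_property (CT J) x" "admissible c CARD('n) (card J)" "card J \<noteq> p"
        unfolding K2_def by blast
      then show False
      proof cases
        case 1
        then show False by (rule ET[OF _ I(3) adm I(2)])
      next
        case 2
        then show False using T_unique[OF I(3) adm 2(1,2) I(2)] I(1) by simp
      qed
    qed
    then show ?thesis by blast
  qed
  moreover have "x1 \<in> K1" using I1 x1(3) unfolding K1_def p_def by blast
  ultimately have "K2 = {}" using connected unfolding connected_space_closedin by blast
  have "\<exists>e I. type_at c (g ch y) (S ch y) (I :: 'n set) e \<and> card I = p"
    if ch: "ch \<in> A" and y: "y \<in> chart_range ch" for ch y
  proof -
    have x: "chart_inv ch y \<in> fst ch" "snd ch (chart_inv ch y) = y"
      using chart_inv_in[OF y] chart_chart_inv[OF y] by auto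
    then have "chart_inv ch y \<in> K1"
      using \<open>topspace X \<subseteq> K1 \<union> K2\<close> \<open>K2 = {}\<close> chart_facts(3)[OF ch] by blast
    then obtain I where "card I = p" "frame_property (CT I) (chart_inv ch y)" unfolding K1_def by blast
    with T_chart[OF _ ch x(1)] show ?thesis unfolding x(2) by blast
  qed
  then show thesis using I1(2) unfolding p_def by (intro that)
qed

lemma product_classification:
  assumes weak: "weakly_einstein A g" and nE: "\<not> einstein A g" and semi: "semisymmetric A g"
  shows "c \<noteq> 0 \<and>
    (c > 0 \<longrightarrow> (\<exists>p q \<theta>.
       cos \<theta> > 0 \<and> sin \<theta> > 0 \<and> (tan \<theta>) ^ 4 = (real p - 1) / (real q - 1) \<and>
       CARD('n) = p + q \<and> p \<noteq> q \<and>
       locally_isometric X A g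
         (product_model (sphere_model p (c / (sin \<theta>)\<^sup>2)) (sphere_model q (c / (cos \<theta>)\<^sup>2))))) \<and>
    (c < 0 \<longrightarrow> (\<exists>p q \<theta>.
       sinh \<theta> > 0 \<and> (tanh \<theta>) ^ 4 = (real p - 1) / (real q - 1) \<and>
       CARD('n) = p + q \<and> p \<noteq> q \<and>
       locally_isometric X A g
         (product_model (sphere_model p (\<bar>c\<bar> / (sinh \<theta>)\<^sup>2))
            (hyperbolic_model q (- \<bar>c\<bar> / (cosh \<theta>)\<^sup>2)))))"
proof -
  obtain p where adm: "admissible c CARD('n) p"
    and types: "\<And>ch y. ch \<in> A \<Longrightarrow> y \<in> chart_range ch \<Longrightarrow>
      \<exists>e I. type_at c (g ch y) (S ch y) (I :: 'n set) e \<and> card I = p"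
    by (rule constant_type[OF weak nE semi]) blast
  define q where "q = CARD('n) - p"
  define s where "s = sqrt ((real q - 1) / (real p - 1))"
  have pq: "CARD('n) = p + q" "p \<noteq> q" "p \<ge> 2" "c \<noteq> 0" using adm by (auto simp: q_def admissible_def)
  have s: "s > 1" and k: "(major_curv c CARD('n) p)\<^sup>2 = \<bar>c\<bar> * s" and l: "(minor_curv c CARD('n) p)\<^sup>2 = \<bar>c\<bar> / s"
    using admissible_curv(1,3,6)[OF adm] by (simp_all add: s_def q_def)
  have "(real q - 1) / (real p - 1) > 0" using adm by (auto simp: q_def admissible_def of_nat_diff)
  then have "s\<^sup>2 = (real q - 1) / (real p - 1)" by (simp add: s_def)
  then have s2: "(1 / s)\<^sup>2 = (real p - 1) / (real q - 1)" by (simp add: power_divide)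
  have iso: "locally_isometric X A g (product_model (space_model p (c + \<bar>c\<bar> * s)) (space_model q (c + \<bar>c\<bar> / s)))"
    using locally_isometric_model[OF adm types] unfolding k l q_def .
  have pos: "\<exists>p q \<theta>.
       cos \<theta> > 0 \<and> sin \<theta> > 0 \<and> (tan \<theta>) ^ 4 = (real p - 1) / (real q - 1) \<and>
       CARD('n) = p + q \<and> p \<noteq> q \<and>
       locally_isometric X A g
         (product_model (sphere_model p (c / (sin \<theta>)\<^sup>2)) (sphere_model q (c / (cos \<theta>)\<^sup>2)))" if c: "c > 0"
  proof -
    \<comment> \<open>The tangent of the angle: its square is \<open>1 / s\<close>, so
      \<open>c\<close> divided by the squared sine and cosine gives \<open>c * (1 + s)\<close> and
      \<open>c * (1 + 1 / s)\<close>.\<close>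
    define t where "t = 1 / sqrt s"
    have t: "t > 0" "t\<^sup>2 = 1 / s" using s by (simp_all add: t_def power_divide)
    have r: "sqrt (1 + t\<^sup>2) > 0" "(sqrt (1 + t\<^sup>2))\<^sup>2 = 1 + 1 / s" using s by (simp_all add: t(2) add_pos_pos)
    have "(tan (arctan t)) ^ 4 = (t\<^sup>2)\<^sup>2" by (simp add: tan_arctan)
    then have tan: "(tan (arctan t)) ^ 4 = (real p - 1) / (real q - 1)" by (simp only: t(2) s2)
    have sin: "c / (sin (arctan t))\<^sup>2 = c + \<bar>c\<bar> * s" and cos: "c / (cos (arctan t))\<^sup>2 = c + \<bar>c\<bar> / s"
      using s c by (simp_all add: sin_arctan cos_arctan power_divide t(2) field_simps)
    have "c + \<bar>c\<bar> * s > 0" "c + \<bar>c\<bar> / s > 0" using c s by (simp_all add: add_pos_pos)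
    then have "locally_isometric X A g (product_model (sphere_model p (c / (sin (arctan t))\<^sup>2)) (sphere_model q (c / (cos (arctan t))\<^sup>2)))"
      using iso by (simp add: sin cos space_model_def)
    moreover have "cos (arctan t) > 0" "sin (arctan t) > 0"
      using t(1) arctan_lbound[of t] arctan_ubound[of t]
      by (simp_all add: sin_arctan add_pos_nonneg cos_gt_zero_pi)
    ultimately show ?thesis using tan pq(1,2) by blast
  qed
  have neg: "\<exists>p q \<theta>.
       sinh \<theta> > 0 \<and> (tanh \<theta>) ^ 4 = (real p - 1) / (real q - 1) \<and>
       CARD('n) = p + q \<and> p \<noteq> q \<and>
       locally_isometric X A g
         (product_model (sphere_model p (\<bar>c\<bar> / (sinh \<theta>)\<^sup>2))
            (hyperbolic_model q (- \<bar>c\<bar> / (cosh \<theta>)\<^sup>2)))" if c: "c < 0"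
  proof -
    \<comment> \<open>Solves \<open>(tanh \<theta>)\<^sup>2 = 1 / s\<close>: then
      \<open>(sinh \<theta>)\<^sup>2 = 1 / (s - 1)\<close> and
      \<open>(cosh \<theta>)\<^sup>2 = s / (s - 1)\<close>.\<close>
    define \<theta> where "\<theta> = arsinh (1 / sqrt (s - 1))"
    have sh: "sinh \<theta> > 0" "(sinh \<theta>)\<^sup>2 = 1 / (s - 1)"
      using s by (simp_all add: \<theta>_def sinh_arsinh_real power_divide)
    have ch: "(cosh \<theta>)\<^sup>2 = s / (s - 1)"
      using s by (simp add: cosh_square_eq sh(2) field_simps)
    have "(tanh \<theta>) ^ 4 = ((sinh \<theta>)\<^sup>2 / (cosh \<theta>)\<^sup>2)\<^sup>2"
      by (simp add: tanh_def power_divide)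
    also have "\<dots> = (1 / s)\<^sup>2" using s by (simp add: sh(2) ch)
    finally have tanh: "(tanh \<theta>) ^ 4 = (real p - 1) / (real q - 1)" by (simp only: s2)
    have k': "\<bar>c\<bar> / (sinh \<theta>)\<^sup>2 = c + \<bar>c\<bar> * s" and l': "- \<bar>c\<bar> / (cosh \<theta>)\<^sup>2 = c + \<bar>c\<bar> / s"
      using s c by (simp_all add: sh(2) ch field_simps)
    have "c + \<bar>c\<bar> * s > 0" "\<not> c + \<bar>c\<bar> / s > 0"
      unfolding k'[symmetric] l'[symmetric] using sh(1) c by (simp_all add: divide_neg_pos not_less less_imp_le)
    then have "locally_isometric X A g (product_model (sphere_model p (\<bar>c\<bar> / (sinh \<theta>)\<^sup>2))
            (hyperbolic_model q (- \<bar>c\<bar> / (cosh \<theta>)\<^sup>2)))"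
      using iso unfolding k' l' by (simp add: space_model_def)
    then show ?thesis using tanh sh(1) pq(1,2) by blast
  qed
  show ?thesis using pos neg pq(4) by blast
qed

end

theorem theorem3p6:
  fixes X :: "'a topology"
    and A :: "('a, 'n::finite) chart set"
    and F :: "'a \<Rightarrow> nat \<Rightarrow> real"
    and c :: real
    and g :: "('a, 'n) chart \<Rightarrow> 'n local_metric"
  assumes "CARD('n) \<ge> 3"
    and "smooth_manifold X A"
    and "connected_space X"
    and "immersion X A (space_form (CARD('n) + 1) c) F"
    and "g = induced_metric (space_form (CARD('n) + 1) c) F"
    and "weakly_einstein A g"
    and "\<not> einstein A g"
    and "semisymmetric A g"
  shows "c \<noteq> 0 \<and>
    (c > 0 \<longrightarrow> (\<exists>p q \<theta>.
       cos \<theta> > 0 \<and> sin \<theta> > 0 \<and> (tan \<theta>) ^ 4 = (real p - 1) / (real q - 1) \<and>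
       CARD('n) = p + q \<and> p \<noteq> q \<and>
       locally_isometric X A g
         (product_model (sphere_model p (c / (sin \<theta>)\<^sup>2)) (sphere_model q (c / (cos \<theta>)\<^sup>2))))) \<and>
    (c < 0 \<longrightarrow> (\<exists>p q \<theta>.
       sinh \<theta> > 0 \<and> (tanh \<theta>) ^ 4 = (real p - 1) / (real q - 1) \<and>
       CARD('n) = p + q \<and> p \<noteq> q \<and>
       locally_isometric X A g
         (product_model (sphere_model p (\<bar>c\<bar> / (sinh \<theta>)\<^sup>2))
            (hyperbolic_model q (- \<bar>c\<bar> / (cosh \<theta>)\<^sup>2)))))"
proof -
  have bij: "\<exists>idx. bij_betw idx (UNIV :: 'm::finite set) {..<CARD('m)}"
    using ex_bij_betw_finite_nat[of "UNIV :: 'm set"] by (simp add: atLeast0LessThan)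
  show ?thesis
  proof (cases "c = 0")
    case True
    \<comment> \<open>\<open>'n option\<close>, and \<open>'n option option\<close> below, provide
      index types with one and two more elements than \<open>'n\<close>, the dimension of the flat
      ambient space.\<close>
    obtain idx :: "'n option \<Rightarrow> nat" where "bij_betw idx UNIV {..<CARD('n option)}"
      using bij by blast
    then interpret space_form_hypersurface X A F c g idx
      using assms(1-5) True by unfold_locales simp_all
    show ?thesis by (rule product_classification[OF assms(6-8)])
  next
    case False
    obtain idx :: "'n option option \<Rightarrow> nat" where "bij_betw idx UNIV {..<CARD('n option option)}"
      using bij by blast
    then interpret space_form_hypersurface X A F c g idx
      using assms(1-5) False by unfold_locales simp_all
    show ?thesis by (rule product_classification[OF assms(6-8)])
  qed
qed

end
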